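(* Let $f\colon X\to Y$ be a localizing immersion of noetherian schemes that is of finite type. Then $f$ is an open immersion.
   Context: A ring homomorphism $A\to B$ is localizing if $B$ is a localization $S^{-1}A$ of $A$ with $A\to B$ the canonical map. A map $f \colon X \to Y$ of noetherian schemes is localizing if every point $y\in Y$ has an affine open neighborhood $V=\operatorname{Spec}(A)$ such that $f^{-1}V$ is covered by finitely many affine opens $U_i=\operatorname{Spec}(B_i)$ for which the corresponding ring homomorphisms $A\to B_i$ are localizing. A localizing immersion is a localizing map of noetherian schemes that is set-theoretically injective. *)

theory Defs
  imports "HOL-Algebra.Generated_Rings" "HOL-Algebra.Ring_Divisibility"
    "HOL-Analysis.Abstract_Topology"
begin

section \<open>Localization of commutative rings\<close>

text \<open>The fraction \<open>a/s\<close>, as the class of all \<open>(b, t)\<close> with \<open>u (t a - s b) = 0\<close> for some \<open>u\<close> in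
  \<open>S\<close>. The set \<open>S\<close> may contain zero; the localization is then the zero ring.\<close>

definition fraction :: "'r ring \<Rightarrow> 'r set \<Rightarrow> 'r \<Rightarrow> 'r \<Rightarrow> ('r \<times> 'r) set" where
  "fraction R S a s = {(b, t). b \<in> carrier R \<and> t \<in> S \<and>
     (\<exists>u\<in>S. u \<otimes>\<^bsub>R\<^esub> ((t \<otimes>\<^bsub>R\<^esub> a) \<ominus>\<^bsub>R\<^esub> (s \<otimes>\<^bsub>R\<^esub> b)) = \<zero>\<^bsub>R\<^esub>)}"

text \<open>Here and for stalks below, an operation on classes is the union of the results over all
  representatives. These results all coincide, so the union is their common value.\<close>

definition localization :: "'r ring \<Rightarrow> 'r set \<Rightarrow> ('r \<times> 'r) set ring" where
  "localization R S =
    \<lparr> carrier = {fraction R S a s | a s. a \<in> carrier R \<and> s \<in> S},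
      monoid.mult = (\<lambda>p q. \<Union>(a, s)\<in>p. \<Union>(b, t)\<in>q. fraction R S (a \<otimes>\<^bsub>R\<^esub> b) (s \<otimes>\<^bsub>R\<^esub> t)),
      one = fraction R S \<one>\<^bsub>R\<^esub> \<one>\<^bsub>R\<^esub>,
      ring.zero = fraction R S \<zero>\<^bsub>R\<^esub> \<one>\<^bsub>R\<^esub>,
      add = (\<lambda>p q. \<Union>(a, s)\<in>p. \<Union>(b, t)\<in>q.
               fraction R S ((t \<otimes>\<^bsub>R\<^esub> a) \<oplus>\<^bsub>R\<^esub> (s \<otimes>\<^bsub>R\<^esub> b)) (s \<otimes>\<^bsub>R\<^esub> t)) \<rparr>"

definition localizing_hom :: "'r ring \<Rightarrow> 's ring \<Rightarrow> ('r \<Rightarrow> 's) \<Rightarrow> bool" where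
  "localizing_hom A B \<phi> \<longleftrightarrow> \<phi> \<in> ring_hom A B \<and>
     (\<exists>S. submonoid S A \<and>
       (\<exists>h \<in> ring_iso (localization A S) B. \<forall>a\<in>carrier A. h (fraction A S a \<one>\<^bsub>A\<^esub>) = \<phi> a))"

definition finite_type_hom :: "'r ring \<Rightarrow> 's ring \<Rightarrow> ('r \<Rightarrow> 's) \<Rightarrow> bool" where
  "finite_type_hom A B \<phi> \<longleftrightarrow> \<phi> \<in> ring_hom A B \<and>
     (\<exists>F. finite F \<and> F \<subseteq> carrier B \<and> generate_ring B (\<phi> ` carrier A \<union> F) = carrier B)"

definition local_ring :: "'r ring \<Rightarrow> bool" where
  "local_ring R \<longleftrightarrow> cring R \<and> (\<exists>!m. maximalideal m R)"

text \<open>Meant for local rings \<open>A\<close> and \<open>B\<close>: the preimage of the maximal ideal of \<open>B\<close> is that of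
  \<open>A\<close>.\<close>

definition local_hom :: "'r ring \<Rightarrow> 's ring \<Rightarrow> ('r \<Rightarrow> 's) \<Rightarrow> bool" where
  "local_hom A B \<phi> \<longleftrightarrow> \<phi> \<in> ring_hom A B \<and>
     (\<forall>m. maximalideal m B \<longrightarrow> maximalideal {a \<in> carrier A. \<phi> a \<in> m} A)"


section \<open>Locally ringed spaces\<close>

record ('a, 'r) ringed_space =
  rtop :: "'a topology"
  sections :: "'a set \<Rightarrow> 'r ring"
  restr :: "'a set \<Rightarrow> 'a set \<Rightarrow> 'r \<Rightarrow> 'r"  \<comment> \<open>\<open>restr X U V\<close> goes from \<open>U\<close> to \<open>V \<subseteq> U\<close>\<close>

abbreviation points :: "('a, 'r) ringed_space \<Rightarrow> 'a set" where
  "points X \<equiv> topspace (rtop X)"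

locale ringed_space =
  fixes X :: "('a, 'r) ringed_space"
  assumes cring_sections: "openin (rtop X) U \<Longrightarrow> cring (sections X U)"
    and restr_hom: "\<lbrakk>openin (rtop X) U; openin (rtop X) V; V \<subseteq> U\<rbrakk>
      \<Longrightarrow> restr X U V \<in> ring_hom (sections X U) (sections X V)"
    and restr_id: "\<lbrakk>openin (rtop X) U; s \<in> carrier (sections X U)\<rbrakk> \<Longrightarrow> restr X U U s = s"
    and restr_comp: "\<lbrakk>openin (rtop X) U; openin (rtop X) V; openin (rtop X) W; W \<subseteq> V; V \<subseteq> U;
        s \<in> carrier (sections X U)\<rbrakk> \<Longrightarrow> restr X V W (restr X U V s) = restr X U W s"
    and locality: "\<lbrakk>\<And>V. V \<in> \<U> \<Longrightarrow> openin (rtop X) V;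
        s \<in> carrier (sections X (\<Union>\<U>)); t \<in> carrier (sections X (\<Union>\<U>));
        \<And>V. V \<in> \<U> \<Longrightarrow> restr X (\<Union>\<U>) V s = restr X (\<Union>\<U>) V t\<rbrakk> \<Longrightarrow> s = t"
    and gluing: "\<lbrakk>\<And>V. V \<in> \<U> \<Longrightarrow> openin (rtop X) V;
        \<And>V. V \<in> \<U> \<Longrightarrow> \<sigma> V \<in> carrier (sections X V);
        \<And>V W. \<lbrakk>V \<in> \<U>; W \<in> \<U>\<rbrakk> \<Longrightarrow> restr X V (V \<inter> W) (\<sigma> V) = restr X W (V \<inter> W) (\<sigma> W)\<rbrakk>
      \<Longrightarrow> \<exists>s \<in> carrier (sections X (\<Union>\<U>)). \<forall>V\<in>\<U>. restr X (\<Union>\<U>) V s = \<sigma> V"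

definition germ :: "('a, 'r) ringed_space \<Rightarrow> 'a \<Rightarrow> 'a set \<Rightarrow> 'r \<Rightarrow> ('a set \<times> 'r) set" where
  "germ X x U s = {(V, t). openin (rtop X) V \<and> x \<in> V \<and> t \<in> carrier (sections X V) \<and>
     (\<exists>W. openin (rtop X) W \<and> x \<in> W \<and> W \<subseteq> U \<inter> V \<and> restr X U W s = restr X V W t)}"

definition stalk :: "('a, 'r) ringed_space \<Rightarrow> 'a \<Rightarrow> ('a set \<times> 'r) set ring" where
  "stalk X x =
    \<lparr> carrier = {germ X x U s | U s. openin (rtop X) U \<and> x \<in> U \<and> s \<in> carrier (sections X U)},
      monoid.mult = (\<lambda>p q. \<Union>(U, s)\<in>p. \<Union>(V, t)\<in>q.
        germ X x (U \<inter> V)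
          (restr X U (U \<inter> V) s \<otimes>\<^bsub>sections X (U \<inter> V)\<^esub> restr X V (U \<inter> V) t)),
      one = germ X x (points X) \<one>\<^bsub>sections X (points X)\<^esub>,
      ring.zero = germ X x (points X) \<zero>\<^bsub>sections X (points X)\<^esub>,
      add = (\<lambda>p q. \<Union>(U, s)\<in>p. \<Union>(V, t)\<in>q.
        germ X x (U \<inter> V)
          (restr X U (U \<inter> V) s \<oplus>\<^bsub>sections X (U \<inter> V)\<^esub> restr X V (U \<inter> V) t)) \<rparr>"

locale locally_ringed_space = ringed_space +
  assumes local_stalk: "x \<in> points X \<Longrightarrow> local_ring (stalk X x)"

definition open_subspace :: "('a, 'r) ringed_space \<Rightarrow> 'a set \<Rightarrow> ('a, 'r) ringed_space" where
  "open_subspace X U = X\<lparr>rtop := subtopology (rtop X) U\<rparr>"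


section \<open>Morphisms of locally ringed spaces\<close>

text \<open>A morphism \<open>X \<rightarrow> Y\<close> consists of a map on points and, for each open set \<open>V\<close> of \<open>Y\<close>, a map
  from the sections over \<open>V\<close> to the sections over the preimage of \<open>V\<close>.\<close>

record ('a, 'r, 'b, 's) rs_map =
  pt_map :: "'a \<Rightarrow> 'b"
  sec_map :: "'b set \<Rightarrow> 's \<Rightarrow> 'r"

definition preim :: "('a, 'r) ringed_space \<Rightarrow> ('a, 'r, 'b, 's) rs_map \<Rightarrow> 'b set \<Rightarrow> 'a set" where
  "preim X f V = {x \<in> points X. pt_map f x \<in> V}"

definition stalk_map ::
    "('a, 'r) ringed_space \<Rightarrow> ('a, 'r, 'b, 's) rs_map \<Rightarrow> 'a \<Rightarrow> ('b set \<times> 's) set \<Rightarrow> ('a set \<times> 'r) set" where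
  "stalk_map X f x p = (\<Union>(V, t)\<in>p. germ X x (preim X f V) (sec_map f V t))"

locale lrs_morphism =
  fixes X :: "('a, 'r) ringed_space"
    and Y :: "('b, 's) ringed_space"
    and f :: "('a, 'r, 'b, 's) rs_map"
  assumes continuous: "continuous_map (rtop X) (rtop Y) (pt_map f)"
    and sec_map_hom: "openin (rtop Y) V
      \<Longrightarrow> sec_map f V \<in> ring_hom (sections Y V) (sections X (preim X f V))"
    and sec_map_restr: "\<lbrakk>openin (rtop Y) V; openin (rtop Y) W; W \<subseteq> V; t \<in> carrier (sections Y V)\<rbrakk>
      \<Longrightarrow> sec_map f W (restr Y V W t) = restr X (preim X f V) (preim X f W) (sec_map f V t)"
    and local_stalk_map: "x \<in> points X
      \<Longrightarrow> local_hom (stalk Y (pt_map f x)) (stalk X x) (stalk_map X f x)"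

definition rs_id :: "('a, 'r, 'a, 'r) rs_map" where
  "rs_id = \<lparr> pt_map = (\<lambda>x. x), sec_map = (\<lambda>U s. s) \<rparr>"

text \<open>The composite \<open>X \<rightarrow> Y \<rightarrow> Z\<close> of \<open>f\<close> followed by \<open>g\<close>.\<close>

definition rs_comp :: "('b, 's) ringed_space \<Rightarrow> ('b, 's, 'c, 't) rs_map \<Rightarrow> ('a, 'r, 'b, 's) rs_map
    \<Rightarrow> ('a, 'r, 'c, 't) rs_map" where
  "rs_comp Y g f = \<lparr> pt_map = pt_map g \<circ> pt_map f,
                     sec_map = (\<lambda>W. sec_map f (preim Y g W) \<circ> sec_map g W) \<rparr>"

text \<open>Equality of morphisms \<open>X \<rightarrow> Y\<close>. The functions in a record are arbitrary away from points,
  open sets and sections, so equality of records would be too strong.\<close>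

definition rs_eq :: "('a, 'r) ringed_space \<Rightarrow> ('b, 's) ringed_space
    \<Rightarrow> ('a, 'r, 'b, 's) rs_map \<Rightarrow> ('a, 'r, 'b, 's) rs_map \<Rightarrow> bool" where
  "rs_eq X Y f g \<longleftrightarrow> (\<forall>x\<in>points X. pt_map f x = pt_map g x) \<and>
     (\<forall>V. openin (rtop Y) V \<longrightarrow> (\<forall>t\<in>carrier (sections Y V). sec_map f V t = sec_map g V t))"

definition lrs_iso :: "('a, 'r) ringed_space \<Rightarrow> ('b, 's) ringed_space
    \<Rightarrow> ('a, 'r, 'b, 's) rs_map \<Rightarrow> bool" where
  "lrs_iso X Y f \<longleftrightarrow> lrs_morphism X Y f \<and>
     (\<exists>g. lrs_morphism Y X g \<and> rs_eq X X (rs_comp Y g f) rs_id \<and> rs_eq Y Y (rs_comp X f g) rs_id)"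


section \<open>Schemes\<close>

definition zariski_topology :: "'r ring \<Rightarrow> 'r set topology" where
  "zariski_topology A =
     topology (\<lambda>U. \<exists>I. ideal I A \<and> U = {P. primeideal P A \<and> \<not> I \<subseteq> P})"

lemma openin_zariski_topology:
  assumes "cring A"
  shows "openin (zariski_topology A) U \<longleftrightarrow>
    (\<exists>I. ideal I A \<and> U = {P. primeideal P A \<and> \<not> I \<subseteq> P})"
proof -
  interpret cring A by fact
  define D where "D I = {P. primeideal P A \<and> \<not> I \<subseteq> P}" for I
  have sub: "I \<subseteq> carrier A" if "ideal I A" for I
    using that by (simp add: additive_subgroup.a_subset ideal.axioms(1))
  have gen: "Idl\<^bsub>A\<^esub> S \<subseteq> P \<longleftrightarrow> S \<subseteq> P" if "S \<subseteq> carrier A" "primeideal P A" for S P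
    using that genideal_self genideal_minimal primeideal.axioms(1) by (meson subset_trans)
  have "istopology (\<lambda>U. \<exists>I. ideal I A \<and> U = D I)"
    unfolding istopology_def
  proof (intro conjI allI impI)
    fix U V
    assume "\<exists>I. ideal I A \<and> U = D I" "\<exists>I. ideal I A \<and> V = D I"
    then obtain I J where IJ: "ideal I A" "U = D I" "ideal J A" "V = D J" by blast
    have "D I \<inter> D J = D (I \<inter> J)"
    proof (intro equalityI subsetI)
      fix P assume P: "P \<in> D I \<inter> D J"
      then interpret primeideal P A by (simp add: D_def)
      from P obtain a b where ab: "a \<in> I" "a \<notin> P" "b \<in> J" "b \<notin> P" by (auto simp: D_def)
      have abc: "a \<in> carrier A" "b \<in> carrier A" using ab IJ sub by blast+
      have "a \<otimes>\<^bsub>A\<^esub> b \<in> I \<inter> J" "a \<otimes>\<^bsub>A\<^esub> b \<notin> P"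
        using ab abc IJ ideal.I_r_closed ideal.I_l_closed I_prime by fast+
      then show "P \<in> D (I \<inter> J)" using P by (auto simp: D_def)
    qed (auto simp: D_def)
    moreover have "ideal (I \<inter> J) A" using IJ i_intersect by blast
    ultimately show "\<exists>K. ideal K A \<and> U \<inter> V = D K" using IJ by blast
  next
    fix \<K> assume "\<forall>K\<in>\<K>. \<exists>I. ideal I A \<and> K = D I"
    then obtain \<iota> where \<iota>: "\<And>K. K \<in> \<K> \<Longrightarrow> ideal (\<iota> K) A \<and> K = D (\<iota> K)" by metis
    define S where "S = (\<Union>K\<in>\<K>. \<iota> K)"
    have S: "S \<subseteq> carrier A" using \<iota> sub by (auto simp: S_def)
    have "\<Union>\<K> = (\<Union>K\<in>\<K>. D (\<iota> K))" using \<iota> by auto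
    also have "\<dots> = {P. primeideal P A \<and> \<not> S \<subseteq> P}" by (auto simp: D_def S_def)
    also have "\<dots> = D (Idl\<^bsub>A\<^esub> S)" using gen[OF S] by (auto simp: D_def)
    finally show "\<exists>I. ideal I A \<and> \<Union>\<K> = D I" using genideal_ideal[OF S] by blast
  qed
  then show ?thesis unfolding zariski_topology_def D_def[symmetric] by simp
qed

text \<open>The local ring of \<open>A\<close> at the prime \<open>P\<close>.\<close>

abbreviation loc_at :: "'r ring \<Rightarrow> 'r set \<Rightarrow> ('r \<times> 'r) set ring" where
  "loc_at A P \<equiv> localization A (carrier A - P)"

text \<open>Sections over \<open>U\<close> are the functions on \<open>U\<close> with value at \<open>P\<close> in the local ring at \<open>P\<close> that are
  locally given by a fraction \<open>a/b\<close> with \<open>a\<close>, \<open>b\<close> in \<open>A\<close>.\<close>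

definition spec_sections :: "'r ring \<Rightarrow> 'r set set \<Rightarrow> ('r set \<Rightarrow> ('r \<times> 'r) set) ring" where
  "spec_sections A U =
    \<lparr> carrier = {\<sigma> \<in> \<Pi>\<^sub>E P\<in>U. carrier (loc_at A P).
        \<forall>P\<in>U. \<exists>W. openin (zariski_topology A) W \<and> P \<in> W \<and> W \<subseteq> U \<and>
          (\<exists>a\<in>carrier A. \<exists>b\<in>carrier A. \<forall>Q\<in>W. b \<notin> Q \<and> \<sigma> Q = fraction A (carrier A - Q) a b)},
      monoid.mult = (\<lambda>\<sigma> \<tau>. \<lambda>P\<in>U. \<sigma> P \<otimes>\<^bsub>loc_at A P\<^esub> \<tau> P),
      one = (\<lambda>P\<in>U. \<one>\<^bsub>loc_at A P\<^esub>),
      ring.zero = (\<lambda>P\<in>U. \<zero>\<^bsub>loc_at A P\<^esub>),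
      add = (\<lambda>\<sigma> \<tau>. \<lambda>P\<in>U. \<sigma> P \<oplus>\<^bsub>loc_at A P\<^esub> \<tau> P) \<rparr>"

definition Spec :: "'r ring \<Rightarrow> ('r set, 'r set \<Rightarrow> ('r \<times> 'r) set) ringed_space" where
  "Spec A = \<lparr> rtop = zariski_topology A, sections = spec_sections A,
              restr = (\<lambda>U V \<sigma>. restrict \<sigma> V) \<rparr>"

text \<open>It is no loss that \<open>A\<close> has the same element type as the sections of \<open>X\<close>: if \<open>X\<close> is isomorphic
  to \<open>Spec A\<close>, then \<open>A\<close> is isomorphic to the ring of global sections of \<open>X\<close>. For the same reason
  the coordinate ring of an affine open set \<open>U\<close> is taken to be \<open>sections X U\<close> below.\<close>

definition affine_scheme :: "('a, 'r) ringed_space \<Rightarrow> bool" where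
  "affine_scheme (X :: ('a, 'r) ringed_space) \<longleftrightarrow>
     (\<exists>(A :: 'r ring) f. cring A \<and> lrs_iso X (Spec A) f)"

definition affine_open :: "('a, 'r) ringed_space \<Rightarrow> 'a set \<Rightarrow> bool" where
  "affine_open X U \<longleftrightarrow> openin (rtop X) U \<and> affine_scheme (open_subspace X U)"

locale scheme = locally_ringed_space +
  assumes affine_cover: "x \<in> points X \<Longrightarrow> \<exists>U. affine_open X U \<and> x \<in> U"

locale noetherian_scheme = scheme +
  assumes noetherian_cover: "\<exists>\<U>. finite \<U> \<and> \<Union>\<U> = points X \<and>
    (\<forall>U\<in>\<U>. affine_open X U \<and> noetherian_ring (sections X U))"

text \<open>For \<open>U\<close> contained in the preimage of \<open>V\<close>, the ring homomorphism from the sections over \<open>V\<close>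
  to the sections over \<open>U\<close>.\<close>

definition induced_hom :: "('a, 'r) ringed_space \<Rightarrow> ('a, 'r, 'b, 's) rs_map
    \<Rightarrow> 'b set \<Rightarrow> 'a set \<Rightarrow> 's \<Rightarrow> 'r" where
  "induced_hom X f V U = restr X (preim X f V) U \<circ> sec_map f V"

definition finite_type :: "('a, 'r) ringed_space \<Rightarrow> ('b, 's) ringed_space
    \<Rightarrow> ('a, 'r, 'b, 's) rs_map \<Rightarrow> bool" where
  "finite_type X Y f \<longleftrightarrow> lrs_morphism X Y f \<and>
     (\<exists>\<V>. \<Union>\<V> = points Y \<and> (\<forall>V\<in>\<V>. affine_open Y V \<and>
       (\<exists>\<U>. finite \<U> \<and> \<Union>\<U> = preim X f V \<and>
         (\<forall>U\<in>\<U>. affine_open X U \<and>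
           finite_type_hom (sections Y V) (sections X U) (induced_hom X f V U)))))"

text \<open>The data of a morphism with image in an open set \<open>V\<close> are at the same time the data of the
  morphism that it induces to the open subspace \<open>V\<close>.\<close>

definition open_immersion :: "('a, 'r) ringed_space \<Rightarrow> ('b, 's) ringed_space
    \<Rightarrow> ('a, 'r, 'b, 's) rs_map \<Rightarrow> bool" where
  "open_immersion X Y f \<longleftrightarrow> lrs_morphism X Y f \<and>
     (\<exists>V. openin (rtop Y) V \<and> lrs_iso X (open_subspace Y V) f)"

locale localizing_map =
  X: noetherian_scheme X + Y: noetherian_scheme Y + lrs_morphism X Y f
  for X :: "('a, 'r) ringed_space"
    and Y :: "('b, 's) ringed_space"
    and f :: "('a, 'r, 'b, 's) rs_map" +
  assumes localizing: "y \<in> points Y \<Longrightarrow>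
    \<exists>V. affine_open Y V \<and> y \<in> V \<and>
      (\<exists>\<U>. finite \<U> \<and> \<Union>\<U> = preim X f V \<and>
        (\<forall>U\<in>\<U>. affine_open X U \<and>
          localizing_hom (sections Y V) (sections X U) (induced_hom X f V U)))"

locale localizing_immersion = localizing_map +
  assumes injective: "inj_on (pt_map f) (points X)"

end

theory Submission
  imports Defs
begin

text \<open>If \<open>B = S\<^sup>-\<^sup>1 A\<close> and \<open>Q\<close> is a prime of \<open>B\<close> with preimage \<open>P\<close>, then \<open>A\<^sub>P \<rightarrow> B\<^sub>Q\<close> is bijective.
  Hence a localizing map is bijective on germs: a section of \<open>Y\<close> whose pullback vanishes near \<open>x\<close>
  vanishes near \<open>f x\<close>, and every germ at \<open>x\<close> is pulled back from \<open>f x\<close>.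

  If moreover \<open>x\<close> has an affine neighbourhood \<open>Spec B\<close> of finite type over \<open>Spec A\<close>, then finitely
  many germs at \<open>f x\<close> account for the generators of \<open>B\<close>, and, \<open>Y\<close> being noetherian, finitely many
  germs generate the kernel. So after shrinking around \<open>x\<close> the coordinate ring of the source becomes
  \<open>A\<^sub>w\<close> for a single \<open>w\<close> in \<open>A\<close>, and the image of the shrunken neighbourhood is the whole of \<open>D(w)\<close>.
  Thus \<open>f\<close> is open. Being injective, it is a homeomorphism onto an open subset, and bijectivity on
  germs makes the maps on sections over open subsets of the image bijective.\<close>

section \<open>Ideals and fractions\<close>

text \<open>The localizing charts and the finite type charts come from unrelated covers, so a
  generator over a finite type chart cannot be handled directly as a fraction over a localizing
  chart. Everything therefore passes through germs: the localizing hypothesis enters only at a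
  point, through \<open>vanishing_descends\<close> and \<open>section_descends\<close>, and what it
  yields is rewritten over whichever affine open set is at hand by \<open>affine_fraction\<close>
  and \<open>affine_vanish\<close>. The ring \<open>A\<^sub>w\<close> is never formed. It is
  replaced by two properties of a homomorphism out of \<open>A\<close>: every element of the target
  becomes an image after multiplication by a power of \<open>w\<close>, and every element of the
  kernel is killed by a power of \<open>w\<close>. This is enough to lift the primes that miss
  \<open>w\<close>. An affine open set is known only through an isomorphism with some
  \<open>Spec A\<close>. Facts about spectra are therefore first restated for
  \<open>sections X U\<close>, with the nonvanishing loci \<open>basic_open\<close> in place of
  prime ideals; \<open>affine_prime_of_point\<close> and \<open>affine_point_of_prime\<close>
  translate between points and primes.\<close>

lemma UN_pairs_const:
  assumes "p \<noteq> {}" "q \<noteq> {}"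
    and "\<And>a s b t. \<lbrakk>(a, s) \<in> p; (b, t) \<in> q\<rbrakk> \<Longrightarrow> F a s b t = c"
  shows "(\<Union>(a, s)\<in>p. \<Union>(b, t)\<in>q. F a s b t) = c"
proof -
  have "(\<Union>(b, t)\<in>q. F a s b t) = c" if "(a, s) \<in> p" for a s
    using assms(2) assms(3)[OF that] by force
  then show ?thesis using assms(1) by force
qed

section \<open>Prime ideals that miss the powers of an element\<close>

context cring
begin

text \<open>Negation is multiplication by \<open>\<ominus> \<one>\<close>, so absorption already
  covers it; this shortens the many ideal checks below.\<close>

lemma ideal_of_closed:
  assumes "I \<subseteq> carrier R" "\<zero> \<in> I" "\<And>a b. \<lbrakk>a \<in> I; b \<in> I\<rbrakk> \<Longrightarrow> a \<oplus> b \<in> I"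
    and "\<And>a x. \<lbrakk>a \<in> I; x \<in> carrier R\<rbrakk> \<Longrightarrow> x \<otimes> a \<in> I"
  shows "ideal I R"
proof (rule idealI)
  show "subgroup I (add_monoid R)"
  proof (rule add.subgroupI)
    fix a assume a: "a \<in> I"
    then have "\<ominus> a = (\<ominus> \<one>) \<otimes> a" using assms(1) by (simp add: l_minus subset_iff)
    then show "\<ominus> a \<in> I" using assms(4)[OF a, of "\<ominus> \<one>"] by simp
  qed (use assms in auto)
  show "\<And>a x. \<lbrakk>a \<in> I; x \<in> carrier R\<rbrakk> \<Longrightarrow> a \<otimes> x \<in> I"
    using assms(1,4) m_comm by (metis subsetD)
qed (use assms ring_axioms in auto)

text \<open>Zorn gives an ideal that is maximal among those missing all powers of \<open>g\<close>;
  enlarging it by any outside element picks up a power of \<open>g\<close>, and multiplying two such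
  relations shows that it is prime. Its maximality is exported as well, because for
  \<open>g = \<one>\<close> it yields maximal ideals.\<close>

lemma ideal_avoiding_maximal:
  assumes I: "ideal I R" and g: "g \<in> carrier R" and avoid: "\<And>n::nat. g [^] n \<notin> I"
  obtains P where "primeideal P R" "I \<subseteq> P" "g \<notin> P"
    "\<And>J. \<lbrakk>ideal J R; P \<subseteq> J; \<And>n::nat. g [^] n \<notin> J\<rbrakk> \<Longrightarrow> J = P"
proof -
  define \<A> where "\<A> = {J. ideal J R \<and> I \<subseteq> J \<and> (\<forall>n::nat. g [^] n \<notin> J)}"
  have "\<exists>P\<in>\<A>. \<forall>J\<in>\<A>. P \<subseteq> J \<longrightarrow> J = P"
  proof (rule subset_Zorn_nonempty)
    show "\<A> \<noteq> {}" using I avoid by (auto simp: \<A>_def)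
    fix \<C> assume ne: "\<C> \<noteq> {}" and ch: "subset.chain \<A> \<C>"
    have "subset.chain {I. ideal I R} \<C>"
      using ch by (auto simp: subset.chain_def \<A>_def)
    then have "ideal (\<Union>\<C>) R" using chain_Union_is_ideal[of \<C>] ne by simp
    then show "\<Union>\<C> \<in> \<A>" using ne ch by (auto simp: \<A>_def subset.chain_def)
  qed
  then obtain P where PA: "P \<in> \<A>" and max: "\<And>J. \<lbrakk>J \<in> \<A>; P \<subseteq> J\<rbrakk> \<Longrightarrow> J = P" by blast
  interpret P: ideal P R using PA by (simp add: \<A>_def)
  have zeroP: "\<zero> \<in> P" using additive_subgroup.zero_closed[OF P.is_additive_subgroup] .
  have avP: "g [^] n \<notin> P" for n :: nat using PA by (simp add: \<A>_def)
  have IP: "I \<subseteq> P" using PA by (simp add: \<A>_def)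
  \<comment> \<open>The ideal generated by \<open>P\<close> and \<open>a\<close> is strictly larger
    than \<open>P\<close>, so it must contain a power of \<open>g\<close>.\<close>
  have reach: "\<exists>p\<in>P. \<exists>r\<in>carrier R. \<exists>n::nat. g [^] n = p \<oplus> r \<otimes> a"
    if a: "a \<in> carrier R" "a \<notin> P" for a
  proof (rule ccontr)
    assume no: "\<not> ?thesis"
    define J where "J = {p \<oplus> r \<otimes> a | p r. p \<in> P \<and> r \<in> carrier R}"
    have "ideal J R"
    proof (rule ideal_of_closed)
      show "J \<subseteq> carrier R" using a by (auto simp: J_def)
      have "\<zero> = \<zero> \<oplus> \<zero> \<otimes> a" using a by simp
      then show "\<zero> \<in> J" unfolding J_def using zeroP zero_closed by blast
    next
      fix b c assume "b \<in> J" "c \<in> J"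
      then obtain p r q s where *: "b = p \<oplus> r \<otimes> a" "c = q \<oplus> s \<otimes> a" "p \<in> P" "q \<in> P"
        "r \<in> carrier R" "s \<in> carrier R" by (auto simp: J_def)
      then have [simp]: "p \<in> carrier R" "q \<in> carrier R" by auto
      have "b \<oplus> c = (p \<oplus> q) \<oplus> (r \<oplus> s) \<otimes> a" using * a by (simp add: l_distr a_ac)
      then show "b \<oplus> c \<in> J" unfolding J_def using * by blast
    next
      fix b x assume "b \<in> J" and x: "x \<in> carrier R"
      then obtain p r where *: "b = p \<oplus> r \<otimes> a" "p \<in> P" "r \<in> carrier R" by (auto simp: J_def)
      then have [simp]: "p \<in> carrier R" by auto
      have "x \<otimes> b = x \<otimes> p \<oplus> (x \<otimes> r) \<otimes> a" using * a x by (simp add: r_distr m_assoc)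
      then show "x \<otimes> b \<in> J" unfolding J_def using * x P.I_l_closed by blast
    qed
    moreover have PJ: "P \<subseteq> J"
    proof
      fix p assume "p \<in> P"
      moreover then have "p = p \<oplus> \<zero> \<otimes> a" using a by simp
      ultimately show "p \<in> J" unfolding J_def by blast
    qed
    moreover have "\<forall>n::nat. g [^] n \<notin> J" using no by (auto simp: J_def)
    ultimately have "J = P" using max IP by (auto simp: \<A>_def)
    moreover have "\<zero> \<oplus> \<one> \<otimes> a \<in> J"
      unfolding J_def using zeroP one_closed by (intro CollectI exI conjI) (rule refl)
    ultimately show False using a by simp
  qed
  have "primeideal P R"
  proof (rule primeidealI)
    show "carrier R \<noteq> P" using avP[of 0] by auto
    fix a b assume ab: "a \<in> carrier R" "b \<in> carrier R" "a \<otimes> b \<in> P"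
    show "a \<in> P \<or> b \<in> P"
    proof (rule ccontr)
      assume "\<not> ?thesis"
      then obtain p r q s and m n :: nat where *: "p \<in> P" "r \<in> carrier R" "q \<in> P" "s \<in> carrier R"
        "g [^] m = p \<oplus> r \<otimes> a" "g [^] n = q \<oplus> s \<otimes> b" using reach ab by metis
      then have pq [simp]: "p \<in> carrier R" "q \<in> carrier R" by auto
      \<comment> \<open>Each term of the expanded product has a factor \<open>p\<close>,
        \<open>q\<close> or \<open>a \<otimes> b\<close>, all of which lie in
        \<open>P\<close>.\<close>
      have "g [^] (m + n) = (p \<oplus> r \<otimes> a) \<otimes> (q \<oplus> s \<otimes> b)"
        using * g by (simp add: nat_pow_mult[symmetric])
      also have "\<dots> = (q \<oplus> s \<otimes> b) \<otimes> p \<oplus> ((r \<otimes> a) \<otimes> q \<oplus> (r \<otimes> s) \<otimes> (a \<otimes> b))"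
        using pq ab(1,2) *(2,4) by algebra
      also have "\<dots> \<in> P"
        by (intro P.a_closed P.I_l_closed[OF ab(3)] P.I_l_closed[OF *(1)] P.I_l_closed[OF *(3)])
          (use * ab in auto)
      finally show False using avP by blast
    qed
  qed (use P.is_ideal is_cring in auto)
  moreover have "g \<notin> P" using avP[of 1] g by simp
  moreover have "J = P" if "ideal J R" "P \<subseteq> J" "\<And>n::nat. g [^] n \<notin> J" for J
    using max[of J] that IP by (auto simp: \<A>_def)
  ultimately show ?thesis using that[of P] IP by blast
qed

text \<open>Take \<open>g = \<one>\<close> in \<open>ideal_avoiding_maximal\<close>: missing the
  powers of \<open>\<one>\<close> means being proper.\<close>

lemma nonunit_in_maximalideal:
  assumes a: "a \<in> carrier R" "a \<notin> Units R"
  obtains m where "maximalideal m R" "a \<in> m"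
proof -
  have no1: "\<one> \<notin> PIdl a"
    using a unfolding cgenideal_def Units_def by (auto simp: m_comm)
  have idl: "ideal (PIdl a) R" using a by (simp add: cgenideal_ideal)
  obtain P where P: "primeideal P R" "PIdl a \<subseteq> P" "\<one> \<notin> P"
    and max: "\<And>J. \<lbrakk>ideal J R; P \<subseteq> J; \<And>n::nat. \<one> [^] n \<notin> J\<rbrakk> \<Longrightarrow> J = P"
    using ideal_avoiding_maximal[OF idl one_closed] no1 by (metis nat_pow_one)
  interpret P: primeideal P R by fact
  have "maximalideal P R"
  proof (rule maximalidealI)
    fix J assume J: "ideal J R" "P \<subseteq> J" "J \<subseteq> carrier R"
    show "J = P \<or> J = carrier R"
      using max[OF J(1,2)] J ideal.one_imp_carrier[OF J(1)] by (metis nat_pow_one)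
  qed (use P.is_ideal P in auto)
  moreover have "a \<in> P" using P(2) a cgenideal_self by blast
  ultimately show ?thesis using that by blast
qed

lemma submonoid_compl_prime:
  assumes "primeideal P R" shows "submonoid (carrier R - P) R"
proof -
  interpret P: primeideal P R by fact
  show ?thesis using P.I_prime P.I_notcarr P.one_imp_carrier
    by (auto simp: submonoid_def)
qed

text \<open>If the annihilator of \<open>a\<close> contained no power of \<open>g\<close>, some
  prime missing \<open>g\<close> would contain it, against \<open>van\<close>. This is the
  injectivity of the map from the localization at \<open>g\<close> to the product of the local rings
  over \<open>D(g)\<close>.\<close>

lemma vanishing_on_basic_open:
  assumes a: "a \<in> carrier R" and g: "g \<in> carrier R"
    and van: "\<And>P. \<lbrakk>primeideal P R; g \<notin> P\<rbrakk> \<Longrightarrow> \<exists>u\<in>carrier R - P. u \<otimes> a = \<zero>"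
  shows "\<exists>n::nat. g [^] n \<otimes> a = \<zero>"
proof (rule ccontr)
  assume no: "\<not> ?thesis"
  define I where "I = {c \<in> carrier R. c \<otimes> a = \<zero>}"
  have "ideal I R" by (rule ideal_of_closed) (use a in \<open>auto simp: I_def l_distr m_assoc\<close>)
  moreover have "g [^] n \<notin> I" for n :: nat using no by (auto simp: I_def)
  ultimately obtain P where "primeideal P R" "I \<subseteq> P" "g \<notin> P"
    using ideal_avoiding_maximal[OF _ g] by metis
  then show False using van[of P] by (auto simp: I_def)
qed

text \<open>The elements that lie in the ideal of some finite subset of \<open>H\<close> form an
  ideal containing \<open>H\<close>. Together with \<open>power_in_genideal\<close> this is the
  quasi-compactness of basic open sets of a spectrum.\<close>

lemma genideal_finite_subset:
  assumes H: "H \<subseteq> carrier R" and c: "c \<in> Idl H"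
  shows "\<exists>F. finite F \<and> F \<subseteq> H \<and> c \<in> Idl F"
proof -
  define K where "K = {c. \<exists>F. finite F \<and> F \<subseteq> H \<and> c \<in> Idl F}"
  have idl: "ideal (Idl F) R" if "F \<subseteq> H" for F using that H genideal_ideal by blast
  have mono: "Idl F \<subseteq> Idl G" if "F \<subseteq> G" for F G using that by (auto simp: genideal_def)
  have "ideal K R"
  proof (rule ideal_of_closed)
    show "K \<subseteq> carrier R"
      using idl by (auto simp: K_def dest!: ideal.Icarr)
    show "\<zero> \<in> K" using idl[of "{}"] additive_subgroup.zero_closed[OF ideal.axioms(1)]
      by (auto simp: K_def intro!: exI[of _ "{}"])
    show "a \<oplus> b \<in> K" if "a \<in> K" "b \<in> K" for a b
    proof -
      from that obtain F G where FG: "finite F" "F \<subseteq> H" "a \<in> Idl F" "finite G" "G \<subseteq> H" "b \<in> Idl G"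
        by (auto simp: K_def)
      then have "a \<in> Idl (F \<union> G)" "b \<in> Idl (F \<union> G)"
        using mono[of F "F \<union> G"] mono[of G "F \<union> G"] by auto
      then have "a \<oplus> b \<in> Idl (F \<union> G)"
        using additive_subgroup.a_closed[OF ideal.axioms(1)[OF idl]] FG by auto
      then show ?thesis unfolding K_def using FG
        by (intro CollectI exI[of _ "F \<union> G"]) auto
    qed
    show "x \<otimes> a \<in> K" if a: "a \<in> K" and x: "x \<in> carrier R" for a x
    proof -
      from a obtain F where F: "finite F" "F \<subseteq> H" "a \<in> Idl F" by (auto simp: K_def)
      then show ?thesis using ideal.I_l_closed[OF idl[OF F(2)] F(3) x] by (auto simp: K_def)
    qed
  qed
  moreover have "H \<subseteq> K"
  proof
    fix h assume "h \<in> H"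
    then have "finite {h}" "{h} \<subseteq> H" "h \<in> Idl {h}" using genideal_self'[of h] H by auto
    then show "h \<in> K" unfolding K_def by blast
  qed
  ultimately show ?thesis using c genideal_minimal[of K H] by (auto simp: K_def)
qed

lemma genideal_subset_prime:
  assumes "H \<subseteq> carrier R" "primeideal P R" "Idl H \<subseteq> P"
  shows "H \<subseteq> P"
  using genideal_self[OF assms(1)] assms(3) by blast

text \<open>Otherwise some prime would contain \<open>Idl H\<close> and miss \<open>g\<close>, hence
  would be a point of \<open>D(g)\<close> that no \<open>D(h)\<close> covers. This turns a cover of
  \<open>D(g)\<close> into an algebraic relation.\<close>

lemma power_in_genideal:
  assumes H: "H \<subseteq> carrier R" and g: "g \<in> carrier R"
    and cov: "\<And>P. \<lbrakk>primeideal P R; g \<notin> P\<rbrakk> \<Longrightarrow> \<exists>h\<in>H. h \<notin> P"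
  shows "\<exists>n::nat. g [^] n \<in> Idl H"
proof (rule ccontr)
  assume "\<not> ?thesis"
  then obtain P where "primeideal P R" "Idl H \<subseteq> P" "g \<notin> P"
    using ideal_avoiding_maximal[OF genideal_ideal[OF H] g] by metis
  then show False using cov[of P] genideal_subset_prime[OF H] by blast
qed

lemma prime_pow_mem:
  assumes "primeideal P R" "h \<in> carrier R" "h [^] (n::nat) \<in> P" shows "h \<in> P"
proof -
  interpret P: primeideal P R by fact
  show ?thesis using assms(3)
  proof (induction n)
    case 0
    then show ?case using P.one_imp_carrier P.I_notcarr by simp
  next
    case (Suc n)
    then show ?case using P.I_prime[of "h [^] n" h] assms(2) by auto
  qed
qed

end

text \<open>The locale \<open>cring\<close> fixes a ring of any record extension, whereas
  \<open>fraction\<close> and \<open>localization\<close> are typed for a plain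
  \<open>'r ring\<close>; the restriction makes them applicable to \<open>R\<close>.\<close>

locale plain_cring = cring R for R :: "'r ring" (structure)
begin

text \<open>A fraction is a full class of pairs, so equality of fractions amounts to symmetry and
  transitivity of the relation that defines the class.\<close>

lemma fraction_eqI:
  assumes S: "submonoid S R"
    and c: "a \<in> carrier R" "b \<in> carrier R" "s \<in> S" "t \<in> S"
    and u: "u \<in> S" "u \<otimes> (t \<otimes> a \<ominus> s \<otimes> b) = \<zero>"
  shows "fraction R S a s = fraction R S b t"
proof -
  interpret S: submonoid S R by fact
  have [simp]: "x \<in> carrier R" if "x \<in> S" for x using that S.subset by blast
  have one_side: "fraction R S a s \<subseteq> fraction R S b t"
    if c: "a \<in> carrier R" "b \<in> carrier R" "s \<in> S" "t \<in> S"
      and u: "u \<in> S" "u \<otimes> (t \<otimes> a \<ominus> s \<otimes> b) = \<zero>" for a b s t u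
  proof
    fix z assume "z \<in> fraction R S a s"
    then obtain d r v where z: "z = (d, r)" "d \<in> carrier R" "r \<in> S" "v \<in> S"
      "v \<otimes> (r \<otimes> a \<ominus> s \<otimes> d) = \<zero>" by (auto simp: fraction_def)
    have cs: "s \<in> carrier R" "t \<in> carrier R" "r \<in> carrier R" "u \<in> carrier R" "v \<in> carrier R"
      using z c u by auto
    \<comment> \<open>Transitivity through the middle fraction \<open>a/s\<close>: its denominator
      \<open>s\<close> has to be part of the annihilating multiplier.\<close>
    have "(u \<otimes> v \<otimes> s) \<otimes> (r \<otimes> b \<ominus> t \<otimes> d)
      = (u \<otimes> t) \<otimes> (v \<otimes> (r \<otimes> a \<ominus> s \<otimes> d)) \<ominus> (v \<otimes> r) \<otimes> (u \<otimes> (t \<otimes> a \<ominus> s \<otimes> b))"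
      using c(1,2) z(2) cs by algebra
    also have "\<dots> = \<zero>" using z(5) u(2) cs by (simp add: a_minus_def)
    finally show "z \<in> fraction R S b t" using z c u by (auto simp: fraction_def)
  qed
  have cs: "s \<in> carrier R" "t \<in> carrier R" "u \<in> carrier R" using c u by auto
  have "u \<otimes> (s \<otimes> b \<ominus> t \<otimes> a) = \<ominus> (u \<otimes> (t \<otimes> a \<ominus> s \<otimes> b))" using c(1,2) cs by algebra
  then have "u \<otimes> (s \<otimes> b \<ominus> t \<otimes> a) = \<zero>" using u by simp
  then show ?thesis using one_side[OF c u] one_side[OF c(2,1,4,3) u(1)] by blast
qed

lemma fraction_self:
  assumes S: "submonoid S R" and c: "a \<in> carrier R" "s \<in> S"
  shows "(a, s) \<in> fraction R S a s"
proof -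
  interpret S: submonoid S R by fact
  have "s \<in> carrier R" using S.subset c by blast
  then have "\<one> \<otimes> (s \<otimes> a \<ominus> s \<otimes> a) = \<zero>" using c(1) by algebra
  then show ?thesis unfolding fraction_def using c S.one_closed by blast
qed

lemma fraction_eqD:
  assumes S: "submonoid S R"
    and c: "a \<in> carrier R" "b \<in> carrier R" "s \<in> S" "t \<in> S"
    and eq: "fraction R S a s = fraction R S b t"
  obtains u where "u \<in> S" "u \<otimes> (t \<otimes> a \<ominus> s \<otimes> b) = \<zero>"
proof -
  have "(b, t) \<in> fraction R S a s" using fraction_self[OF S c(2,4)] eq by simp
  then show ?thesis using that by (auto simp: fraction_def)
qed

lemma fraction_memD:
  assumes S: "submonoid S R" and c: "a \<in> carrier R" "s \<in> S" and "(b, t) \<in> fraction R S a s"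
  shows "b \<in> carrier R" "t \<in> S" "fraction R S b t = fraction R S a s"
proof -
  obtain u where u: "b \<in> carrier R" "t \<in> S" "u \<in> S" "u \<otimes> (t \<otimes> a \<ominus> s \<otimes> b) = \<zero>"
    using assms(4) by (auto simp: fraction_def)
  show "b \<in> carrier R" "t \<in> S" "fraction R S b t = fraction R S a s"
    using u fraction_eqI[OF S c(1) u(1) c(2) u(2-4)] by auto
qed

text \<open>The product is defined as a union over representatives; all members of the union agree
  because the difference of two products splits into multiples of the two given relations.\<close>

lemma localization_mult:
  assumes S: "submonoid S R" and c: "a \<in> carrier R" "b \<in> carrier R" "s \<in> S" "t \<in> S"
  shows "fraction R S a s \<otimes>\<^bsub>localization R S\<^esub> fraction R S b t = fraction R S (a \<otimes> b) (s \<otimes> t)"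
proof -
  interpret S: submonoid S R by fact
  have [simp]: "x \<in> carrier R" if "x \<in> S" for x using that S.subset by blast
  have key: "fraction R S (a' \<otimes> b') (s' \<otimes> t') = fraction R S (a \<otimes> b) (s \<otimes> t)"
    if as: "(a', s') \<in> fraction R S a s" and bt: "(b', t') \<in> fraction R S b t" for a' s' b' t'
  proof -
    note as' = fraction_memD[OF S c(1,3) as] note bt' = fraction_memD[OF S c(2,4) bt]
    obtain u v where u: "u \<in> S" "u \<otimes> (s \<otimes> a' \<ominus> s' \<otimes> a) = \<zero>"
      and v: "v \<in> S" "v \<otimes> (t \<otimes> b' \<ominus> t' \<otimes> b) = \<zero>"
      using fraction_eqD[OF S as'(1) c(1) as'(2) c(3) as'(3)]
        fraction_eqD[OF S bt'(1) c(2) bt'(2) c(4) bt'(3)] by metis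
    have cs [simp]: "s \<in> carrier R" "t \<in> carrier R" "s' \<in> carrier R" "t' \<in> carrier R"
      "u \<in> carrier R" "v \<in> carrier R" "a' \<in> carrier R" "b' \<in> carrier R"
      using c u v as' bt' by auto
    have "(u \<otimes> v) \<otimes> ((s \<otimes> t) \<otimes> (a' \<otimes> b') \<ominus> (s' \<otimes> t') \<otimes> (a \<otimes> b))
      = (v \<otimes> t \<otimes> b') \<otimes> (u \<otimes> (s \<otimes> a' \<ominus> s' \<otimes> a)) \<oplus> (u \<otimes> s' \<otimes> a) \<otimes> (v \<otimes> (t \<otimes> b' \<ominus> t' \<otimes> b))"
      using c(1,2) cs by algebra
    also have "\<dots> = \<zero>" using u v c by simp
    finally show ?thesis using as' bt' u v c
      by (intro fraction_eqI[OF S, where u = "u \<otimes> v"]) auto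
  qed
  have "fraction R S a s \<noteq> {}" "fraction R S b t \<noteq> {}"
    using fraction_self[OF S c(1,3)] fraction_self[OF S c(2,4)] by auto
  then show ?thesis using UN_pairs_const[OF _ _ key] by (simp add: localization_def)
qed

lemma localization_add:
  assumes S: "submonoid S R" and c: "a \<in> carrier R" "b \<in> carrier R" "s \<in> S" "t \<in> S"
  shows "fraction R S a s \<oplus>\<^bsub>localization R S\<^esub> fraction R S b t
    = fraction R S (t \<otimes> a \<oplus> s \<otimes> b) (s \<otimes> t)"
proof -
  interpret S: submonoid S R by fact
  have [simp]: "x \<in> carrier R" if "x \<in> S" for x using that S.subset by blast
  have key: "fraction R S (t' \<otimes> a' \<oplus> s' \<otimes> b') (s' \<otimes> t') = fraction R S (t \<otimes> a \<oplus> s \<otimes> b) (s \<otimes> t)"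
    if as: "(a', s') \<in> fraction R S a s" and bt: "(b', t') \<in> fraction R S b t" for a' s' b' t'
  proof -
    note as' = fraction_memD[OF S c(1,3) as] note bt' = fraction_memD[OF S c(2,4) bt]
    obtain u v where u: "u \<in> S" "u \<otimes> (s \<otimes> a' \<ominus> s' \<otimes> a) = \<zero>"
      and v: "v \<in> S" "v \<otimes> (t \<otimes> b' \<ominus> t' \<otimes> b) = \<zero>"
      using fraction_eqD[OF S as'(1) c(1) as'(2) c(3) as'(3)]
        fraction_eqD[OF S bt'(1) c(2) bt'(2) c(4) bt'(3)] by metis
    have cs [simp]: "s \<in> carrier R" "t \<in> carrier R" "s' \<in> carrier R" "t' \<in> carrier R"
      "u \<in> carrier R" "v \<in> carrier R" "a' \<in> carrier R" "b' \<in> carrier R"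
      using c u v as' bt' by auto
    have "(u \<otimes> v) \<otimes> ((s \<otimes> t) \<otimes> (t' \<otimes> a' \<oplus> s' \<otimes> b') \<ominus> (s' \<otimes> t') \<otimes> (t \<otimes> a \<oplus> s \<otimes> b))
      = (v \<otimes> t \<otimes> t') \<otimes> (u \<otimes> (s \<otimes> a' \<ominus> s' \<otimes> a)) \<oplus> (u \<otimes> s \<otimes> s') \<otimes> (v \<otimes> (t \<otimes> b' \<ominus> t' \<otimes> b))"
      using c(1,2) cs by algebra
    also have "\<dots> = \<zero>" using u v c by simp
    finally show ?thesis using as' bt' u v c
      by (intro fraction_eqI[OF S, where u = "u \<otimes> v"]) auto
  qed
  have "fraction R S a s \<noteq> {}" "fraction R S b t \<noteq> {}"
    using fraction_self[OF S c(1,3)] fraction_self[OF S c(2,4)] by auto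
  then show ?thesis using UN_pairs_const[OF _ _ key] by (simp add: localization_def)
qed

lemma localization_one: "\<one>\<^bsub>localization R S\<^esub> = fraction R S \<one> \<one>"
  by (simp add: localization_def)

lemma localization_carrier:
  "carrier (localization R S) = {fraction R S a s | a s. a \<in> carrier R \<and> s \<in> S}"
  by (simp add: localization_def)

end

section \<open>Sections over a basic open subset of a spectrum\<close>

context plain_cring
begin

lemma fraction_cancel:
  assumes S: "submonoid S R" and c: "a \<in> carrier R" "s \<in> S" "t \<in> S"
  shows "fraction R S (t \<otimes> a) (t \<otimes> s) = fraction R S a s"
proof -
  interpret S: submonoid S R by fact
  have cs: "s \<in> carrier R" "t \<in> carrier R" using S.subset c by auto
  have "\<one> \<otimes> (s \<otimes> (t \<otimes> a) \<ominus> (t \<otimes> s) \<otimes> a) = \<zero>" using c(1) cs by algebra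
  then show ?thesis using c cs by (intro fraction_eqI[OF S _ _ _ _ S.one_closed]) auto
qed

lemma zariski_basic_open:
  assumes W: "openin (zariski_topology R) W" and P: "P \<in> W"
  obtains h where "h \<in> carrier R" "h \<notin> P" "\<And>Q. \<lbrakk>primeideal Q R; h \<notin> Q\<rbrakk> \<Longrightarrow> Q \<in> W"
proof -
  obtain I where I: "ideal I R" "W = {P. primeideal P R \<and> \<not> I \<subseteq> P}"
    using W openin_zariski_topology[OF is_cring] by auto
  then obtain h where h: "h \<in> I" "h \<notin> P" using P by auto
  show ?thesis using that[of h] h I ideal.Icarr[OF I(1)] by auto
qed

lemma openin_zariski_basic:
  assumes "g \<in> carrier R"
  shows "openin (zariski_topology R) {P. primeideal P R \<and> g \<notin> P}"
proof -
  have "g \<in> P \<longleftrightarrow> PIdl g \<subseteq> P" if "primeideal P R" for P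
    using that assms cgenideal_self cgenideal_minimal primeideal.axioms(1) by blast
  then have "{P. primeideal P R \<and> g \<notin> P} = {P. primeideal P R \<and> \<not> PIdl g \<subseteq> P}" by auto
  then show ?thesis
    using openin_zariski_topology[OF is_cring] cgenideal_ideal[OF assms] by auto
qed

text \<open>The usual partition of unity argument. Passing from \<open>h\<close>, \<open>a\<close> to \<open>h\<^sup>N\<^sup>+\<^sup>1\<close>, \<open>h\<^sup>N a\<close> makes the
  local numerators compatible, and then the elements \<open>c\<close> for which \<open>c \<sigma>\<close> has a global numerator
  form an ideal.\<close>

lemma section_on_basic_open:
  assumes g: "g \<in> carrier R"
    and loc: "\<And>P. \<lbrakk>primeideal P R; g \<notin> P\<rbrakk> \<Longrightarrow>
      \<exists>W. openin (zariski_topology R) W \<and> P \<in> W \<and>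
        (\<exists>a\<in>carrier R. \<exists>b\<in>carrier R. \<forall>Q\<in>W. b \<notin> Q \<and> \<sigma> Q = fraction R (carrier R - Q) a b)"
  shows "\<exists>a\<in>carrier R. \<exists>n::nat. \<forall>P. primeideal P R \<longrightarrow> g \<notin> P \<longrightarrow>
    \<sigma> P = fraction R (carrier R - P) a (g [^] n)"
proof -
  \<comment> \<open>The same \<open>h\<close> serves as the denominator and as the element whose
    basic open set is the domain; this keeps the bookkeeping to one element per member of the
    cover.\<close>
  define num where "num h a \<longleftrightarrow> a \<in> carrier R \<and>
    (\<forall>Q. primeideal Q R \<longrightarrow> h \<notin> Q \<longrightarrow> \<sigma> Q = fraction R (carrier R - Q) a h)" for h a
  define H where "H = {h \<in> carrier R. (\<forall>Q. primeideal Q R \<longrightarrow> h \<notin> Q \<longrightarrow> g \<notin> Q) \<and> (\<exists>a. num h a)}"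
  have Hc: "H \<subseteq> carrier R" by (auto simp: H_def)
  have "\<exists>h\<in>H. h \<notin> P" if P: "primeideal P R" "g \<notin> P" for P
  proof -
    obtain W a b where W: "openin (zariski_topology R) W" "P \<in> W" and ab: "a \<in> carrier R" "b \<in> carrier R"
      and W': "\<And>Q. Q \<in> W \<Longrightarrow> b \<notin> Q \<and> \<sigma> Q = fraction R (carrier R - Q) a b"
      using loc[OF P] by blast
    obtain h where h: "h \<in> carrier R" "h \<notin> P" and hW: "\<And>Q. \<lbrakk>primeideal Q R; h \<notin> Q\<rbrakk> \<Longrightarrow> Q \<in> W"
      using zariski_basic_open[OF W] by blast
    have bP: "b \<notin> P" using W' W by blast
    \<comment> \<open>Expanding \<open>a/b\<close> by \<open>h \<otimes> g\<close> makes the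
      denominator equal to the element that cuts out the domain: \<open>h\<close> keeps the domain
      inside \<open>W\<close>, and \<open>g\<close> keeps it inside \<open>D(g)\<close>.\<close>
    let ?h = "(h \<otimes> g) \<otimes> b"
    have sub: "h \<notin> Q" "g \<notin> Q" if "primeideal Q R" "?h \<notin> Q" for Q
    proof -
      interpret Q: primeideal Q R by fact
      show "h \<notin> Q" "g \<notin> Q" using that(2) h g ab Q.I_l_closed Q.I_r_closed by auto
    qed
    have "num ?h ((h \<otimes> g) \<otimes> a)" unfolding num_def
    proof (intro conjI allI impI)
      fix Q assume Q: "primeideal Q R" "?h \<notin> Q"
      have "\<sigma> Q = fraction R (carrier R - Q) a b" "b \<notin> Q" using W' hW sub[OF Q] Q by auto
      moreover have "h \<otimes> g \<in> carrier R - Q" using sub[OF Q] Q(1) h g primeideal.I_prime by fast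
      ultimately show "\<sigma> Q = fraction R (carrier R - Q) ((h \<otimes> g) \<otimes> a) ?h"
        using fraction_cancel[OF submonoid_compl_prime[OF Q(1)] ab(1)] ab by simp
    qed (use h g ab in auto)
    moreover have "?h \<notin> P"
      using h g ab bP P primeideal.I_prime[OF P(1)] by (meson m_closed)
    ultimately show ?thesis unfolding H_def using sub h g ab by (intro bexI[of _ ?h]) auto
  qed
  then obtain N where "g [^] (N::nat) \<in> Idl H" using power_in_genideal[OF Hc g] by blast
  then obtain F where F: "finite F" "F \<subseteq> H" "g [^] N \<in> Idl F"
    using genideal_finite_subset[OF Hc] by blast
  have Fc: "F \<subseteq> carrier R" using F Hc by blast
  have covF: "\<exists>h\<in>F. h \<notin> P" if P: "primeideal P R" "g \<notin> P" for P
  proof (rule ccontr)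
    assume "\<not> ?thesis"
    then have "Idl F \<subseteq> P" using genideal_minimal[of P F] primeideal.axioms(1)[OF P(1)] by auto
    then show False using prime_pow_mem[OF P(1) g] F P by blast
  qed
  have "\<forall>h\<in>F. \<exists>a. num h a" using F(2) by (auto simp: H_def)
  then obtain \<alpha> where \<alpha>: "\<And>h. h \<in> F \<Longrightarrow> num h (\<alpha> h)" using bchoice by meson
  have \<alpha>c: "\<alpha> h \<in> carrier R" if "h \<in> F" for h using \<alpha>[OF that] by (simp add: num_def)
  \<comment> \<open>Two local fractions agree at every prime of \<open>D(h \<otimes> k)\<close>, so
    a power of \<open>h \<otimes> k\<close> kills their cross difference.\<close>
  have "\<exists>n::nat. (h \<otimes> k) [^] n \<otimes> (k \<otimes> \<alpha> h \<ominus> h \<otimes> \<alpha> k) = \<zero>" if hk: "h \<in> F" "k \<in> F" for h k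
  proof (rule vanishing_on_basic_open)
    have c: "h \<in> carrier R" "k \<in> carrier R" "\<alpha> h \<in> carrier R" "\<alpha> k \<in> carrier R"
      using hk Fc \<alpha>c by auto
    show "k \<otimes> \<alpha> h \<ominus> h \<otimes> \<alpha> k \<in> carrier R" "h \<otimes> k \<in> carrier R" using c by auto
    fix P assume P: "primeideal P R" "h \<otimes> k \<notin> P"
    interpret P: primeideal P R by fact
    have n: "h \<notin> P" "k \<notin> P" using P(2) c P.I_l_closed P.I_r_closed by auto
    have "fraction R (carrier R - P) (\<alpha> h) h = fraction R (carrier R - P) (\<alpha> k) k"
      using \<alpha>[OF hk(1)] \<alpha>[OF hk(2)] n P(1) unfolding num_def by metis
    then show "\<exists>u\<in>carrier R - P. u \<otimes> (k \<otimes> \<alpha> h \<ominus> h \<otimes> \<alpha> k) = \<zero>"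
      using fraction_eqD[OF submonoid_compl_prime[OF P(1)], of "\<alpha> h" "\<alpha> k" h k] c n by auto
  qed
  then obtain \<nu> where \<nu>: "\<And>h k. \<lbrakk>h \<in> F; k \<in> F\<rbrakk> \<Longrightarrow>
      (h \<otimes> k) [^] (\<nu> h k :: nat) \<otimes> (k \<otimes> \<alpha> h \<ominus> h \<otimes> \<alpha> k) = \<zero>" by metis
  \<comment> \<open>One exponent for all pairs from the finite cover; the inserted \<open>0\<close>
    keeps \<open>Max\<close> meaningful when \<open>F\<close> is empty.\<close>
  define M where "M = Max (insert 0 ((\<lambda>(h, k). \<nu> h k) ` (F \<times> F)))"
  have M: "\<nu> h k \<le> M" if "h \<in> F" "k \<in> F" for h k
    unfolding M_def using that F(1) by (intro Max_ge) auto
  have cross: "k [^] Suc M \<otimes> (h [^] M \<otimes> \<alpha> h) = h [^] Suc M \<otimes> (k [^] M \<otimes> \<alpha> k)" if hk: "h \<in> F" "k \<in> F" for h k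
  proof -
    have c: "h \<in> carrier R" "k \<in> carrier R" "\<alpha> h \<in> carrier R" "\<alpha> k \<in> carrier R"
      using hk Fc \<alpha>c by auto
    then have c': "h [^] M \<in> carrier R" "k [^] M \<in> carrier R" by auto
    have "(h \<otimes> k) [^] M \<otimes> (k \<otimes> \<alpha> h \<ominus> h \<otimes> \<alpha> k)
      = (h \<otimes> k) [^] (M - \<nu> h k) \<otimes> ((h \<otimes> k) [^] \<nu> h k \<otimes> (k \<otimes> \<alpha> h \<ominus> h \<otimes> \<alpha> k))"
      using c M[OF hk] by (simp add: m_assoc[symmetric] nat_pow_mult)
    also have "\<dots> = \<zero>" using \<nu>[OF hk] c by simp
    finally have "(h [^] M \<otimes> k [^] M) \<otimes> (k \<otimes> \<alpha> h \<ominus> h \<otimes> \<alpha> k) = \<zero>"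
      using c by (simp add: nat_pow_distrib)
    moreover have "(h [^] M \<otimes> k [^] M) \<otimes> (k \<otimes> \<alpha> h \<ominus> h \<otimes> \<alpha> k)
      = (k [^] M \<otimes> k) \<otimes> (h [^] M \<otimes> \<alpha> h) \<ominus> (h [^] M \<otimes> h) \<otimes> (k [^] M \<otimes> \<alpha> k)"
      using c c' by algebra
    ultimately show ?thesis using c c' by (simp add: r_right_minus_eq)
  qed
  let ?G = "(\<lambda>h. h [^] Suc M) ` F"
  have Gc: "?G \<subseteq> carrier R" using Fc by auto
  \<comment> \<open>The powers \<open>h [^] Suc M\<close> lie in the same primes as the
    \<open>h\<close>, so they still cover \<open>D(g)\<close>; the power of \<open>g\<close>
    obtained here becomes the global denominator.\<close>
  have "\<exists>h\<in>?G. h \<notin> P" if P: "primeideal P R" "g \<notin> P" for P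
    using covF[OF P] prime_pow_mem[OF P(1)] Fc by (metis imageI subsetD)
  then obtain n where n: "g [^] (n::nat) \<in> Idl ?G" using power_in_genideal[OF Gc g] by blast
  define C where "C = {c \<in> carrier R. \<exists>a\<in>carrier R. \<forall>k\<in>F. k [^] Suc M \<otimes> a = c \<otimes> (k [^] M \<otimes> \<alpha> k)}"
  have cF: "k \<in> carrier R" "\<alpha> k \<in> carrier R" "k [^] Suc M \<in> carrier R" "k [^] M \<otimes> \<alpha> k \<in> carrier R" if "k \<in> F" for k
    using Fc \<alpha>c that by auto
  have "ideal C R"
  proof (rule ideal_of_closed)
    show "C \<subseteq> carrier R" by (auto simp: C_def)
    show "\<zero> \<in> C" using cF by (auto simp: C_def simp del: nat_pow_Suc intro!: bexI[of _ \<zero>])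
    fix c d assume "c \<in> C" "d \<in> C"
    then obtain a b where *: "a \<in> carrier R" "b \<in> carrier R" "c \<in> carrier R" "d \<in> carrier R"
      "\<And>k. k \<in> F \<Longrightarrow> k [^] Suc M \<otimes> a = c \<otimes> (k [^] M \<otimes> \<alpha> k)"
      "\<And>k. k \<in> F \<Longrightarrow> k [^] Suc M \<otimes> b = d \<otimes> (k [^] M \<otimes> \<alpha> k)" unfolding C_def by blast
    have "\<forall>k\<in>F. k [^] Suc M \<otimes> (a \<oplus> b) = (c \<oplus> d) \<otimes> (k [^] M \<otimes> \<alpha> k)"
      using * cF by (simp add: l_distr r_distr del: nat_pow_Suc)
    then show "c \<oplus> d \<in> C" unfolding C_def using * by blast
  next
    fix c x assume "c \<in> C" and x: "x \<in> carrier R"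
    then obtain a where *: "a \<in> carrier R" "c \<in> carrier R"
      "\<And>k. k \<in> F \<Longrightarrow> k [^] Suc M \<otimes> a = c \<otimes> (k [^] M \<otimes> \<alpha> k)" unfolding C_def by blast
    have "\<forall>k\<in>F. k [^] Suc M \<otimes> (x \<otimes> a) = (x \<otimes> c) \<otimes> (k [^] M \<otimes> \<alpha> k)"
    proof
      fix k assume k: "k \<in> F"
      have "k [^] Suc M \<otimes> (x \<otimes> a) = x \<otimes> (k [^] Suc M \<otimes> a)"
        using m_lcomm cF(3)[OF k] x * by blast
      then show "k [^] Suc M \<otimes> (x \<otimes> a) = (x \<otimes> c) \<otimes> (k [^] M \<otimes> \<alpha> k)"
        unfolding *(3)[OF k] using m_assoc x * cF(4)[OF k] by simp
    qed
    then show "x \<otimes> c \<in> C" unfolding C_def using * x by blast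
  qed
  moreover have "?G \<subseteq> C"
  proof
    fix z assume "z \<in> ?G"
    then obtain h where h: "h \<in> F" "z = h [^] Suc M" by blast
    \<comment> \<open>The relation \<open>cross\<close> says exactly that
      \<open>h [^] M \<otimes> \<alpha> h\<close> is a global numerator belonging to
      \<open>h [^] Suc M\<close>.\<close>
    then have "\<forall>k\<in>F. k [^] Suc M \<otimes> (h [^] M \<otimes> \<alpha> h) = z \<otimes> (k [^] M \<otimes> \<alpha> k)"
      using cross by blast
    then show "z \<in> C" unfolding C_def using cF[OF h(1)] h(2) by blast
  qed
  ultimately have "g [^] n \<in> C" using genideal_minimal n by blast
  then obtain a where a: "a \<in> carrier R"
    and aF: "\<And>k. k \<in> F \<Longrightarrow> k [^] Suc M \<otimes> a = g [^] n \<otimes> (k [^] M \<otimes> \<alpha> k)" unfolding C_def by blast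
  have "\<sigma> P = fraction R (carrier R - P) a (g [^] n)" if P: "primeideal P R" "g \<notin> P" for P
  proof -
    interpret P: primeideal P R by fact
    note S = submonoid_compl_prime[OF P(1)]
    obtain k where k: "k \<in> F" "k \<notin> P" using covF[OF P] by blast
    have kS: "k \<in> carrier R - P" "k [^] M \<in> carrier R - P" "g [^] n \<in> carrier R - P"
      using k cF(1)[OF k(1)] P(2) g prime_pow_mem[OF P(1) cF(1)[OF k(1)], of M]
        prime_pow_mem[OF P(1) g, of n] by blast+
    have c: "k \<in> carrier R" "\<alpha> k \<in> carrier R" "k [^] M \<in> carrier R" "g [^] n \<in> carrier R"
      using kS cF(2)[OF k(1)] by blast+
    have "\<sigma> P = fraction R (carrier R - P) (\<alpha> k) k" using \<alpha>[OF k(1)] k P(1) by (simp add: num_def)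
    also have "\<dots> = fraction R (carrier R - P) a (g [^] n)"
    proof (rule fraction_eqI[OF S _ a _ _ kS(2)])
      have "k [^] M \<otimes> (g [^] n \<otimes> \<alpha> k \<ominus> k \<otimes> a) = g [^] n \<otimes> (k [^] M \<otimes> \<alpha> k) \<ominus> (k [^] M \<otimes> k) \<otimes> a"
        using c a by algebra
      also have "\<dots> = \<zero>" using aF[OF k(1)] c by (simp add: r_right_minus_eq)
      finally show "k [^] M \<otimes> (g [^] n \<otimes> \<alpha> k \<ominus> k \<otimes> a) = \<zero>" .
    qed (use c kS in auto)
    finally show ?thesis .
  qed
  then show ?thesis using a by blast
qed

end

section \<open>Units, localizing homomorphisms and the lifting of primes\<close>

lemma (in comm_monoid) Units_of_mult_one:
  assumes "x \<in> carrier G" "y \<in> carrier G" "x \<otimes> y = \<one>"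
  shows "x \<in> Units G"
proof -
  have "y \<otimes> x = \<one>" using assms m_comm by simp
  then show ?thesis using assms unfolding Units_def by blast
qed

lemma ring_hom_pow:
  assumes "h \<in> ring_hom R S" "cring R" "cring S" "x \<in> carrier R"
  shows "h (x [^]\<^bsub>R\<^esub> (n::nat)) = h x [^]\<^bsub>S\<^esub> n"
proof -
  interpret ring_hom_cring R S h using assms by (simp add: ring_hom_cring_def ring_hom_cring_axioms_def)
  show ?thesis using assms(4) by (induction n) auto
qed

lemma ring_hom_Units:
  assumes "h \<in> ring_hom R S" "cring R" "cring S" "x \<in> Units R"
  shows "h x \<in> Units S"
proof -
  interpret ring_hom_cring R S h using assms by (simp add: ring_hom_cring_def ring_hom_cring_axioms_def)
  obtain y where y: "y \<in> carrier R" "x \<in> carrier R" "x \<otimes>\<^bsub>R\<^esub> y = \<one>\<^bsub>R\<^esub>"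
    using assms(4) by (auto simp: Units_def)
  then have "h x \<otimes>\<^bsub>S\<^esub> h y = \<one>\<^bsub>S\<^esub>" by (metis hom_mult hom_one)
  then show ?thesis using S.Units_of_mult_one[of "h x" "h y"] y by simp
qed

lemma (in cring) unit_mult_zero:
  assumes "u \<in> Units R" "a \<in> carrier R" "u \<otimes> a = \<zero>"
  shows "a = \<zero>"
  using assms by (metis Units_closed Units_l_cancel r_null zero_closed)

text \<open>Everything follows from \<open>s (a/s) = a\<close> in the localization, carried over by
  the isomorphism \<open>h\<close>. From here on a localizing homomorphism is represented by these
  properties alone, and the isomorphism with \<open>localization A S\<close> does not
  return.\<close>

lemma localizing_homE:
  fixes A :: "'r ring" and B :: "'s ring"
  assumes A: "cring A" and B: "cring B" and loc: "localizing_hom A B \<phi>"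
  obtains S where "S \<subseteq> carrier A" "\<And>s. s \<in> S \<Longrightarrow> \<phi> s \<in> Units B"
    "\<And>b. b \<in> carrier B \<Longrightarrow> \<exists>a\<in>carrier A. \<exists>s\<in>S. \<phi> s \<otimes>\<^bsub>B\<^esub> b = \<phi> a"
    "\<And>a. \<lbrakk>a \<in> carrier A; \<phi> a = \<zero>\<^bsub>B\<^esub>\<rbrakk> \<Longrightarrow> \<exists>u\<in>S. u \<otimes>\<^bsub>A\<^esub> a = \<zero>\<^bsub>A\<^esub>"
proof -
  interpret A: plain_cring A using A by (simp add: plain_cring_def)
  interpret B: cring B by fact
  obtain S h where S: "submonoid S A" and h: "h \<in> ring_iso (localization A S) B"
    and \<phi>: "\<phi> \<in> ring_hom A B" and h\<phi>: "\<And>a. a \<in> carrier A \<Longrightarrow> h (fraction A S a \<one>\<^bsub>A\<^esub>) = \<phi> a"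
    using loc unfolding localizing_hom_def by blast
  interpret S: submonoid S A by fact
  have fr: "fraction A S a s \<in> carrier (localization A S)" if "a \<in> carrier A" "s \<in> S" for a s
    using that by (auto simp: A.localization_carrier)
  note hE = ring_iso_memE[OF h]
  have mul: "\<phi> s \<otimes>\<^bsub>B\<^esub> h (fraction A S a s) = \<phi> a" if "a \<in> carrier A" "s \<in> S" for a s
  proof -
    have s: "s \<in> carrier A" using that S.subset by blast
    have "fraction A S s \<one>\<^bsub>A\<^esub> \<otimes>\<^bsub>localization A S\<^esub> fraction A S a s
      = fraction A S (s \<otimes>\<^bsub>A\<^esub> a) (s \<otimes>\<^bsub>A\<^esub> \<one>\<^bsub>A\<^esub>)"
      using A.localization_mult[OF S s that(1) S.one_closed that(2)] s by simp
    also have "\<dots> = fraction A S a \<one>\<^bsub>A\<^esub>"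
      using A.fraction_cancel[OF S that(1) S.one_closed that(2)] by simp
    finally show ?thesis using h\<phi> that s hE(2) fr by (metis S.one_closed)
  qed
  show ?thesis
  proof (rule that)
    show "S \<subseteq> carrier A" by (rule S.subset)
    show "\<phi> s \<in> Units B" if "s \<in> S" for s
    proof (rule B.Units_of_mult_one)
      show "\<phi> s \<in> carrier B" using ring_hom_memE(1)[OF \<phi>] S.mem_carrier[OF that] .
      show "h (fraction A S \<one>\<^bsub>A\<^esub> s) \<in> carrier B" using hE(1) fr that by simp
      show "\<phi> s \<otimes>\<^bsub>B\<^esub> h (fraction A S \<one>\<^bsub>A\<^esub> s) = \<one>\<^bsub>B\<^esub>"
        using mul[OF A.one_closed that] ring_hom_memE(4)[OF \<phi>] by simp
    qed
    show "\<exists>a\<in>carrier A. \<exists>s\<in>S. \<phi> s \<otimes>\<^bsub>B\<^esub> b = \<phi> a" if "b \<in> carrier B" for b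
    proof -
      have "b \<in> h ` carrier (localization A S)"
        using bij_betw_imp_surj_on[OF hE(5)] that by simp
      then obtain p where "p \<in> carrier (localization A S)" "b = h p" by (rule imageE)
      moreover then obtain a s where "a \<in> carrier A" "s \<in> S" "p = fraction A S a s"
        unfolding A.localization_carrier by auto
      ultimately show ?thesis using mul by metis
    qed
    show "\<exists>u\<in>S. u \<otimes>\<^bsub>A\<^esub> a = \<zero>\<^bsub>A\<^esub>" if a: "a \<in> carrier A" "\<phi> a = \<zero>\<^bsub>B\<^esub>" for a
    proof -
      have "h (fraction A S a \<one>\<^bsub>A\<^esub>) = h (fraction A S \<zero>\<^bsub>A\<^esub> \<one>\<^bsub>A\<^esub>)"
        using h\<phi> a ring_hom_zero[OF \<phi> A.ring_axioms B.ring_axioms] by simp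
      then have "fraction A S a \<one>\<^bsub>A\<^esub> = fraction A S \<zero>\<^bsub>A\<^esub> \<one>\<^bsub>A\<^esub>"
        using hE(5) fr a by (auto simp: bij_betw_def inj_on_def)
      then obtain u where u: "u \<in> S" "u \<otimes>\<^bsub>A\<^esub> (\<one>\<^bsub>A\<^esub> \<otimes>\<^bsub>A\<^esub> a \<ominus>\<^bsub>A\<^esub> \<one>\<^bsub>A\<^esub> \<otimes>\<^bsub>A\<^esub> \<zero>\<^bsub>A\<^esub>) = \<zero>\<^bsub>A\<^esub>"
        using A.fraction_eqD[OF S a(1) A.zero_closed S.one_closed S.one_closed] by metis
      then have "u \<otimes>\<^bsub>A\<^esub> a = \<zero>\<^bsub>A\<^esub>" using a by (simp add: a_minus_def)
      then show ?thesis using u by blast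
    qed
  qed
qed

text \<open>The last two hypotheses hold when \<open>S\<close> is the localization of \<open>R\<close> at the powers of \<open>w\<close>.\<close>

lemma (in ring_hom_cring) prime_lift:
  assumes P: "primeideal P R" and w: "w \<in> carrier R" "w \<notin> P"
    and frac: "\<And>e. e \<in> carrier S \<Longrightarrow> \<exists>a\<in>carrier R. \<exists>n::nat. e \<otimes>\<^bsub>S\<^esub> h (w [^] n) = h a"
    and ker: "\<And>a. \<lbrakk>a \<in> carrier R; h a = \<zero>\<^bsub>S\<^esub>\<rbrakk> \<Longrightarrow> \<exists>n::nat. w [^] n \<otimes> a = \<zero>"
  shows "\<exists>Q. primeideal Q S \<and> (\<forall>a\<in>carrier R. h a \<in> Q \<longleftrightarrow> a \<in> P)"
proof -
  interpret P: primeideal P R by fact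
  \<comment> \<open>The extension of \<open>P\<close>: those elements of \<open>S\<close> that have
    a numerator in \<open>P\<close>.\<close>
  define Q where "Q = {e \<in> carrier S. \<exists>a\<in>P. \<exists>n::nat. e \<otimes>\<^bsub>S\<^esub> h (w [^] n) = h a}"
  have wP: "w [^] n \<notin> P" for n :: nat using R.prime_pow_mem[OF P w(1)] w(2) by blast
  have wc [simp]: "w [^] n \<in> carrier R" for n :: nat using w by simp
  \<comment> \<open>Whether the numerator lies in \<open>P\<close> is independent of its choice: two
    numerators agree up to powers of \<open>w\<close>, and no power of \<open>w\<close> lies in
    \<open>P\<close>. Being a proper prime ideal is then read off from numerators.\<close>
  have iff: "e \<in> Q \<longleftrightarrow> a \<in> P"
    if e: "e \<in> carrier S" "a \<in> carrier R" "e \<otimes>\<^bsub>S\<^esub> h (w [^] n) = h a" for e a and n :: nat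
  proof
    assume "e \<in> Q"
    then obtain b and m :: nat where b: "b \<in> P" "e \<otimes>\<^bsub>S\<^esub> h (w [^] m) = h b" by (auto simp: Q_def)
    have bc: "b \<in> carrier R" using b by auto
    have "h (a \<otimes> w [^] m \<ominus> b \<otimes> w [^] n) = h a \<otimes>\<^bsub>S\<^esub> h (w [^] m) \<ominus>\<^bsub>S\<^esub> h b \<otimes>\<^bsub>S\<^esub> h (w [^] n)"
      using e bc w by (simp add: a_minus_def)
    also have "\<dots> = (e \<otimes>\<^bsub>S\<^esub> h (w [^] n)) \<otimes>\<^bsub>S\<^esub> h (w [^] m) \<ominus>\<^bsub>S\<^esub> (e \<otimes>\<^bsub>S\<^esub> h (w [^] m)) \<otimes>\<^bsub>S\<^esub> h (w [^] n)"
      using e b by simp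
    also have "\<dots> = \<zero>\<^bsub>S\<^esub>"
    proof -
      have "h (w [^] n) \<in> carrier S" "h (w [^] m) \<in> carrier S" by auto
      then show ?thesis using e(1) by algebra
    qed
    finally obtain k :: nat where k: "w [^] k \<otimes> (a \<otimes> w [^] m \<ominus> b \<otimes> w [^] n) = \<zero>"
      using ker e bc w by (metis R.m_closed R.minus_closed wc)
    have "(w [^] k \<otimes> w [^] m) \<otimes> a
      = w [^] k \<otimes> (a \<otimes> w [^] m \<ominus> b \<otimes> w [^] n) \<oplus> (w [^] k \<otimes> w [^] n) \<otimes> b"
      using e(2) bc wc[of k] wc[of m] wc[of n] by algebra
    also have "\<dots> \<in> P" unfolding k using b P.I_l_closed by simp
    finally have "w [^] (k + m) \<otimes> a \<in> P" using w by (simp add: R.nat_pow_mult)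
    then show "a \<in> P" using P.I_prime[OF wc e(2)] wP by blast
  qed (use e in \<open>auto simp: Q_def\<close>)
  have img: "h a \<in> Q \<longleftrightarrow> a \<in> P" if "a \<in> carrier R" for a
    using iff[of "h a" a 0] that by simp
  have "primeideal Q S"
  proof (rule primeidealI)
    show "ideal Q S"
    proof (rule S.ideal_of_closed)
      show "Q \<subseteq> carrier S" by (auto simp: Q_def)
      show "\<zero>\<^bsub>S\<^esub> \<in> Q" using img[of \<zero>] additive_subgroup.zero_closed[OF P.is_additive_subgroup] by simp
    next
      fix d e assume de: "d \<in> Q" "e \<in> Q"
      then obtain a b and m n :: nat where *: "a \<in> P" "b \<in> P" "d \<in> carrier S" "e \<in> carrier S"
        "d \<otimes>\<^bsub>S\<^esub> h (w [^] m) = h a" "e \<otimes>\<^bsub>S\<^esub> h (w [^] n) = h b" by (auto simp: Q_def)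
      have c: "a \<in> carrier R" "b \<in> carrier R" "h (w [^] m) \<in> carrier S" "h (w [^] n) \<in> carrier S"
        using * by auto
      have "(d \<oplus>\<^bsub>S\<^esub> e) \<otimes>\<^bsub>S\<^esub> h (w [^] (m + n)) = (d \<oplus>\<^bsub>S\<^esub> e) \<otimes>\<^bsub>S\<^esub> (h (w [^] m) \<otimes>\<^bsub>S\<^esub> h (w [^] n))"
        using w by (simp flip: R.nat_pow_mult)
      also have "\<dots> = h (w [^] n) \<otimes>\<^bsub>S\<^esub> (d \<otimes>\<^bsub>S\<^esub> h (w [^] m)) \<oplus>\<^bsub>S\<^esub> h (w [^] m) \<otimes>\<^bsub>S\<^esub> (e \<otimes>\<^bsub>S\<^esub> h (w [^] n))"
        using *(3,4) c(3,4) by algebra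
      also have "\<dots> = h (w [^] n \<otimes> a \<oplus> w [^] m \<otimes> b)" using * c by simp
      finally have "(d \<oplus>\<^bsub>S\<^esub> e) \<otimes>\<^bsub>S\<^esub> h (w [^] (m + n)) = h (w [^] n \<otimes> a \<oplus> w [^] m \<otimes> b)" .
      moreover have "w [^] n \<otimes> a \<oplus> w [^] m \<otimes> b \<in> P" using *(1,2) by (intro P.a_closed P.I_l_closed) auto
      ultimately show "d \<oplus>\<^bsub>S\<^esub> e \<in> Q" unfolding Q_def using *(3,4) by blast
    next
      fix e x assume "e \<in> Q" and x: "x \<in> carrier S"
      then obtain a b and m n :: nat where *: "a \<in> P" "b \<in> carrier R" "e \<in> carrier S"
        "e \<otimes>\<^bsub>S\<^esub> h (w [^] m) = h a" "x \<otimes>\<^bsub>S\<^esub> h (w [^] n) = h b" using frac[OF x] by (auto simp: Q_def)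
      have c: "a \<in> carrier R" "h (w [^] m) \<in> carrier S" "h (w [^] n) \<in> carrier S" using * by auto
      have "(x \<otimes>\<^bsub>S\<^esub> e) \<otimes>\<^bsub>S\<^esub> h (w [^] (m + n)) = (x \<otimes>\<^bsub>S\<^esub> e) \<otimes>\<^bsub>S\<^esub> (h (w [^] m) \<otimes>\<^bsub>S\<^esub> h (w [^] n))"
        using w by (simp flip: R.nat_pow_mult)
      also have "\<dots> = (x \<otimes>\<^bsub>S\<^esub> h (w [^] n)) \<otimes>\<^bsub>S\<^esub> (e \<otimes>\<^bsub>S\<^esub> h (w [^] m))"
        using *(3) x c(2,3) by algebra
      also have "\<dots> = h (b \<otimes> a)" using * c by simp
      finally show "x \<otimes>\<^bsub>S\<^esub> e \<in> Q" unfolding Q_def using * x P.I_l_closed by blast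
    qed
    show "carrier S \<noteq> Q" using img[of \<one>] P.one_imp_carrier P.I_notcarr by auto
  next
    fix d e assume de: "d \<in> carrier S" "e \<in> carrier S" "d \<otimes>\<^bsub>S\<^esub> e \<in> Q"
    obtain a b and m n :: nat where *: "a \<in> carrier R" "b \<in> carrier R"
      "d \<otimes>\<^bsub>S\<^esub> h (w [^] m) = h a" "e \<otimes>\<^bsub>S\<^esub> h (w [^] n) = h b" using frac de by meson
    have c: "h (w [^] m) \<in> carrier S" "h (w [^] n) \<in> carrier S" by auto
    have "(d \<otimes>\<^bsub>S\<^esub> e) \<otimes>\<^bsub>S\<^esub> h (w [^] (m + n)) = (d \<otimes>\<^bsub>S\<^esub> e) \<otimes>\<^bsub>S\<^esub> (h (w [^] m) \<otimes>\<^bsub>S\<^esub> h (w [^] n))"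
      using w by (simp flip: R.nat_pow_mult)
    also have "\<dots> = (d \<otimes>\<^bsub>S\<^esub> h (w [^] m)) \<otimes>\<^bsub>S\<^esub> (e \<otimes>\<^bsub>S\<^esub> h (w [^] n))"
      using de(1,2) c by algebra
    also have "\<dots> = h (a \<otimes> b)" using * by simp
    finally have "a \<otimes> b \<in> P" using iff[of "d \<otimes>\<^bsub>S\<^esub> e" "a \<otimes> b" "m + n"] de * by simp
    then have "a \<in> P \<or> b \<in> P" using P.I_prime * by blast
    then show "d \<in> Q \<or> e \<in> Q" using iff de * by blast
  qed (rule S.is_cring)
  then show ?thesis using img by blast
qed


section \<open>Ringed spaces\<close>

text \<open>The nonvanishing locus of \<open>s\<close>, defined by local invertibility so that it
  makes sense in every ringed space. By \<open>basic_open_hat\<close> it is the usual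
  \<open>D(s)\<close> on an affine open set, and by \<open>germ_Units_iff\<close> it consists of the
  points where the germ is a unit.\<close>

definition basic_open :: "('a, 'r) ringed_space \<Rightarrow> 'a set \<Rightarrow> 'r \<Rightarrow> 'a set" where
  "basic_open X U s = {x. \<exists>W. openin (rtop X) W \<and> x \<in> W \<and> W \<subseteq> U \<and> restr X U W s \<in> Units (sections X W)}"

lemma basic_open_subset: "basic_open X U s \<subseteq> U"
  by (auto simp: basic_open_def)

lemma openin_basic_open: "openin (rtop X) (basic_open X U s)"
proof (subst openin_subopen, intro ballI)
  fix x assume "x \<in> basic_open X U s"
  then obtain W where "openin (rtop X) W" "x \<in> W" "W \<subseteq> U" "restr X U W s \<in> Units (sections X W)"
    by (auto simp: basic_open_def)
  then show "\<exists>T. openin (rtop X) T \<and> x \<in> T \<and> T \<subseteq> basic_open X U s"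
    by (auto simp: basic_open_def)
qed

context ringed_space
begin

lemma restr_rhc:
  "\<lbrakk>openin (rtop X) U; openin (rtop X) V; V \<subseteq> U\<rbrakk>
    \<Longrightarrow> ring_hom_cring (sections X U) (sections X V) (restr X U V)"
  using cring_sections restr_hom by (simp add: ring_hom_cring_def ring_hom_cring_axioms_def)

lemma restr_closed:
  "\<lbrakk>openin (rtop X) U; openin (rtop X) V; V \<subseteq> U; s \<in> carrier (sections X U)\<rbrakk>
    \<Longrightarrow> restr X U V s \<in> carrier (sections X V)"
  using restr_hom ring_hom_closed by metis

lemma section_eqI:
  assumes "openin (rtop X) U" "s \<in> carrier (sections X U)" "t \<in> carrier (sections X U)"
    and "\<And>x. x \<in> U \<Longrightarrow> \<exists>W. openin (rtop X) W \<and> x \<in> W \<and> W \<subseteq> U \<and> restr X U W s = restr X U W t"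
  shows "s = t"
proof -
  define \<U> where "\<U> = {W. openin (rtop X) W \<and> W \<subseteq> U \<and> restr X U W s = restr X U W t}"
  have "\<Union>\<U> = U" using assms(4) by (auto simp: \<U>_def)
  then show ?thesis using locality[of \<U> s t] assms(2,3) by (auto simp: \<U>_def)
qed

lemma restr_Units:
  "\<lbrakk>openin (rtop X) U; openin (rtop X) V; V \<subseteq> U; s \<in> Units (sections X U)\<rbrakk>
    \<Longrightarrow> restr X U V s \<in> Units (sections X V)"
  by (rule ring_hom_Units[OF restr_hom cring_sections cring_sections])

lemma mem_basic_openI:
  assumes "openin (rtop X) U" "openin (rtop X) W" "x \<in> W" "W \<subseteq> U" "restr X U W s \<in> Units (sections X W)"
  shows "x \<in> basic_open X U s"
  using assms by (auto simp: basic_open_def)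

text \<open>Inverses are unique, so the local inverses agree on overlaps and glue to an inverse over
  \<open>V\<close>.\<close>

lemma unit_on_basic_open:
  assumes U: "openin (rtop X) U" and V: "openin (rtop X) V" "V \<subseteq> basic_open X U s"
    and s: "s \<in> carrier (sections X U)"
  shows "restr X U V s \<in> Units (sections X V)"
proof -
  have VU: "V \<subseteq> U" using order_trans[OF V(2) basic_open_subset] .
  define \<U> where "\<U> = {W. openin (rtop X) W \<and> W \<subseteq> V \<and> restr X U W s \<in> Units (sections X W)}"
  have \<U>D: "openin (rtop X) W" "W \<subseteq> V" "W \<subseteq> U" "restr X U W s \<in> Units (sections X W)" if "W \<in> \<U>" for W
    using that VU by (auto simp: \<U>_def)
  have cov: "\<Union>\<U> = V"
  proof (intro equalityI subsetI)
    fix x assume x: "x \<in> V"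
    then obtain W where W: "openin (rtop X) W" "x \<in> W" "W \<subseteq> U" "restr X U W s \<in> Units (sections X W)"
      using V by (auto simp: basic_open_def)
    have o: "openin (rtop X) (W \<inter> V)" using W V by auto
    have "restr X U (W \<inter> V) s = restr X W (W \<inter> V) (restr X U W s)"
      using restr_comp[OF U W(1) o _ W(3) s] by simp
    then have "W \<inter> V \<in> \<U>" using restr_Units[OF W(1) o _ W(4)] o by (auto simp: \<U>_def)
    then show "x \<in> \<Union>\<U>" using W x by blast
  qed (auto simp: \<U>_def)
  define \<sigma> where "\<sigma> W = inv\<^bsub>sections X W\<^esub> (restr X U W s)" for W
  \<comment> \<open>Restricting a local inverse gives the inverse of the restriction, an expression
    independent of the open set \<open>W\<close> it came from.\<close>
  have inv_restr: "restr X W W' (\<sigma> W) = inv\<^bsub>sections X W'\<^esub> (restr X U W' s)"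
    if W: "W \<in> \<U>" "openin (rtop X) W'" "W' \<subseteq> W" for W W'
  proof -
    interpret h: ring_hom_cring "sections X W" "sections X W'" "restr X W W'"
      using restr_rhc \<U>D W by blast
    note D = \<U>D[OF W(1)]
    have eq: "restr X W W' (restr X U W s) = restr X U W' s" using restr_comp[OF U D(1) W(2) W(3) D(3) s] .
    have c: "restr X W W' (\<sigma> W) \<in> carrier (sections X W')" "restr X U W' s \<in> carrier (sections X W')"
      using D(4) restr_closed[OF U W(2) _ s] W(3) D(3) by (auto simp: \<sigma>_def)
    have "restr X U W' s \<otimes>\<^bsub>sections X W'\<^esub> restr X W W' (\<sigma> W)
      = restr X W W' (restr X U W s \<otimes>\<^bsub>sections X W\<^esub> \<sigma> W)"
      using h.R.Units_closed[OF D(4)] h.R.Units_inv_closed[OF D(4)] eq by (simp add: \<sigma>_def)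
    also have "\<dots> = \<one>\<^bsub>sections X W'\<^esub>" using h.R.Units_r_inv[OF D(4)] by (simp add: \<sigma>_def)
    finally have "restr X U W' s \<otimes>\<^bsub>sections X W'\<^esub> restr X W W' (\<sigma> W) = \<one>\<^bsub>sections X W'\<^esub>" .
    then show ?thesis using h.S.comm_inv_char[OF c(2,1)] by simp
  qed
  have "\<exists>\<tau>\<in>carrier (sections X (\<Union>\<U>)). \<forall>W\<in>\<U>. restr X (\<Union>\<U>) W \<tau> = \<sigma> W"
  proof (rule gluing)
    fix W assume W: "W \<in> \<U>"
    interpret cring "sections X W" using cring_sections \<U>D W by blast
    show "openin (rtop X) W" using \<U>D W by blast
    show "\<sigma> W \<in> carrier (sections X W)" using \<U>D W by (simp add: \<sigma>_def)
    fix W' assume "W' \<in> \<U>"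
    then show "restr X W (W \<inter> W') (\<sigma> W) = restr X W' (W \<inter> W') (\<sigma> W')"
      using inv_restr[OF W, of "W \<inter> W'"] inv_restr[of W' "W \<inter> W'"]
        openin_Int[OF \<U>D(1)[OF W] \<U>D(1)[of W']] by simp
  qed
  then obtain \<tau> where \<tau>: "\<tau> \<in> carrier (sections X V)" "\<And>W. W \<in> \<U> \<Longrightarrow> restr X V W \<tau> = \<sigma> W"
    unfolding cov by blast
  interpret V: cring "sections X V" using cring_sections V by blast
  have sV: "restr X U V s \<in> carrier (sections X V)" using restr_closed[OF U V(1) VU s] .
  have "restr X U V s \<otimes>\<^bsub>sections X V\<^esub> \<tau> = \<one>\<^bsub>sections X V\<^esub>"
  proof (rule section_eqI[OF V(1)])
    fix x assume "x \<in> V"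
    then obtain W where W: "W \<in> \<U>" "x \<in> W" using cov by blast
    note D = \<U>D[OF W(1)]
    interpret h: ring_hom_cring "sections X V" "sections X W" "restr X V W"
      using restr_rhc V D by blast
    have "restr X V W (restr X U V s) = restr X U W s" using restr_comp[OF U V(1) D(1,2) VU s] .
    then have "restr X V W (restr X U V s \<otimes>\<^bsub>sections X V\<^esub> \<tau>) = restr X V W \<one>\<^bsub>sections X V\<^esub>"
      using \<tau> sV W D(4) by (simp add: \<sigma>_def)
    then show "\<exists>W. openin (rtop X) W \<and> x \<in> W \<and> W \<subseteq> V \<and>
      restr X V W (restr X U V s \<otimes>\<^bsub>sections X V\<^esub> \<tau>) = restr X V W \<one>\<^bsub>sections X V\<^esub>"
      using D W by blast
  qed (use sV \<tau> in auto)
  then show ?thesis using V.Units_of_mult_one sV \<tau> by blast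
qed

lemma basic_open_restr:
  assumes U: "openin (rtop X) U" and V: "openin (rtop X) V" "V \<subseteq> U" and s: "s \<in> carrier (sections X U)"
  shows "basic_open X V (restr X U V s) = basic_open X U s \<inter> V"
proof (intro equalityI subsetI)
  fix x assume "x \<in> basic_open X V (restr X U V s)"
  then obtain W where W: "openin (rtop X) W" "x \<in> W" "W \<subseteq> V" "restr X V W (restr X U V s) \<in> Units (sections X W)"
    by (auto simp: basic_open_def)
  then show "x \<in> basic_open X U s \<inter> V"
    using restr_comp[OF U V(1) W(1,3) V(2) s] V(2) by (auto simp: basic_open_def)
next
  fix x assume x: "x \<in> basic_open X U s \<inter> V"
  let ?W = "basic_open X U s \<inter> V"
  have o: "openin (rtop X) ?W" using openin_basic_open V(1) by (rule openin_Int)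
  have "restr X V ?W (restr X U V s) = restr X U ?W s" using restr_comp[OF U V(1) o _ V(2) s] by simp
  moreover have "restr X U ?W s \<in> Units (sections X ?W)" using unit_on_basic_open[OF U o _ s] by simp
  ultimately show "x \<in> basic_open X V (restr X U V s)"
    using o x by (intro mem_basic_openI[OF V(1), of ?W]) auto
qed

lemma basic_open_mult:
  assumes U: "openin (rtop X) U" and s: "s \<in> carrier (sections X U)" and t: "t \<in> carrier (sections X U)"
  shows "basic_open X U (s \<otimes>\<^bsub>sections X U\<^esub> t) = basic_open X U s \<inter> basic_open X U t"
proof -
  interpret U: cring "sections X U" using cring_sections U by blast
  have iff: "restr X U W (s \<otimes>\<^bsub>sections X U\<^esub> t) \<in> Units (sections X W) \<longleftrightarrow>
    restr X U W s \<in> Units (sections X W) \<and> restr X U W t \<in> Units (sections X W)"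
    if W: "openin (rtop X) W" "W \<subseteq> U" for W
  proof -
    interpret h: ring_hom_cring "sections X U" "sections X W" "restr X U W" using restr_rhc U W by blast
    have c: "restr X U W s \<in> carrier (sections X W)" "restr X U W t \<in> carrier (sections X W)" using s t by auto
    show ?thesis using h.S.unit_factor[OF _ c] h.S.unit_factor[OF _ c(2,1)] h.S.Units_m_closed s t
      by (metis c h.S.m_comm h.hom_mult)
  qed
  show ?thesis
  proof (intro equalityI subsetI)
    fix x assume "x \<in> basic_open X U (s \<otimes>\<^bsub>sections X U\<^esub> t)"
    then show "x \<in> basic_open X U s \<inter> basic_open X U t" using iff by (auto simp: basic_open_def)
  next
    let ?W = "basic_open X U s \<inter> basic_open X U t"
    fix x assume x: "x \<in> ?W"
    have o: "openin (rtop X) ?W" "?W \<subseteq> U"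
      by (rule openin_Int[OF openin_basic_open openin_basic_open])
        (rule subset_trans[OF Int_lower1 basic_open_subset])
    have "restr X U ?W (s \<otimes>\<^bsub>sections X U\<^esub> t) \<in> Units (sections X ?W)"
      using iff[OF o] unit_on_basic_open[OF U o(1) Int_lower1 s]
        unit_on_basic_open[OF U o(1) Int_lower2 t] by simp
    then show "x \<in> basic_open X U (s \<otimes>\<^bsub>sections X U\<^esub> t)"
      using o x by (intro mem_basic_openI[OF U, of ?W]) auto
  qed
qed

lemma basic_open_pow:
  assumes U: "openin (rtop X) U" and s: "s \<in> carrier (sections X U)"
  shows "basic_open X U s \<subseteq> basic_open X U (s [^]\<^bsub>sections X U\<^esub> (n::nat))"
proof -
  interpret U: cring "sections X U" using cring_sections U by blast
  let ?W = "basic_open X U s"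
  have o: "openin (rtop X) ?W" "?W \<subseteq> U" by (rule openin_basic_open basic_open_subset)+
  interpret W: cring "sections X ?W" using cring_sections o by blast
  have "restr X U ?W s [^]\<^bsub>sections X ?W\<^esub> n \<in> Units (sections X ?W)"
    using unit_on_basic_open[OF U o(1) subset_refl s] W.Units_pow_closed by blast
  then show ?thesis
    using ring_hom_pow[OF restr_hom[OF U o] U.is_cring W.is_cring s] o
    by (auto simp: basic_open_def)
qed

lemma basic_open_unit:
  assumes U: "openin (rtop X) U" and s: "s \<in> Units (sections X U)"
  shows "basic_open X U s = U"
  using basic_open_subset[of X U s] restr_Units[OF U U _ s] U by (auto simp: basic_open_def)

end

lemma (in ring_hom_cring) primeideal_vimage:
  assumes "primeideal Q S"
  shows "primeideal {a \<in> carrier R. h a \<in> Q} R"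
proof -
  interpret Q: primeideal Q S by fact
  show ?thesis
  proof (rule primeidealI)
    show "ideal {a \<in> carrier R. h a \<in> Q} R"
      by (rule R.ideal_of_closed)
        (use additive_subgroup.zero_closed[OF Q.is_additive_subgroup] Q.a_closed Q.I_l_closed in auto)
    show "carrier R \<noteq> {a \<in> carrier R. h a \<in> Q}"
      using Q.one_imp_carrier Q.I_notcarr R.one_closed by (metis (no_types, lifting) hom_one mem_Collect_eq)
    show "a \<in> {a \<in> carrier R. h a \<in> Q} \<or> b \<in> {a \<in> carrier R. h a \<in> Q}"
      if "a \<in> carrier R" "b \<in> carrier R" "a \<otimes> b \<in> {a \<in> carrier R. h a \<in> Q}" for a b
      using that Q.I_prime[of "h a" "h b"] by auto
  qed (rule R.is_cring)
qed

lemma openin_open_subspace: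
  assumes "openin (rtop X) U"
  shows "openin (rtop (open_subspace X U)) S \<longleftrightarrow> openin (rtop X) S \<and> S \<subseteq> U"
  using assms by (auto simp: open_subspace_def openin_open_subtopology)

lemma points_open_subspace:
  assumes "openin (rtop X) U"
  shows "points (open_subspace X U) = U"
  using openin_subset[OF assms] by (auto simp: open_subspace_def)

lemma open_subspace_simps [simp]:
  "sections (open_subspace X U) = sections X" "restr (open_subspace X U) = restr X"
  by (simp_all add: open_subspace_def)

lemma openin_preim:
  assumes "lrs_morphism X Y f" "openin (rtop Y) V"
  shows "openin (rtop X) (preim X f V)"
  using lrs_morphism.continuous[OF assms(1)] assms(2)
  by (auto simp: preim_def dest: openin_continuous_map_preimage)

text \<open>The inverse morphism \<open>g\<close> inverts points, preimages of open sets and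
  sections at once. Only this homeomorphism with isomorphisms of sections is carried on to the
  charts.\<close>

lemma lrs_isoD:
  assumes iso: "lrs_iso X Y f"
  shows "bij_betw (pt_map f) (points X) (points Y)"
    and "openin (rtop X) N \<Longrightarrow> \<exists>W. openin (rtop Y) W \<and> N = preim X f W"
    and "openin (rtop Y) W \<Longrightarrow> sec_map f W \<in> ring_iso (sections Y W) (sections X (preim X f W))"
proof -
  obtain g where f: "lrs_morphism X Y f" and g: "lrs_morphism Y X g"
    and gf: "rs_eq X X (rs_comp Y g f) rs_id" and fg: "rs_eq Y Y (rs_comp X f g) rs_id"
    using iso by (auto simp: lrs_iso_def)
  interpret f: lrs_morphism X Y f by fact
  interpret g: lrs_morphism Y X g by fact
  have fp: "pt_map f x \<in> points Y" if "x \<in> points X" for x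
    using f.continuous that by (auto simp: continuous_map_def)
  have gp: "pt_map g y \<in> points X" if "y \<in> points Y" for y
    using g.continuous that by (auto simp: continuous_map_def)
  have gfp: "pt_map g (pt_map f x) = x" if "x \<in> points X" for x
    using gf that by (simp add: rs_eq_def rs_comp_def rs_id_def)
  have fgp: "pt_map f (pt_map g y) = y" if "y \<in> points Y" for y
    using fg that by (simp add: rs_eq_def rs_comp_def rs_id_def)
  show "bij_betw (pt_map f) (points X) (points Y)"
    by (rule bij_betw_byWitness[of _ "pt_map g"]) (auto simp: fp gp gfp fgp)
  have pfg: "preim X f (preim Y g N) = N" if "N \<subseteq> points X" for N
    using that fp gfp by (auto simp: preim_def)
  have pgf: "preim Y g (preim X f W) = W" if "W \<subseteq> points Y" for W
    using that gp fgp by (auto simp: preim_def)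
  have Xid: "sec_map f (preim Y g N) (sec_map g N t) = t"
    if "openin (rtop X) N" "t \<in> carrier (sections X N)" for N t
    using gf that by (simp add: rs_eq_def rs_comp_def rs_id_def)
  have Yid: "sec_map g (preim X f W) (sec_map f W t) = t"
    if "openin (rtop Y) W" "t \<in> carrier (sections Y W)" for W t
    using fg that by (simp add: rs_eq_def rs_comp_def rs_id_def)
  show "\<exists>W. openin (rtop Y) W \<and> N = preim X f W" if "openin (rtop X) N"
    using openin_preim[OF g that] pfg openin_subset[OF that] by metis
  show "sec_map f W \<in> ring_iso (sections Y W) (sections X (preim X f W))" if W: "openin (rtop Y) W"
  proof -
    have o: "openin (rtop X) (preim X f W)" using openin_preim[OF f W] .
    have pgfW: "preim Y g (preim X f W) = W" using pgf openin_subset[OF W] by simp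
    \<comment> \<open>Going back through \<open>f\<close> and \<open>g\<close> returns
      \<open>W\<close>, so \<open>g\<close> sends sections over the preimage to sections over
      \<open>W\<close> itself.\<close>
    note fh = f.sec_map_hom[OF W] and gh = g.sec_map_hom[OF o, unfolded pgfW]
    have "bij_betw (sec_map f W) (carrier (sections Y W)) (carrier (sections X (preim X f W)))"
      by (rule bij_betw_byWitness[of _ "sec_map g (preim X f W)"])
        (use Xid[OF o] Yid[OF W] pgfW ring_hom_closed[OF fh] ring_hom_closed[OF gh] in auto)
    then show ?thesis using fh by (simp add: ring_iso_def)
  qed
qed


section \<open>Affine open sets\<close>

lemma topspace_zariski:
  assumes "cring A" shows "topspace (zariski_topology A) = {P. primeideal P A}"
proof (intro equalityI subsetI)
  fix P assume "P \<in> topspace (zariski_topology A)"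
  then show "P \<in> {P. primeideal P A}"
    using openin_zariski_topology[OF assms] openin_topspace by blast
next
  interpret cring A by fact
  fix P assume P: "P \<in> {P. primeideal P A}"
  have "\<one>\<^bsub>A\<^esub> \<notin> P"
    using P ideal.one_imp_carrier primeideal.axioms(1) primeideal.I_notcarr by blast
  then have "P \<in> {P. primeideal P A \<and> \<not> carrier A \<subseteq> P}" using P by auto
  moreover have "openin (zariski_topology A) {P. primeideal P A \<and> \<not> carrier A \<subseteq> P}"
    using openin_zariski_topology[OF assms] oneideal by blast
  ultimately show "P \<in> topspace (zariski_topology A)" using openin_subset by blast
qed

section \<open>The structure sheaf of a spectrum\<close>

definition const_section :: "'r ring \<Rightarrow> 'r set set \<Rightarrow> 'r \<Rightarrow> 'r set \<Rightarrow> ('r \<times> 'r) set" where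
  "const_section A W a = (\<lambda>P\<in>W. fraction A (carrier A - P) a \<one>\<^bsub>A\<^esub>)"

context plain_cring
begin

lemma one_compl_prime: "primeideal P R \<Longrightarrow> \<one> \<in> carrier R - P"
  using submonoid.one_closed[OF submonoid_compl_prime] by simp

lemma spec_section_locally_fraction:
  assumes "\<sigma> \<in> carrier (spec_sections R W)" "P \<in> W"
  shows "\<exists>V. openin (zariski_topology R) V \<and> P \<in> V \<and> V \<subseteq> W \<and>
      (\<exists>a\<in>carrier R. \<exists>b\<in>carrier R. \<forall>Q\<in>V. b \<notin> Q \<and> \<sigma> Q = fraction R (carrier R - Q) a b)"
  using assms by (simp add: spec_sections_def)

lemma spec_section_local:
  assumes "\<sigma> \<in> carrier (spec_sections R W)" "P \<in> W"
  obtains V a b where "openin (zariski_topology R) V" "P \<in> V" "V \<subseteq> W" "a \<in> carrier R" "b \<in> carrier R"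
    "\<And>Q. Q \<in> V \<Longrightarrow> b \<notin> Q" "\<And>Q. Q \<in> V \<Longrightarrow> \<sigma> Q = fraction R (carrier R - Q) a b"
  using spec_section_locally_fraction[OF assms] that by metis

lemma openin_zariski_prime:
  "openin (zariski_topology R) W \<Longrightarrow> P \<in> W \<Longrightarrow> primeideal P R"
  using openin_subset[of "zariski_topology R" W] topspace_zariski[OF is_cring] by auto

lemma fraction_section:
  assumes W: "openin (zariski_topology R) W" and c: "a \<in> carrier R" "b \<in> carrier R"
    and nz: "\<And>P. P \<in> W \<Longrightarrow> b \<notin> P"
  shows "(\<lambda>P\<in>W. fraction R (carrier R - P) a b) \<in> carrier (spec_sections R W)"
proof -
  have "\<exists>a\<in>carrier R. \<exists>b\<in>carrier R. \<forall>Q\<in>W.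
      b \<notin> Q \<and> (\<lambda>P\<in>W. fraction R (carrier R - P) a b) Q = fraction R (carrier R - Q) a b"
    using c nz by auto
  then have loc: "\<exists>V. openin (zariski_topology R) V \<and> P \<in> V \<and> V \<subseteq> W \<and>
      (\<exists>a'\<in>carrier R. \<exists>b'\<in>carrier R. \<forall>Q\<in>V. b' \<notin> Q \<and>
        (\<lambda>P\<in>W. fraction R (carrier R - P) a b) Q = fraction R (carrier R - Q) a' b')"
    if "P \<in> W" for P using W c nz that by (intro exI[of _ W]) auto
  have "fraction R (carrier R - P) a b \<in> carrier (loc_at R P)" if "P \<in> W" for P
    unfolding localization_carrier using c nz that by blast
  then show ?thesis using loc by (auto simp: spec_sections_def)
qed

text \<open>Local fractions multiply to local fractions on the intersection of their domains. In
  \<open>basic_open_hat\<close> this closure allows a product to be compared with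
  \<open>\<one>\<close> through the injectivity of \<open>\<psi> W\<close>.\<close>

lemma spec_mult_closed:
  assumes W: "openin (zariski_topology R) W"
    and s: "\<sigma> \<in> carrier (spec_sections R W)" and t: "\<tau> \<in> carrier (spec_sections R W)"
  shows "\<sigma> \<otimes>\<^bsub>spec_sections R W\<^esub> \<tau> \<in> carrier (spec_sections R W)"
proof -
  have loc: "\<exists>V. openin (zariski_topology R) V \<and> P \<in> V \<and> V \<subseteq> W \<and>
      (\<exists>a\<in>carrier R. \<exists>b\<in>carrier R. \<forall>Q\<in>V. b \<notin> Q \<and>
        (\<sigma> \<otimes>\<^bsub>spec_sections R W\<^esub> \<tau>) Q = fraction R (carrier R - Q) a b)" if P: "P \<in> W" for P
  proof -
    obtain V a b where 1: "openin (zariski_topology R) V" "P \<in> V" "V \<subseteq> W" "a \<in> carrier R" "b \<in> carrier R"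
      "\<And>Q. Q \<in> V \<Longrightarrow> b \<notin> Q" "\<And>Q. Q \<in> V \<Longrightarrow> \<sigma> Q = fraction R (carrier R - Q) a b"
      using spec_section_local[OF s P] by metis
    obtain V' c d where 2: "openin (zariski_topology R) V'" "P \<in> V'" "V' \<subseteq> W" "c \<in> carrier R" "d \<in> carrier R"
      "\<And>Q. Q \<in> V' \<Longrightarrow> d \<notin> Q" "\<And>Q. Q \<in> V' \<Longrightarrow> \<tau> Q = fraction R (carrier R - Q) c d"
      using spec_section_local[OF t P] by metis
    have o: "openin (zariski_topology R) (V \<inter> V')" using 1 2 by auto
    have "b \<otimes> d \<notin> Q \<and> (\<sigma> \<otimes>\<^bsub>spec_sections R W\<^esub> \<tau>) Q = fraction R (carrier R - Q) (a \<otimes> c) (b \<otimes> d)"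
      if Q: "Q \<in> V \<inter> V'" for Q
    proof -
      have pr: "primeideal Q R" using openin_zariski_prime[OF o Q] .
      have "(\<sigma> \<otimes>\<^bsub>spec_sections R W\<^esub> \<tau>) Q = \<sigma> Q \<otimes>\<^bsub>loc_at R Q\<^esub> \<tau> Q"
        using Q 1(3) by (auto simp: spec_sections_def)
      also have "\<dots> = fraction R (carrier R - Q) (a \<otimes> c) (b \<otimes> d)"
        using 1 2 Q localization_mult[OF submonoid_compl_prime[OF pr]] by simp
      finally show ?thesis using primeideal.I_prime[OF pr, of b d] 1 2 Q by auto
    qed
    then show ?thesis using o 1 2
      by (intro exI[of _ "V \<inter> V'"] conjI bexI[of _ "a \<otimes> c"] bexI[of _ "b \<otimes> d"]) auto
  qed
  have "\<sigma> P \<otimes>\<^bsub>loc_at R P\<^esub> \<tau> P \<in> carrier (loc_at R P)" if P: "P \<in> W" for P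
  proof -
    obtain V a b where 1: "a \<in> carrier R" "b \<in> carrier R" "b \<notin> P"
      "(\<sigma> \<otimes>\<^bsub>spec_sections R W\<^esub> \<tau>) P = fraction R (carrier R - P) a b"
      using loc[OF P] by blast
    then show ?thesis using P unfolding localization_carrier by (auto simp: spec_sections_def)
  qed
  then have "\<sigma> \<otimes>\<^bsub>spec_sections R W\<^esub> \<tau> \<in> (\<Pi>\<^sub>E P\<in>W. carrier (loc_at R P))"
    by (auto simp: spec_sections_def)
  then show ?thesis using loc unfolding spec_sections_def by auto
qed

lemma const_section_hom:
  assumes W: "openin (zariski_topology R) W"
  shows "const_section R W \<in> ring_hom R (spec_sections R W)"
proof (rule ring_hom_memI)
  note S = submonoid_compl_prime[OF openin_zariski_prime[OF W]]
    and one = one_compl_prime[OF openin_zariski_prime[OF W]]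
  show "const_section R W a \<in> carrier (spec_sections R W)" if "a \<in> carrier R" for a
    unfolding const_section_def using fraction_section[OF W that one_closed] one by blast
  show "const_section R W (a \<otimes> b) = const_section R W a \<otimes>\<^bsub>spec_sections R W\<^esub> const_section R W b"
    if "a \<in> carrier R" "b \<in> carrier R" for a b
    using localization_mult[OF S that one one] that
    by (auto simp: const_section_def spec_sections_def intro!: restrict_ext)
  show "const_section R W (a \<oplus> b) = const_section R W a \<oplus>\<^bsub>spec_sections R W\<^esub> const_section R W b"
    if "a \<in> carrier R" "b \<in> carrier R" for a b
    using localization_add[OF S that one one] that
    by (auto simp: const_section_def spec_sections_def intro!: restrict_ext)
  show "const_section R W \<one> = \<one>\<^bsub>spec_sections R W\<^esub>"
    by (auto simp: const_section_def spec_sections_def localization_one intro!: restrict_ext)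
qed

end

text \<open>An isomorphism of the open subspace \<open>U\<close> with \<open>Spec A\<close>, spelled
  out as a bijection \<open>p\<close> onto the primes and ring isomorphisms \<open>\<psi>\<close> on
  sections. All open sets are written as subsets of \<open>X\<close>, which keeps
  \<open>open_subspace\<close> and \<open>preim\<close> out of the computations.\<close>

locale affine_chart = ringed_space X for X :: "('a, 'r) ringed_space" +
  fixes U :: "'a set" and A :: "'r ring" and p :: "'a \<Rightarrow> 'r set"
    and \<psi> :: "'r set set \<Rightarrow> ('r set \<Rightarrow> ('r \<times> 'r) set) \<Rightarrow> 'r"
  assumes open_U: "openin (rtop X) U"
    and cring_A: "cring A"
    and bij_p: "bij_betw p U {P. primeideal P A}"
    and open_p: "openin (zariski_topology A) W \<Longrightarrow> openin (rtop X) {x \<in> U. p x \<in> W}"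
    and open_ex: "\<lbrakk>openin (rtop X) N; N \<subseteq> U\<rbrakk>
      \<Longrightarrow> \<exists>W. openin (zariski_topology A) W \<and> N = {x \<in> U. p x \<in> W}"
    and iso: "openin (zariski_topology A) W
      \<Longrightarrow> \<psi> W \<in> ring_iso (spec_sections A W) (sections X {x \<in> U. p x \<in> W})"
    and natural: "\<lbrakk>openin (zariski_topology A) W; openin (zariski_topology A) W'; W' \<subseteq> W;
        \<sigma> \<in> carrier (spec_sections A W)\<rbrakk>
      \<Longrightarrow> \<psi> W' (restrict \<sigma> W') = restr X {x \<in> U. p x \<in> W} {x \<in> U. p x \<in> W'} (\<psi> W \<sigma>)"
begin

sublocale A: plain_cring A using cring_A by (simp add: plain_cring_def)

sublocale OU: cring "sections X U" using cring_sections open_U .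

lemma prime_p: "x \<in> U \<Longrightarrow> primeideal (p x) A"
  using bij_betwE[OF bij_p] by auto

abbreviation "primes \<equiv> {P. primeideal P A}"

lemma open_primes: "openin (zariski_topology A) primes"
  using openin_topspace topspace_zariski[OF cring_A] by metis

lemma pt_primes: "{x \<in> U. p x \<in> primes} = U"
  using prime_p by auto

text \<open>The passage from \<open>A\<close> to the coordinate ring \<open>sections X U\<close>. As
  it is onto by \<open>hat_surj\<close>, statements about sections over \<open>U\<close> can be
  checked on elements of \<open>A\<close>.\<close>

definition hat :: "'r \<Rightarrow> 'r" where
  "hat a = \<psi> primes (const_section A primes a)"

abbreviation pt :: "'r set set \<Rightarrow> 'a set" where
  "pt W \<equiv> {x \<in> U. p x \<in> W}"

abbreviation zopen :: "'r \<Rightarrow> 'r set set" where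
  "zopen g \<equiv> {P. primeideal P A \<and> g \<notin> P}"

lemma \<psi>_const_hom:
  assumes W: "openin (zariski_topology A) W"
  shows "(\<lambda>a. \<psi> W (const_section A W a)) \<in> ring_hom A (sections X (pt W))"
proof -
  have "\<psi> W \<in> ring_hom (spec_sections A W) (sections X (pt W))"
    using iso[OF W] by (simp add: ring_iso_def)
  from ring_hom_trans[OF A.const_section_hom[OF W] this] show ?thesis by (simp add: comp_def)
qed

lemma hat_hom: "hat \<in> ring_hom A (sections X U)"
  using \<psi>_const_hom[OF open_primes] unfolding pt_primes by (simp add: hat_def[abs_def])

sublocale hat: ring_hom_cring A "sections X U" hat
  by unfold_locales (rule hat_hom)

lemma restr_hat:
  assumes W: "openin (zariski_topology A) W" and a: "a \<in> carrier A"
  shows "restr X U (pt W) (hat a) = \<psi> W (const_section A W a)"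
proof -
  have Wp: "W \<subseteq> primes" using A.openin_zariski_prime[OF W] by blast
  have "restrict (const_section A primes a) W = const_section A W a"
    using Wp by (auto simp: const_section_def fun_eq_iff)
  then show ?thesis
    using natural[OF open_primes W Wp ring_hom_closed[OF A.const_section_hom[OF open_primes] a]]
    unfolding pt_primes by (simp add: hat_def)
qed

text \<open>On \<open>D(a)\<close> the section \<open>1/a\<close> is an inverse. Conversely, an
  inverse near \<open>x\<close> is a fraction at the prime \<open>p x\<close>, and comparing the
  product with \<open>1\<close> in the local ring there shows that \<open>a\<close> lies outside
  \<open>p x\<close>.\<close>

lemma basic_open_hat:
  assumes a: "a \<in> carrier A"
  shows "basic_open X U (hat a) = pt (zopen a)"
proof (intro equalityI subsetI)
  fix x assume x: "x \<in> pt (zopen a)"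
  let ?W = "zopen a"
  have W: "openin (zariski_topology A) ?W" using A.openin_zariski_basic[OF a] .
  define \<tau> where "\<tau> = (\<lambda>P\<in>?W. fraction A (carrier A - P) \<one>\<^bsub>A\<^esub> a)"
  have \<tau>: "\<tau> \<in> carrier (spec_sections A ?W)" unfolding \<tau>_def
    using A.fraction_section[OF W A.one_closed a] by simp
  have ca: "const_section A ?W a \<in> carrier (spec_sections A ?W)"
    using ring_hom_closed[OF A.const_section_hom[OF W] a] .
  have "fraction A (carrier A - P) a \<one>\<^bsub>A\<^esub> \<otimes>\<^bsub>loc_at A P\<^esub> fraction A (carrier A - P) \<one>\<^bsub>A\<^esub> a = \<one>\<^bsub>loc_at A P\<^esub>"
    if P: "primeideal P A" "a \<notin> P" for P
  proof -
    note S = A.submonoid_compl_prime[OF P(1)] and one = A.one_compl_prime[OF P(1)]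
    have aP: "a \<in> carrier A - P" using a P by simp
    show ?thesis
      using A.localization_mult[OF S a A.one_closed one aP] A.fraction_cancel[OF S A.one_closed one aP] a
      by (simp add: A.localization_one)
  qed
  then have "const_section A ?W a \<otimes>\<^bsub>spec_sections A ?W\<^esub> \<tau> = \<one>\<^bsub>spec_sections A ?W\<^esub>"
    by (auto simp: const_section_def \<tau>_def spec_sections_def intro!: restrict_ext)
  then have inv: "\<psi> ?W (const_section A ?W a) \<otimes>\<^bsub>sections X (pt ?W)\<^esub> \<psi> ?W \<tau> = \<one>\<^bsub>sections X (pt ?W)\<^esub>"
    using ring_iso_memE(2)[OF iso[OF W] ca \<tau>] ring_iso_memE(4)[OF iso[OF W]] by simp
  interpret W: cring "sections X (pt ?W)" using cring_sections[OF open_p[OF W]] .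
  have "restr X U (pt ?W) (hat a) \<in> Units (sections X (pt ?W))"
    unfolding restr_hat[OF W a]
    using ring_iso_memE(1)[OF iso[OF W]] ca \<tau> inv by (intro W.Units_of_mult_one)
  then show "x \<in> basic_open X U (hat a)"
    using mem_basic_openI[OF open_U open_p[OF W]] x by blast
next
  fix x assume "x \<in> basic_open X U (hat a)"
  then obtain N where N: "openin (rtop X) N" "x \<in> N" "N \<subseteq> U" "restr X U N (hat a) \<in> Units (sections X N)"
    by (auto simp: basic_open_def)
  obtain W where W: "openin (zariski_topology A) W" and NW: "N = pt W" using open_ex[OF N(1,3)] by blast
  have ca: "const_section A W a \<in> carrier (spec_sections A W)"
    using ring_hom_closed[OF A.const_section_hom[OF W] a] .
  have c1: "\<one>\<^bsub>spec_sections A W\<^esub> \<in> carrier (spec_sections A W)"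
    using ring_hom_closed[OF A.const_section_hom[OF W] A.one_closed] ring_hom_one[OF A.const_section_hom[OF W]] by simp
  obtain s where s: "s \<in> carrier (sections X N)" "restr X U N (hat a) \<otimes>\<^bsub>sections X N\<^esub> s = \<one>\<^bsub>sections X N\<^esub>"
    using N(4) by (auto simp: Units_def)
  have "s \<in> \<psi> W ` carrier (spec_sections A W)"
    using bij_betw_imp_surj_on[OF ring_iso_memE(5)[OF iso[OF W]]] s NW by simp
  then obtain \<tau> where \<tau>: "\<tau> \<in> carrier (spec_sections A W)" "s = \<psi> W \<tau>" by (rule imageE)
  have "\<psi> W (const_section A W a \<otimes>\<^bsub>spec_sections A W\<^esub> \<tau>) = \<psi> W \<one>\<^bsub>spec_sections A W\<^esub>"
    using s \<tau> restr_hat[OF W a] ring_iso_memE(2)[OF iso[OF W] ca \<tau>(1)] ring_iso_memE(4)[OF iso[OF W]]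
    by (simp add: NW)
  then have eq: "const_section A W a \<otimes>\<^bsub>spec_sections A W\<^esub> \<tau> = \<one>\<^bsub>spec_sections A W\<^esub>"
    using bij_betw_imp_inj_on[OF ring_iso_memE(5)[OF iso[OF W]]] A.spec_mult_closed[OF W ca \<tau>(1)] c1
    by (auto dest: inj_onD)
  have xW: "p x \<in> W" and xU: "x \<in> U" using N NW by auto
  note pr = prime_p[OF xU]
  interpret P: primeideal "p x" A using pr .
  note S = A.submonoid_compl_prime[OF pr] and one = A.one_compl_prime[OF pr]
  obtain b d where bd: "b \<in> carrier A" "d \<in> carrier A" "d \<notin> p x" "\<tau> (p x) = fraction A (carrier A - p x) b d"
    using A.spec_section_local[OF \<tau>(1) xW] by metis
  have "(const_section A W a \<otimes>\<^bsub>spec_sections A W\<^esub> \<tau>) (p x)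
      = fraction A (carrier A - p x) a \<one>\<^bsub>A\<^esub> \<otimes>\<^bsub>loc_at A (p x)\<^esub> fraction A (carrier A - p x) b d"
    using xW bd by (simp add: spec_sections_def const_section_def)
  also have "\<dots> = fraction A (carrier A - p x) (a \<otimes>\<^bsub>A\<^esub> b) d"
    using A.localization_mult[OF S a bd(1) one] bd by simp
  finally have "fraction A (carrier A - p x) (a \<otimes>\<^bsub>A\<^esub> b) d = fraction A (carrier A - p x) \<one>\<^bsub>A\<^esub> \<one>\<^bsub>A\<^esub>"
    unfolding eq using xW by (simp add: spec_sections_def A.localization_one)
  then obtain u where u: "u \<in> carrier A - p x" "u \<otimes>\<^bsub>A\<^esub> (\<one>\<^bsub>A\<^esub> \<otimes>\<^bsub>A\<^esub> (a \<otimes>\<^bsub>A\<^esub> b) \<ominus>\<^bsub>A\<^esub> d \<otimes>\<^bsub>A\<^esub> \<one>\<^bsub>A\<^esub>) = \<zero>\<^bsub>A\<^esub>"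
    using A.fraction_eqD[OF S _ A.one_closed _ one, of "a \<otimes>\<^bsub>A\<^esub> b" d] a bd by auto
  \<comment> \<open>The equation \<open>(a b)/d = 1\<close> in the local ring, cleared of
    denominators. As \<open>u\<close> and \<open>d\<close> lie outside the prime, so does
    \<open>a\<close>.\<close>
  have "u \<otimes>\<^bsub>A\<^esub> d = (u \<otimes>\<^bsub>A\<^esub> b) \<otimes>\<^bsub>A\<^esub> a \<ominus>\<^bsub>A\<^esub> u \<otimes>\<^bsub>A\<^esub> (\<one>\<^bsub>A\<^esub> \<otimes>\<^bsub>A\<^esub> (a \<otimes>\<^bsub>A\<^esub> b) \<ominus>\<^bsub>A\<^esub> d \<otimes>\<^bsub>A\<^esub> \<one>\<^bsub>A\<^esub>)"
  proof -
    have "u \<in> carrier A" using u by simp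
    then show ?thesis using a bd(1,2) by algebra
  qed
  also have "\<dots> = (u \<otimes>\<^bsub>A\<^esub> b) \<otimes>\<^bsub>A\<^esub> a" unfolding u(2) using u a bd by (simp add: a_minus_def)
  finally have ud: "u \<otimes>\<^bsub>A\<^esub> d = (u \<otimes>\<^bsub>A\<^esub> b) \<otimes>\<^bsub>A\<^esub> a" .
  have "a \<notin> p x"
  proof
    assume "a \<in> p x"
    then have "u \<otimes>\<^bsub>A\<^esub> d \<in> p x" unfolding ud using P.I_l_closed u bd by simp
    then show False using P.I_prime[of u d] u bd by auto
  qed
  then show "x \<in> pt (zopen a)" using pr xU by simp
qed

text \<open>Carries \<open>section_on_basic_open\<close> through \<open>\<psi>\<close>: over
  \<open>D(g)\<close> a section is some \<open>a / g^n\<close>. Clearing the denominator states this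
  inside the ring of sections.\<close>

lemma hat_fraction:
  assumes g: "g \<in> carrier A" and \<tau>: "\<tau> \<in> carrier (sections X (pt (zopen g)))"
  shows "\<exists>a\<in>carrier A. \<exists>n::nat. restr X U (pt (zopen g)) (hat a)
    = restr X U (pt (zopen g)) (hat (g [^]\<^bsub>A\<^esub> n)) \<otimes>\<^bsub>sections X (pt (zopen g))\<^esub> \<tau>"
proof -
  let ?W = "zopen g"
  have W: "openin (zariski_topology A) ?W" using A.openin_zariski_basic[OF g] .
  have "\<tau> \<in> \<psi> ?W ` carrier (spec_sections A ?W)"
    using bij_betw_imp_surj_on[OF ring_iso_memE(5)[OF iso[OF W]]] \<tau> by simp
  then obtain \<sigma> where \<sigma>: "\<sigma> \<in> carrier (spec_sections A ?W)" "\<tau> = \<psi> ?W \<sigma>" by (rule imageE)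
  have "\<exists>V. openin (zariski_topology A) V \<and> P \<in> V \<and>
      (\<exists>a\<in>carrier A. \<exists>b\<in>carrier A. \<forall>Q\<in>V. b \<notin> Q \<and> \<sigma> Q = fraction A (carrier A - Q) a b)"
    if "primeideal P A" "g \<notin> P" for P
  proof -
    have "P \<in> ?W" using that by simp
    from A.spec_section_locally_fraction[OF \<sigma>(1) this] show ?thesis by (elim ex_forward) simp
  qed
  then obtain a and n :: nat where a: "a \<in> carrier A"
    and an: "\<And>P. \<lbrakk>primeideal P A; g \<notin> P\<rbrakk> \<Longrightarrow> \<sigma> P = fraction A (carrier A - P) a (g [^]\<^bsub>A\<^esub> n)"
    using A.section_on_basic_open[OF g, of \<sigma>] by blast
  have gn: "g [^]\<^bsub>A\<^esub> n \<in> carrier A" using g by simp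
  have ca: "const_section A ?W (g [^]\<^bsub>A\<^esub> n) \<in> carrier (spec_sections A ?W)"
    using ring_hom_closed[OF A.const_section_hom[OF W] gn] .
  have "fraction A (carrier A - P) (g [^]\<^bsub>A\<^esub> n) \<one>\<^bsub>A\<^esub> \<otimes>\<^bsub>loc_at A P\<^esub> \<sigma> P = fraction A (carrier A - P) a \<one>\<^bsub>A\<^esub>"
    if P: "primeideal P A" "g \<notin> P" for P
  proof -
    note S = A.submonoid_compl_prime[OF P(1)] and one = A.one_compl_prime[OF P(1)]
    have gP: "g [^]\<^bsub>A\<^esub> n \<in> carrier A - P" using A.prime_pow_mem[OF P(1) g] P gn by auto
    show ?thesis unfolding an[OF P]
      using A.localization_mult[OF S gn a one gP] A.fraction_cancel[OF S a one gP] gn by simp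
  qed
  then have "const_section A ?W (g [^]\<^bsub>A\<^esub> n) \<otimes>\<^bsub>spec_sections A ?W\<^esub> \<sigma> = const_section A ?W a"
    by (auto simp: const_section_def spec_sections_def intro!: restrict_ext)
  then have "\<psi> ?W (const_section A ?W a) = \<psi> ?W (const_section A ?W (g [^]\<^bsub>A\<^esub> n)) \<otimes>\<^bsub>sections X (pt ?W)\<^esub> \<tau>"
    using ring_iso_memE(2)[OF iso[OF W] ca \<sigma>(1)] \<sigma>(2) by simp
  then have "restr X U (pt ?W) (hat a)
      = restr X U (pt ?W) (hat (g [^]\<^bsub>A\<^esub> n)) \<otimes>\<^bsub>sections X (pt ?W)\<^esub> \<tau>"
    unfolding restr_hat[OF W a] restr_hat[OF W gn] .
  then show ?thesis using a by (intro bexI exI)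
qed

text \<open>The case \<open>g = \<one>\<close> of \<open>hat_fraction\<close>, where the basic open
  set is all of \<open>U\<close> and the denominator disappears.\<close>

lemma hat_surj:
  assumes "s \<in> carrier (sections X U)"
  obtains a where "a \<in> carrier A" "s = hat a"
proof -
  have eq: "pt (zopen \<one>\<^bsub>A\<^esub>) = U" using A.one_compl_prime prime_p by auto
  obtain a and n :: nat where "a \<in> carrier A"
    "restr X U U (hat a) = restr X U U (hat (\<one>\<^bsub>A\<^esub> [^]\<^bsub>A\<^esub> n)) \<otimes>\<^bsub>sections X U\<^esub> s"
    using hat_fraction[OF A.one_closed] assms unfolding eq by metis
  then show ?thesis using that[of a] assms restr_id[OF open_U] by simp
qed

lemma basic_open_basis:
  assumes N: "openin (rtop X) N" "x \<in> N" "N \<subseteq> U"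
  shows "\<exists>s\<in>carrier (sections X U). x \<in> basic_open X U s \<and> basic_open X U s \<subseteq> N"
proof -
  obtain W where W: "openin (zariski_topology A) W" and NW: "N = pt W" using open_ex[OF N(1,3)] by blast
  have "p x \<in> W" using N NW by simp
  then obtain h where h: "h \<in> carrier A" "h \<notin> p x" "\<And>Q. \<lbrakk>primeideal Q A; h \<notin> Q\<rbrakk> \<Longrightarrow> Q \<in> W"
    using A.zariski_basic_open[OF W] by metis
  have "x \<in> pt (zopen h)" "pt (zopen h) \<subseteq> N" using h N NW prime_p by auto
  then show ?thesis using basic_open_hat[OF h(1)] h(1) by (intro bexI[of _ "hat h"]) auto
qed

lemma section_fraction:
  assumes s: "s \<in> carrier (sections X U)" and \<tau>: "\<tau> \<in> carrier (sections X (basic_open X U s))"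
  shows "\<exists>a\<in>carrier (sections X U). \<exists>n::nat. restr X U (basic_open X U s) a
    = restr X U (basic_open X U s) (s [^]\<^bsub>sections X U\<^esub> n) \<otimes>\<^bsub>sections X (basic_open X U s)\<^esub> \<tau>"
proof -
  obtain g where g: "g \<in> carrier A" "s = hat g" using hat_surj[OF s] by metis
  show ?thesis
    using hat_fraction[OF g(1), of \<tau>] \<tau> hat.hom_closed
    unfolding g(2) basic_open_hat[OF g(1)] hat.ring.hom_nat_pow[OF g(1)] by fast
qed

text \<open>A section that vanishes over \<open>D(g)\<close> has value zero in every local ring
  there, so \<open>vanishing_on_basic_open\<close> gives one power of \<open>g\<close> for all
  primes. With \<open>section_fraction\<close> this identifies the sections over a basic open set as
  a localization.\<close>

lemma section_vanish:
  assumes s: "s \<in> carrier (sections X U)" and t: "t \<in> carrier (sections X U)"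
    and z: "restr X U (basic_open X U s) t = \<zero>\<^bsub>sections X (basic_open X U s)\<^esub>"
  shows "\<exists>n::nat. s [^]\<^bsub>sections X U\<^esub> n \<otimes>\<^bsub>sections X U\<^esub> t = \<zero>\<^bsub>sections X U\<^esub>"
proof -
  obtain g where g: "g \<in> carrier A" "s = hat g" using hat_surj[OF s] by metis
  obtain a where a: "a \<in> carrier A" "t = hat a" using hat_surj[OF t] by metis
  let ?W = "zopen g"
  have W: "openin (zariski_topology A) ?W" using A.openin_zariski_basic[OF g(1)] .
  interpret OW: cring "sections X (pt ?W)" using cring_sections open_p[OF W] by blast
  have cl: "const_section A ?W b \<in> carrier (spec_sections A ?W)" if "b \<in> carrier A" for b
    using ring_hom_closed[OF A.const_section_hom[OF W] that] .
  have "\<psi> ?W (const_section A ?W a) = \<zero>\<^bsub>sections X (pt ?W)\<^esub>"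
    using z unfolding g(2) a(2) basic_open_hat[OF g(1)] restr_hat[OF W a(1)] .
  also have "\<dots> = \<psi> ?W (const_section A ?W \<zero>\<^bsub>A\<^esub>)"
    using ring_hom_zero[OF \<psi>_const_hom[OF W] A.ring_axioms OW.ring_axioms] by simp
  finally have "const_section A ?W a = const_section A ?W \<zero>\<^bsub>A\<^esub>"
    using bij_betw_imp_inj_on[OF ring_iso_memE(5)[OF iso[OF W]]] cl a by (auto dest: inj_onD)
  then have eq: "fraction A (carrier A - P) a \<one>\<^bsub>A\<^esub> = fraction A (carrier A - P) \<zero>\<^bsub>A\<^esub> \<one>\<^bsub>A\<^esub>"
    if "primeideal P A" "g \<notin> P" for P
    using that by (auto simp: const_section_def dest: fun_cong[of _ _ P])
  have "\<exists>u\<in>carrier A - P. u \<otimes>\<^bsub>A\<^esub> a = \<zero>\<^bsub>A\<^esub>" if P: "primeideal P A" "g \<notin> P" for P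
  proof -
    note S = A.submonoid_compl_prime[OF P(1)] and one = A.one_compl_prime[OF P(1)]
    obtain u where "u \<in> carrier A - P"
      "u \<otimes>\<^bsub>A\<^esub> (\<one>\<^bsub>A\<^esub> \<otimes>\<^bsub>A\<^esub> a \<ominus>\<^bsub>A\<^esub> \<one>\<^bsub>A\<^esub> \<otimes>\<^bsub>A\<^esub> \<zero>\<^bsub>A\<^esub>) = \<zero>\<^bsub>A\<^esub>"
      using A.fraction_eqD[OF S a(1) A.zero_closed one one eq[OF P]] by metis
    then show ?thesis using a by (auto simp: a_minus_def)
  qed
  then obtain n :: nat where "g [^]\<^bsub>A\<^esub> n \<otimes>\<^bsub>A\<^esub> a = \<zero>\<^bsub>A\<^esub>"
    using A.vanishing_on_basic_open[OF a(1) g(1)] by blast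
  then have "hat (g [^]\<^bsub>A\<^esub> n) \<otimes>\<^bsub>sections X U\<^esub> hat a = \<zero>\<^bsub>sections X U\<^esub>"
    using g a by (metis A.nat_pow_closed hat.hom_mult hat.hom_zero)
  then show ?thesis using g a hat.ring.hom_nat_pow[OF g(1)] by metis
qed

lemma mem_basic_open_hat:
  assumes "a \<in> carrier A" "x \<in> U"
  shows "x \<in> basic_open X U (hat a) \<longleftrightarrow> a \<notin> p x"
  using assms prime_p by (simp add: basic_open_hat)

text \<open>This is the image of the prime \<open>p x\<close> under \<open>hat\<close>, described
  without the chart; \<open>mem_basic_open_hat\<close> carries the prime property over.\<close>

lemma prime_of_point:
  assumes x: "x \<in> U"
  shows "primeideal {s \<in> carrier (sections X U). x \<notin> basic_open X U s} (sections X U)"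
    (is "primeideal ?P _")
proof -
  interpret P: primeideal "p x" A using prime_p[OF x] .
  have img: "hat a \<in> ?P \<longleftrightarrow> a \<in> p x" if "a \<in> carrier A" for a
    using mem_basic_open_hat[OF that x] that by simp
  have cases: "\<exists>a\<in>carrier A. s = hat a" if "s \<in> carrier (sections X U)" for s
    using hat_surj[OF that] by metis
  have casesP: "\<exists>a\<in>p x. s = hat a" if "s \<in> ?P" for s
    using that cases img by blast
  show ?thesis
  proof (rule primeidealI)
    show "ideal ?P (sections X U)"
    proof (rule OU.ideal_of_closed)
      show "\<zero>\<^bsub>sections X U\<^esub> \<in> ?P"
        using img[OF A.zero_closed] additive_subgroup.zero_closed[OF P.is_additive_subgroup]
        unfolding hat.hom_zero by blast
      fix s t assume s: "s \<in> ?P" and "t \<in> ?P"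
      then obtain a b where *: "a \<in> p x" "s = hat a" "b \<in> p x" "t = hat b" using casesP by meson
      then have "a \<in> carrier A" "b \<in> carrier A" by auto
      then show "s \<oplus>\<^bsub>sections X U\<^esub> t \<in> ?P" using img[of "a \<oplus>\<^bsub>A\<^esub> b"] P.a_closed * by simp
    next
      fix s t assume "s \<in> ?P" and t: "t \<in> carrier (sections X U)"
      then obtain a b where *: "a \<in> p x" "s = hat a" "b \<in> carrier A" "t = hat b"
        using casesP cases by meson
      then have "a \<in> carrier A" by auto
      then show "t \<otimes>\<^bsub>sections X U\<^esub> s \<in> ?P" using img[of "b \<otimes>\<^bsub>A\<^esub> a"] P.I_l_closed * by simp
    qed auto
    have "\<one>\<^bsub>A\<^esub> \<notin> p x" using A.one_compl_prime[OF prime_p[OF x]] by simp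
    then show "carrier (sections X U) \<noteq> ?P" using img[OF A.one_closed] by auto
    fix s t assume st: "s \<in> carrier (sections X U)" "t \<in> carrier (sections X U)" "s \<otimes>\<^bsub>sections X U\<^esub> t \<in> ?P"
    then obtain a b where *: "a \<in> carrier A" "s = hat a" "b \<in> carrier A" "t = hat b"
      using cases by meson
    then have "a \<otimes>\<^bsub>A\<^esub> b \<in> p x" using img[of "a \<otimes>\<^bsub>A\<^esub> b"] st(3) by simp
    then show "s \<in> ?P \<or> t \<in> ?P" using P.I_prime[of a b] img * by blast
  qed (rule OU.is_cring)
qed

text \<open>The preimage of \<open>Q\<close> under \<open>hat\<close> is a prime of
  \<open>A\<close>, hence some \<open>p x\<close>; surjectivity of \<open>hat\<close> turns this
  into a statement about all sections over \<open>U\<close>.\<close>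

lemma point_of_prime:
  assumes Q: "primeideal Q (sections X U)"
  shows "\<exists>x\<in>U. \<forall>s\<in>carrier (sections X U). s \<in> Q \<longleftrightarrow> x \<notin> basic_open X U s"
proof -
  have "primeideal {a \<in> carrier A. hat a \<in> Q} A" using hat.primeideal_vimage[OF Q] .
  then have "{a \<in> carrier A. hat a \<in> Q} \<in> p ` U" using bij_betw_imp_surj_on[OF bij_p] by simp
  then obtain x where x: "x \<in> U" and px: "p x = {a \<in> carrier A. hat a \<in> Q}" by (metis (no_types, lifting) imageE)
  have "s \<in> Q \<longleftrightarrow> x \<notin> basic_open X U s" if s: "s \<in> carrier (sections X U)" for s
  proof -
    obtain a where a: "a \<in> carrier A" "s = hat a" using hat_surj[OF s] by metis
    show ?thesis using mem_basic_open_hat[OF a(1) x] a px by simp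
  qed
  then show ?thesis using x by blast
qed

lemma points_separated:
  assumes x: "x \<in> U" and y: "y \<in> U"
    and eq: "\<And>s. s \<in> carrier (sections X U) \<Longrightarrow> x \<in> basic_open X U s \<longleftrightarrow> y \<in> basic_open X U s"
  shows "x = y"
proof -
  have sub: "p z \<subseteq> carrier A" if "z \<in> U" for z
    using prime_p[OF that] by (simp add: ideal.axioms(1) additive_subgroup.a_subset primeideal.axioms(1))
  have "a \<in> p x \<longleftrightarrow> a \<in> p y" if "a \<in> carrier A" for a
    using eq[of "hat a"] mem_basic_open_hat that x y by auto
  then have "p x = p y" using sub[OF x] sub[OF y] by auto
  then show ?thesis using bij_betw_imp_inj_on[OF bij_p] x y by (auto dest: inj_onD)
qed

end

lemma affine_open_chart:
  fixes X :: "('a, 'r) ringed_space"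
  assumes "ringed_space X" "affine_open X U"
  shows "\<exists>A p \<psi>. affine_chart X U A p \<psi>"
proof -
  interpret ringed_space X by fact
  obtain A :: "'r ring" and f where U: "openin (rtop X) U" and A: "cring A" and f: "lrs_iso (open_subspace X U) (Spec A) f"
    using assms(2) by (auto simp: affine_open_def affine_scheme_def)
  have m: "lrs_morphism (open_subspace X U) (Spec A) f" using f by (simp add: lrs_iso_def)
  have pre: "preim (open_subspace X U) f W = {x \<in> U. pt_map f x \<in> W}" for W
    using points_open_subspace[OF U] by (auto simp: preim_def)
  have [simp]: "rtop (Spec A) = zariski_topology A" "sections (Spec A) = spec_sections A"
    "restr (Spec A) = (\<lambda>U V \<sigma>. restrict \<sigma> V)" by (auto simp: Spec_def)
  note D = lrs_isoD[OF f]
  have "affine_chart X U A (pt_map f) (sec_map f)"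
  proof (intro affine_chart.intro affine_chart_axioms.intro)
    show "bij_betw (pt_map f) U {P. primeideal P A}"
      using D(1) points_open_subspace[OF U] topspace_zariski[OF A] by simp
    show "openin (rtop X) {x \<in> U. pt_map f x \<in> W}" if "openin (zariski_topology A) W" for W
      using openin_preim[OF m, of W] that openin_open_subspace[OF U] pre by simp
    show "\<exists>W. openin (zariski_topology A) W \<and> N = {x \<in> U. pt_map f x \<in> W}"
      if "openin (rtop X) N" "N \<subseteq> U" for N
      using D(2)[of N] that openin_open_subspace[OF U] pre by simp
    show "sec_map f W \<in> ring_iso (spec_sections A W) (sections X {x \<in> U. pt_map f x \<in> W})"
      if "openin (zariski_topology A) W" for W
      using D(3)[of W] that pre by simp
    show "sec_map f W' (restrict \<sigma> W') =
        restr X {x \<in> U. pt_map f x \<in> W} {x \<in> U. pt_map f x \<in> W'} (sec_map f W \<sigma>)"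
      if "openin (zariski_topology A) W" "openin (zariski_topology A) W'" "W' \<subseteq> W"
        "\<sigma> \<in> carrier (spec_sections A W)" for W W' \<sigma>
      using lrs_morphism.sec_map_restr[OF m, of W W' \<sigma>] that pre by simp
  qed (fact U A assms(1))+
  then show ?thesis by blast
qed

section \<open>Affine open sets in terms of their own coordinate rings\<close>

context ringed_space
begin

context
  fixes U :: "'a set"
  assumes aff: "affine_open X U"
begin

text \<open>As in each lemma of this block, a chart is chosen and then forgotten: the conclusion
  speaks only of \<open>sections X U\<close> and \<open>basic_open\<close>, so it does not depend on
  the choice.\<close>

lemma affine_basis:
  assumes "openin (rtop X) N" "x \<in> N" "N \<subseteq> U"
  obtains s where "s \<in> carrier (sections X U)" "x \<in> basic_open X U s" "basic_open X U s \<subseteq> N"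
proof -
  obtain A p \<psi> where "affine_chart X U A p \<psi>" using affine_open_chart[OF ringed_space_axioms aff] by blast
  from affine_chart.basic_open_basis[OF this assms] that show ?thesis by blast
qed

lemma affine_fraction:
  assumes "s \<in> carrier (sections X U)" "\<tau> \<in> carrier (sections X (basic_open X U s))"
  obtains a and n :: nat where "a \<in> carrier (sections X U)" "restr X U (basic_open X U s) a
    = restr X U (basic_open X U s) (s [^]\<^bsub>sections X U\<^esub> n) \<otimes>\<^bsub>sections X (basic_open X U s)\<^esub> \<tau>"
proof -
  obtain A p \<psi> where "affine_chart X U A p \<psi>" using affine_open_chart[OF ringed_space_axioms aff] by blast
  from affine_chart.section_fraction[OF this assms] that show ?thesis by blast
qed

lemma affine_vanish:
  assumes "s \<in> carrier (sections X U)" "t \<in> carrier (sections X U)"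
    "restr X U (basic_open X U s) t = \<zero>\<^bsub>sections X (basic_open X U s)\<^esub>"
  obtains n :: nat where "s [^]\<^bsub>sections X U\<^esub> n \<otimes>\<^bsub>sections X U\<^esub> t = \<zero>\<^bsub>sections X U\<^esub>"
proof -
  obtain A p \<psi> where "affine_chart X U A p \<psi>" using affine_open_chart[OF ringed_space_axioms aff] by blast
  from affine_chart.section_vanish[OF this assms] that show ?thesis by blast
qed

lemma affine_prime_of_point:
  assumes "x \<in> U"
  shows "primeideal {s \<in> carrier (sections X U). x \<notin> basic_open X U s} (sections X U)"
proof -
  obtain A p \<psi> where "affine_chart X U A p \<psi>" using affine_open_chart[OF ringed_space_axioms aff] by blast
  from affine_chart.prime_of_point[OF this assms] show ?thesis .
qed

lemma affine_point_of_prime: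
  assumes "primeideal Q (sections X U)"
  obtains x where "x \<in> U" "\<And>s. s \<in> carrier (sections X U) \<Longrightarrow> s \<in> Q \<longleftrightarrow> x \<notin> basic_open X U s"
proof -
  obtain A p \<psi> where "affine_chart X U A p \<psi>" using affine_open_chart[OF ringed_space_axioms aff] by blast
  from affine_chart.point_of_prime[OF this assms] that show ?thesis by blast
qed

lemma affine_points_separated:
  assumes "x \<in> U" "y \<in> U"
    and "\<And>s. s \<in> carrier (sections X U) \<Longrightarrow> x \<in> basic_open X U s \<longleftrightarrow> y \<in> basic_open X U s"
  shows "x = y"
proof -
  obtain A p \<psi> where "affine_chart X U A p \<psi>" using affine_open_chart[OF ringed_space_axioms aff] by blast
  from affine_chart.points_separated[OF this assms] show ?thesis .
qed

end

end


section \<open>Stalks\<close>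

context ringed_space
begin

text \<open>Transitivity of agreement near \<open>x\<close>: two neighbourhoods on which sections
  agree are replaced by their intersection.\<close>

lemma germ_eqI:
  assumes U: "openin (rtop X) U" "s \<in> carrier (sections X U)"
    and V: "openin (rtop X) V" "t \<in> carrier (sections X V)"
    and W: "openin (rtop X) W" "x \<in> W" "W \<subseteq> U" "W \<subseteq> V" "restr X U W s = restr X V W t"
  shows "germ X x U s = germ X x V t"
proof -
  have sub: "germ X x U s \<subseteq> germ X x V t"
    if U: "openin (rtop X) U" "s \<in> carrier (sections X U)"
      and V: "openin (rtop X) V" "t \<in> carrier (sections X V)"
      and W: "W \<subseteq> U" "W \<subseteq> V" "restr X U W s = restr X V W t" for U V s t
  proof
    fix z assume "z \<in> germ X x U s"
    then obtain V' t' W' where z: "z = (V', t')" "openin (rtop X) V'" "x \<in> V'" "t' \<in> carrier (sections X V')"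
      "openin (rtop X) W'" "x \<in> W'" "W' \<subseteq> U" "W' \<subseteq> V'" "restr X U W' s = restr X V' W' t'"
      by (auto simp: germ_def)
    have o: "openin (rtop X) (W \<inter> W')" using assms(5) z by auto
    have "restr X V (W \<inter> W') t = restr X W (W \<inter> W') (restr X V W t)"
      using restr_comp[OF V(1) assms(5) o _ W(2) V(2)] by simp
    also have "\<dots> = restr X U (W \<inter> W') s"
      unfolding W(3)[symmetric] using restr_comp[OF U(1) assms(5) o _ W(1) U(2)] by simp
    also have "\<dots> = restr X W' (W \<inter> W') (restr X U W' s)"
      using restr_comp[OF U(1) z(5) o _ z(7) U(2)] by simp
    also have "\<dots> = restr X V' (W \<inter> W') t'"
      unfolding z(9) using restr_comp[OF z(2) z(5) o _ z(8) z(4)] by simp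
    finally show "z \<in> germ X x V t"
      unfolding germ_def z(1) using z o assms(6) W by (intro CollectI case_prodI conjI exI[of _ "W \<inter> W'"]) auto
  qed
  show ?thesis using sub[OF U V W(3-5)] sub[OF V U W(4,3) W(5)[symmetric]] by blast
qed

lemma germ_memD:
  assumes "openin (rtop X) U" "s \<in> carrier (sections X U)" "(V, t) \<in> germ X x U s"
  shows "openin (rtop X) V" "x \<in> V" "t \<in> carrier (sections X V)" "germ X x V t = germ X x U s"
proof -
  obtain W where *: "openin (rtop X) V" "x \<in> V" "t \<in> carrier (sections X V)"
    "openin (rtop X) W" "x \<in> W" "W \<subseteq> U" "W \<subseteq> V" "restr X U W s = restr X V W t"
    using assms(3) by (auto simp: germ_def)
  then show "openin (rtop X) V" "x \<in> V" "t \<in> carrier (sections X V)" "germ X x V t = germ X x U s"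
    using germ_eqI[OF assms(1,2) *(1,3-8)] by auto
qed

lemma germ_self:
  assumes "openin (rtop X) U" "x \<in> U" "s \<in> carrier (sections X U)"
  shows "(U, s) \<in> germ X x U s"
  using assms by (auto simp: germ_def)

lemma germ_eqD:
  assumes V: "openin (rtop X) V" "x \<in> V" "t \<in> carrier (sections X V)" and eq: "germ X x U s = germ X x V t"
  obtains W where "openin (rtop X) W" "x \<in> W" "W \<subseteq> U" "W \<subseteq> V" "restr X U W s = restr X V W t"
proof -
  have "(V, t) \<in> germ X x U s" unfolding eq using germ_self[OF V] .
  then show ?thesis using that by (auto simp: germ_def)
qed

lemma germ_restr:
  assumes "openin (rtop X) U" "openin (rtop X) V" "V \<subseteq> U" "x \<in> V" "s \<in> carrier (sections X U)"
  shows "germ X x V (restr X U V s) = germ X x U s"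
  using assms restr_closed restr_id by (intro germ_eqI[where W = V]) auto

text \<open>Sums and products of germs are both unions over representatives. With the operation as a
  parameter \<open>opr\<close> that commutes with restriction, independence of the representatives
  is proved once for both.\<close>

lemma germ_op:
  fixes opr :: "'r ring \<Rightarrow> 'r \<Rightarrow> 'r \<Rightarrow> 'r"
  assumes closed: "\<And>U s t. \<lbrakk>openin (rtop X) U; s \<in> carrier (sections X U); t \<in> carrier (sections X U)\<rbrakk>
      \<Longrightarrow> opr (sections X U) s t \<in> carrier (sections X U)"
    and hom: "\<And>U V s t. \<lbrakk>openin (rtop X) U; openin (rtop X) V; V \<subseteq> U;
        s \<in> carrier (sections X U); t \<in> carrier (sections X U)\<rbrakk>
      \<Longrightarrow> restr X U V (opr (sections X U) s t) = opr (sections X V) (restr X U V s) (restr X U V t)"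
    and U: "openin (rtop X) U" "x \<in> U" "s \<in> carrier (sections X U)"
    and V: "openin (rtop X) V" "x \<in> V" "t \<in> carrier (sections X V)"
  shows "(\<Union>(U, s)\<in>germ X x U s. \<Union>(V, t)\<in>germ X x V t.
      germ X x (U \<inter> V) (opr (sections X (U \<inter> V)) (restr X U (U \<inter> V) s) (restr X V (U \<inter> V) t)))
    = germ X x (U \<inter> V) (opr (sections X (U \<inter> V)) (restr X U (U \<inter> V) s) (restr X V (U \<inter> V) t))"
proof (rule UN_pairs_const)
  show "germ X x U s \<noteq> {}" "germ X x V t \<noteq> {}" using germ_self[OF U] germ_self[OF V] by auto
  fix U' s' V' t' assume s': "(U', s') \<in> germ X x U s" and t': "(V', t') \<in> germ X x V t"
  note U' = germ_memD[OF U(1,3) s'] and V' = germ_memD[OF V(1,3) t']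
  obtain W1 where 1: "openin (rtop X) W1" "x \<in> W1" "W1 \<subseteq> U'" "W1 \<subseteq> U" "restr X U' W1 s' = restr X U W1 s"
    using germ_eqD[OF U U'(4)] by metis
  obtain W2 where 2: "openin (rtop X) W2" "x \<in> W2" "W2 \<subseteq> V'" "W2 \<subseteq> V" "restr X V' W2 t' = restr X V W2 t"
    using germ_eqD[OF V V'(4)] by metis
  let ?W = "W1 \<inter> W2"
  have o: "openin (rtop X) ?W" "openin (rtop X) (U \<inter> V)" "openin (rtop X) (U' \<inter> V')"
    using 1 2 U V U' V' by auto
  have rs: "restr X U' ?W s' = restr X U ?W s"
    using restr_comp[OF U'(1) 1(1) o(1) _ 1(3) U'(3)] restr_comp[OF U(1) 1(1) o(1) _ 1(4) U(3)] 1(5) by simp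
  have rt: "restr X V' ?W t' = restr X V ?W t"
    using restr_comp[OF V'(1) 2(1) o(1) _ 2(3) V'(3)] restr_comp[OF V(1) 2(1) o(1) _ 2(4) V(3)] 2(5) by simp
  \<comment> \<open>Restricting the result equals operating on the restrictions, so on
    \<open>?W\<close> only the restricted representatives matter, and these coincide.\<close>
  have val: "restr X (A \<inter> B) ?W (opr (sections X (A \<inter> B)) (restr X A (A \<inter> B) a) (restr X B (A \<inter> B) b))
      = opr (sections X ?W) (restr X A ?W a) (restr X B ?W b)"
    if "openin (rtop X) A" "openin (rtop X) B" "?W \<subseteq> A \<inter> B" "a \<in> carrier (sections X A)"
      "b \<in> carrier (sections X B)" for A B a b
  proof -
    have oAB: "openin (rtop X) (A \<inter> B)" using that by auto
    show ?thesis
      using hom[OF oAB o(1) that(3) restr_closed[OF that(1) oAB _ that(4)] restr_closed[OF that(2) oAB _ that(5)]]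
        restr_comp[OF that(1) oAB o(1) that(3) _ that(4)] restr_comp[OF that(2) oAB o(1) that(3) _ that(5)]
      by simp
  qed
  show "germ X x (U' \<inter> V') (opr (sections X (U' \<inter> V')) (restr X U' (U' \<inter> V') s') (restr X V' (U' \<inter> V') t'))
      = germ X x (U \<inter> V) (opr (sections X (U \<inter> V)) (restr X U (U \<inter> V) s) (restr X V (U \<inter> V) t))"
  proof (rule germ_eqI[OF o(3) _ o(2) _ o(1)])
    show "x \<in> ?W" "?W \<subseteq> U' \<inter> V'" "?W \<subseteq> U \<inter> V" using 1 2 by auto
    then show "restr X (U' \<inter> V') ?W (opr (sections X (U' \<inter> V')) (restr X U' (U' \<inter> V') s') (restr X V' (U' \<inter> V') t'))
      = restr X (U \<inter> V) ?W (opr (sections X (U \<inter> V)) (restr X U (U \<inter> V) s) (restr X V (U \<inter> V) t))"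
      using val[of U' V' s' t'] val[of U V s t] U V U' V' rs rt by simp
  qed (use U V U' V' o in \<open>auto intro!: closed restr_closed\<close>)
qed

lemma stalk_mult:
  assumes U: "openin (rtop X) U" "x \<in> U" "s \<in> carrier (sections X U)"
    and V: "openin (rtop X) V" "x \<in> V" "t \<in> carrier (sections X V)"
  shows "germ X x U s \<otimes>\<^bsub>stalk X x\<^esub> germ X x V t
    = germ X x (U \<inter> V) (restr X U (U \<inter> V) s \<otimes>\<^bsub>sections X (U \<inter> V)\<^esub> restr X V (U \<inter> V) t)"
  using germ_op[of "\<lambda>R. monoid.mult R", OF _ _ U V] monoid.m_closed[OF ring.is_monoid[OF cring.axioms(1)[OF cring_sections]]]
    ring_hom_mult[OF restr_hom] by (simp add: stalk_def)

lemma stalk_add: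
  assumes U: "openin (rtop X) U" "x \<in> U" "s \<in> carrier (sections X U)"
    and V: "openin (rtop X) V" "x \<in> V" "t \<in> carrier (sections X V)"
  shows "germ X x U s \<oplus>\<^bsub>stalk X x\<^esub> germ X x V t
    = germ X x (U \<inter> V) (restr X U (U \<inter> V) s \<oplus>\<^bsub>sections X (U \<inter> V)\<^esub> restr X V (U \<inter> V) t)"
  using germ_op[of "\<lambda>R. ring.add R", OF _ _ U V] ring.ring_simprules(1)[OF cring.axioms(1)[OF cring_sections]]
    ring_hom_add[OF restr_hom] by (simp add: stalk_def)

lemma stalk_carrierE:
  assumes "p \<in> carrier (stalk X x)"
  obtains U s where "openin (rtop X) U" "x \<in> U" "s \<in> carrier (sections X U)" "p = germ X x U s"
  using assms by (auto simp: stalk_def)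

lemma stalk_carrierI:
  "\<lbrakk>openin (rtop X) U; x \<in> U; s \<in> carrier (sections X U)\<rbrakk> \<Longrightarrow> germ X x U s \<in> carrier (stalk X x)"
  by (auto simp: stalk_def)

lemma stalk_one: "\<one>\<^bsub>stalk X x\<^esub> = germ X x (points X) \<one>\<^bsub>sections X (points X)\<^esub>"
  and stalk_zero: "\<zero>\<^bsub>stalk X x\<^esub> = germ X x (points X) \<zero>\<^bsub>sections X (points X)\<^esub>"
  by (auto simp: stalk_def)

lemma germ_one:
  assumes "openin (rtop X) U" "x \<in> U"
  shows "germ X x U \<one>\<^bsub>sections X U\<^esub> = \<one>\<^bsub>stalk X x\<^esub>"
proof -
  interpret ring_hom_cring "sections X (points X)" "sections X U" "restr X (points X) U"
    using restr_rhc[OF openin_topspace assms(1)] openin_subset[OF assms(1)] by simp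
  show ?thesis
    using germ_restr[OF openin_topspace assms(1) openin_subset[OF assms(1)] assms(2) R.one_closed]
    by (simp add: stalk_one)
qed

lemma germ_zero:
  assumes "openin (rtop X) U" "x \<in> U"
  shows "germ X x U \<zero>\<^bsub>sections X U\<^esub> = \<zero>\<^bsub>stalk X x\<^esub>"
proof -
  interpret ring_hom_cring "sections X (points X)" "sections X U" "restr X (points X) U"
    using restr_rhc[OF openin_topspace assms(1)] openin_subset[OF assms(1)] by simp
  show ?thesis
    using germ_restr[OF openin_topspace assms(1) openin_subset[OF assms(1)] assms(2) R.zero_closed]
    by (simp add: stalk_zero)
qed

text \<open>An inverse germ is represented near \<open>x\<close>, and the product becomes
  \<open>\<one>\<close> after shrinking once more. This links nonvanishing loci with the maximal
  ideals of stalks.\<close>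

lemma germ_Units_iff:
  assumes U: "openin (rtop X) U" "x \<in> U" "s \<in> carrier (sections X U)"
  shows "germ X x U s \<in> Units (stalk X x) \<longleftrightarrow> x \<in> basic_open X U s"
proof
  assume "germ X x U s \<in> Units (stalk X x)"
  then obtain q where q: "q \<in> carrier (stalk X x)" "germ X x U s \<otimes>\<^bsub>stalk X x\<^esub> q = \<one>\<^bsub>stalk X x\<^esub>"
    by (auto simp: Units_def)
  obtain V t where V: "openin (rtop X) V" "x \<in> V" "t \<in> carrier (sections X V)" "q = germ X x V t"
    using stalk_carrierE[OF q(1)] by metis
  have o: "openin (rtop X) (U \<inter> V)" "x \<in> U \<inter> V" using U V by auto
  interpret UV: cring "sections X (U \<inter> V)" using cring_sections[OF o(1)] .
  have "germ X x (U \<inter> V) (restr X U (U \<inter> V) s \<otimes>\<^bsub>sections X (U \<inter> V)\<^esub> restr X V (U \<inter> V) t)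
    = germ X x (U \<inter> V) \<one>\<^bsub>sections X (U \<inter> V)\<^esub>"
    using stalk_mult[OF U V(1-3)] germ_one[OF o] q(2) V(4) by simp
  then obtain W where W: "openin (rtop X) W" "x \<in> W" "W \<subseteq> U \<inter> V"
    "restr X (U \<inter> V) W (restr X U (U \<inter> V) s \<otimes>\<^bsub>sections X (U \<inter> V)\<^esub> restr X V (U \<inter> V) t)
     = restr X (U \<inter> V) W \<one>\<^bsub>sections X (U \<inter> V)\<^esub>"
    using germ_eqD[OF o UV.one_closed] by metis
  interpret h: ring_hom_cring "sections X (U \<inter> V)" "sections X W" "restr X (U \<inter> V) W"
    using restr_rhc[OF o(1) W(1,3)] .
  have c: "restr X U (U \<inter> V) s \<in> carrier (sections X (U \<inter> V))" "restr X V (U \<inter> V) t \<in> carrier (sections X (U \<inter> V))"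
    using restr_closed[OF U(1) o(1) _ U(3)] restr_closed[OF V(1) o(1) _ V(3)] by auto
  have "restr X (U \<inter> V) W (restr X U (U \<inter> V) s) \<in> Units (sections X W)"
    using W(4) c by (intro h.S.Units_of_mult_one[of _ "restr X (U \<inter> V) W (restr X V (U \<inter> V) t)"]) auto
  then show "x \<in> basic_open X U s"
    using restr_comp[OF U(1) o(1) W(1,3) _ U(3)] W by (intro mem_basic_openI[OF U(1) W(1,2)]) auto
next
  assume "x \<in> basic_open X U s"
  then obtain W where W: "openin (rtop X) W" "x \<in> W" "W \<subseteq> U" "restr X U W s \<in> Units (sections X W)"
    by (auto simp: basic_open_def)
  interpret W: cring "sections X W" using cring_sections[OF W(1)] .
  let ?t = "inv\<^bsub>sections X W\<^esub> (restr X U W s)"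
  have c: "restr X U W s \<in> carrier (sections X W)" "?t \<in> carrier (sections X W)" using W(4) by auto
  have g: "germ X x U s = germ X x W (restr X U W s)" using germ_restr[OF U(1) W(1,3,2) U(3)] by simp
  have "germ X x U s \<otimes>\<^bsub>stalk X x\<^esub> germ X x W ?t = \<one>\<^bsub>stalk X x\<^esub>"
    "germ X x W ?t \<otimes>\<^bsub>stalk X x\<^esub> germ X x U s = \<one>\<^bsub>stalk X x\<^esub>"
    unfolding g
    using stalk_mult[OF W(1,2) c(1) W(1,2) c(2)] stalk_mult[OF W(1,2) c(2) W(1,2) c(1)]
      restr_id[OF W(1)] c W(4) germ_one[OF W(1,2)] by simp_all
  then show "germ X x U s \<in> Units (stalk X x)"
    using stalk_carrierI[OF U] stalk_carrierI[OF W(1,2) c(2)] by (auto simp: Units_def)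
qed

end

lemma UN_pair_const:
  assumes "p \<noteq> {}" "\<And>a s. (a, s) \<in> p \<Longrightarrow> F a s = c"
  shows "(\<Union>(a, s)\<in>p. F a s) = c"
  using assms by force

text \<open>Only the compatibility with restriction of a morphism of locally ringed spaces is required,
  so that the maps on stalks can be computed before they are known to be local.\<close>

lemma stalk_map_germ:
  assumes X: "ringed_space X" and Y: "ringed_space Y"
    and cont: "\<And>V. openin (rtop Y) V \<Longrightarrow> openin (rtop X) (preim X f V)"
    and hom: "\<And>V. openin (rtop Y) V \<Longrightarrow> sec_map f V \<in> ring_hom (sections Y V) (sections X (preim X f V))"
    and nat: "\<And>V W t. \<lbrakk>openin (rtop Y) V; openin (rtop Y) W; W \<subseteq> V; t \<in> carrier (sections Y V)\<rbrakk>
      \<Longrightarrow> sec_map f W (restr Y V W t) = restr X (preim X f V) (preim X f W) (sec_map f V t)"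
    and x: "x \<in> points X"
    and V: "openin (rtop Y) V" "pt_map f x \<in> V" "t \<in> carrier (sections Y V)"
  shows "stalk_map X f x (germ Y (pt_map f x) V t) = germ X x (preim X f V) (sec_map f V t)"
  unfolding stalk_map_def
proof (rule UN_pair_const)
  interpret X: ringed_space X by fact
  interpret Y: ringed_space Y by fact
  show "germ Y (pt_map f x) V t \<noteq> {}" using Y.germ_self[OF V] by auto
  fix V' t' assume V't': "(V', t') \<in> germ Y (pt_map f x) V t"
  note V' = Y.germ_memD[OF V(1,3) V't']
  obtain W where W: "openin (rtop Y) W" "pt_map f x \<in> W" "W \<subseteq> V'" "W \<subseteq> V" "restr Y V' W t' = restr Y V W t"
    using Y.germ_eqD[OF V V'(4)] by metis
  have sub: "preim X f W \<subseteq> preim X f V'" "preim X f W \<subseteq> preim X f V" using W by (auto simp: preim_def)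
  show "germ X x (preim X f V') (sec_map f V' t') = germ X x (preim X f V) (sec_map f V t)"
  proof (rule X.germ_eqI[OF cont[OF V'(1)] _ cont[OF V(1)] _ cont[OF W(1)] _ sub])
    show "x \<in> preim X f W" using x W by (simp add: preim_def)
    show "restr X (preim X f V') (preim X f W) (sec_map f V' t') = restr X (preim X f V) (preim X f W) (sec_map f V t)"
      using nat[OF V'(1) W(1,3) V'(3)] nat[OF V(1) W(1,4) V(3)] W(5) by simp
  qed (use ring_hom_closed[OF hom] V V' in auto)
qed


section \<open>Morphisms\<close>

locale local_morphism = X: locally_ringed_space X + Y: locally_ringed_space Y + lrs_morphism X Y f
  for X :: "('a, 'r) ringed_space" and Y :: "('b, 's) ringed_space" and f :: "('a, 'r, 'b, 's) rs_map"
begin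

lemma open_preim: "openin (rtop Y) V \<Longrightarrow> openin (rtop X) (preim X f V)"
  using openin_preim[OF lrs_morphism_axioms] .

lemma mem_preim: "openin (rtop X) W \<Longrightarrow> x \<in> W \<Longrightarrow> x \<in> preim X f V \<longleftrightarrow> pt_map f x \<in> V"
  using openin_subset by (auto simp: preim_def)

lemma induced_rhc:
  assumes "openin (rtop Y) V" "openin (rtop X) W" "W \<subseteq> preim X f V"
  shows "ring_hom_cring (sections Y V) (sections X W) (induced_hom X f V W)"
  using ring_hom_trans[OF sec_map_hom[OF assms(1)] X.restr_hom[OF open_preim[OF assms(1)] assms(2,3)]]
    X.cring_sections[OF assms(2)] Y.cring_sections[OF assms(1)]
  by (simp add: ring_hom_cring_def ring_hom_cring_axioms_def induced_hom_def)

lemma induced_restr_left: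
  assumes "openin (rtop Y) V" "openin (rtop Y) V'" "V' \<subseteq> V" "openin (rtop X) W" "W \<subseteq> preim X f V'"
    and "t \<in> carrier (sections Y V)"
  shows "induced_hom X f V' W (restr Y V V' t) = induced_hom X f V W t"
proof -
  have sub: "preim X f V' \<subseteq> preim X f V" using assms(3) by (auto simp: preim_def)
  show ?thesis
    using sec_map_restr[OF assms(1-3,6)] ring_hom_closed[OF sec_map_hom[OF assms(1)] assms(6)]
      X.restr_comp[OF open_preim[OF assms(1)] open_preim[OF assms(2)] assms(4,5) sub]
    by (simp add: induced_hom_def)
qed

lemma induced_restr_right:
  assumes "openin (rtop Y) V" "openin (rtop X) W" "openin (rtop X) W'" "W' \<subseteq> W" "W \<subseteq> preim X f V"
    and "t \<in> carrier (sections Y V)"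
  shows "restr X W W' (induced_hom X f V W t) = induced_hom X f V W' t"
  using X.restr_comp[OF open_preim[OF assms(1)] assms(2,3,4,5)] ring_hom_closed[OF sec_map_hom[OF assms(1)] assms(6)]
  by (simp add: induced_hom_def)

text \<open>Units pull back to units, which gives one inclusion. The other is where the locality of
  stalk maps enters: a nonunit germ at \<open>pt_map f x\<close> lies in the maximal ideal and pulls
  back into the maximal ideal at \<open>x\<close>.\<close>

lemma basic_open_sec_map:
  assumes V: "openin (rtop Y) V" and s: "s \<in> carrier (sections Y V)"
  shows "basic_open X (preim X f V) (sec_map f V s) = preim X f (basic_open Y V s)"
proof (intro equalityI subsetI)
  fix x assume x: "x \<in> preim X f (basic_open Y V s)"
  let ?W = "basic_open Y V s"
  have W: "openin (rtop Y) ?W" using openin_basic_open .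
  have sub: "preim X f ?W \<subseteq> preim X f V" using basic_open_subset[of Y V s] by (auto simp: preim_def)
  have "restr Y V ?W s \<in> Units (sections Y ?W)" using Y.unit_on_basic_open[OF V W subset_refl s] .
  then have "sec_map f ?W (restr Y V ?W s) \<in> Units (sections X (preim X f ?W))"
    by (rule ring_hom_Units[OF sec_map_hom[OF W] Y.cring_sections[OF W] X.cring_sections[OF open_preim[OF W]]])
  then show "x \<in> basic_open X (preim X f V) (sec_map f V s)"
    using sec_map_restr[OF V W basic_open_subset s]
    by (intro X.mem_basic_openI[OF open_preim[OF V] open_preim[OF W] x sub]) simp
next
  fix x assume x: "x \<in> basic_open X (preim X f V) (sec_map f V s)"
  then have xV: "x \<in> preim X f V" using basic_open_subset by (rule rev_subsetD)
  then have xp: "x \<in> points X" and yV: "pt_map f x \<in> V" by (auto simp: preim_def)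
  have yp: "pt_map f x \<in> points Y" using openin_subset[OF V] yV by blast
  note \<phi>s = ring_hom_closed[OF sec_map_hom[OF V] s]
  let ?y = "pt_map f x"
  interpret SY: cring "stalk Y ?y" using Y.local_stalk[OF yp] by (simp add: local_ring_def)
  interpret SX: cring "stalk X x" using X.local_stalk[OF xp] by (simp add: local_ring_def)
  show "x \<in> preim X f (basic_open Y V s)"
  proof (rule ccontr)
    assume "\<not> ?thesis"
    then have "germ Y ?y V s \<notin> Units (stalk Y ?y)"
      using Y.germ_Units_iff[OF V yV s] xp by (simp add: preim_def)
    then obtain m' where m': "maximalideal m' (stalk Y ?y)" "germ Y ?y V s \<in> m'"
      using SY.nonunit_in_maximalideal[OF Y.stalk_carrierI[OF V yV s]] by metis
    obtain m where m: "maximalideal m (stalk X x)" using X.local_stalk[OF xp] by (auto simp: local_ring_def)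
    have "maximalideal {a \<in> carrier (stalk Y ?y). stalk_map X f x a \<in> m} (stalk Y ?y)"
      using local_stalk_map[OF xp] m by (simp add: local_hom_def)
    \<comment> \<open>The stalk at \<open>?y\<close> has only one maximal ideal, so the one
      containing the nonunit germ is the preimage of \<open>m\<close>.\<close>
    then have "m' = {a \<in> carrier (stalk Y ?y). stalk_map X f x a \<in> m}"
      using Y.local_stalk[OF yp] m'(1) by (auto simp: local_ring_def)
    then have "stalk_map X f x (germ Y ?y V s) \<in> m" using m'(2) by simp
    then have gm: "germ X x (preim X f V) (sec_map f V s) \<in> m"
      using stalk_map_germ[OF X.ringed_space_axioms Y.ringed_space_axioms open_preim sec_map_hom sec_map_restr xp V yV s]
      by simp
    have "germ X x (preim X f V) (sec_map f V s) \<in> Units (stalk X x)"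
      using X.germ_Units_iff[OF open_preim[OF V] xV \<phi>s] x by simp
    then obtain q where q: "q \<in> carrier (stalk X x)"
      "q \<otimes>\<^bsub>stalk X x\<^esub> germ X x (preim X f V) (sec_map f V s) = \<one>\<^bsub>stalk X x\<^esub>" by (auto simp: Units_def)
    interpret m: maximalideal m "stalk X x" using m .
    have "\<one>\<^bsub>stalk X x\<^esub> \<in> m" using m.I_l_closed[OF gm q(1)] q(2) by simp
    then show False using m.one_imp_carrier m.I_notcarr by simp
  qed
qed

lemma basic_open_induced:
  assumes "openin (rtop Y) V" "openin (rtop X) W" "W \<subseteq> preim X f V" "s \<in> carrier (sections Y V)"
  shows "basic_open X W (induced_hom X f V W s) = preim X f (basic_open Y V s) \<inter> W"
  using X.basic_open_restr[OF open_preim[OF assms(1)] assms(2,3) ring_hom_closed[OF sec_map_hom[OF assms(1)] assms(4)]]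
    basic_open_sec_map[OF assms(1,4)] by (simp add: induced_hom_def)

end

text \<open>The elements of \<open>B\<close> that come from \<open>A\<close> inside \<open>R\<close>
  after multiplication by a power of \<open>g\<close> form a subring, with exponents added, so it is
  enough to test generators. Membership in \<open>carrier B\<close> is carried along because the
  induction needs it to apply \<open>k\<close>.\<close>

lemma (in cring) generate_ring_fractions:
  assumes \<psi>: "ring_hom_cring A R \<psi>" and k: "ring_hom_cring B R k" and g: "g \<in> carrier A"
    and H: "\<And>b. b \<in> H \<Longrightarrow> b \<in> carrier B \<and> (\<exists>a\<in>carrier A. \<exists>n::nat. \<psi> (g [^]\<^bsub>A\<^esub> n) \<otimes> k b = \<psi> a)"
    and b: "b \<in> generate_ring B H"
  shows "b \<in> carrier B \<and> (\<exists>a\<in>carrier A. \<exists>n::nat. \<psi> (g [^]\<^bsub>A\<^esub> n) \<otimes> k b = \<psi> a)"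
  using b
proof induction
  interpret \<psi>: ring_hom_cring A R \<psi> by fact
  interpret k: ring_hom_cring B R k by fact
  {
    case one
    then show ?case by (auto intro!: bexI[of _ "\<one>\<^bsub>A\<^esub>"] exI[of _ 0])
  next
    case (incl b)
    then show ?case using H by blast
  next
    case (a_inv b)
    then obtain a and n :: nat where *: "b \<in> carrier B" "a \<in> carrier A" "\<psi> (g [^]\<^bsub>A\<^esub> n) \<otimes> k b = \<psi> a" by blast
    then have "\<psi> (g [^]\<^bsub>A\<^esub> n) \<otimes> k (\<ominus>\<^bsub>B\<^esub> b) = \<psi> (\<ominus>\<^bsub>A\<^esub> a)" using g by (simp add: r_minus)
    then show ?case using * by blast
  next
    case (eng_add b c)
    then obtain a d and m n :: nat where *: "b \<in> carrier B" "c \<in> carrier B" "a \<in> carrier A" "d \<in> carrier A"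
      "\<psi> (g [^]\<^bsub>A\<^esub> m) \<otimes> k b = \<psi> a" "\<psi> (g [^]\<^bsub>A\<^esub> n) \<otimes> k c = \<psi> d" by blast
    have c: "\<psi> (g [^]\<^bsub>A\<^esub> m) \<in> carrier R" "\<psi> (g [^]\<^bsub>A\<^esub> n) \<in> carrier R" "k b \<in> carrier R" "k c \<in> carrier R"
      using g * by auto
    have "\<psi> (g [^]\<^bsub>A\<^esub> (m + n)) \<otimes> k (b \<oplus>\<^bsub>B\<^esub> c) = (\<psi> (g [^]\<^bsub>A\<^esub> m) \<otimes> \<psi> (g [^]\<^bsub>A\<^esub> n)) \<otimes> (k b \<oplus> k c)"
      using g * by (simp flip: \<psi>.R.nat_pow_mult)
    also have "\<dots> = \<psi> (g [^]\<^bsub>A\<^esub> n) \<otimes> (\<psi> (g [^]\<^bsub>A\<^esub> m) \<otimes> k b) \<oplus> \<psi> (g [^]\<^bsub>A\<^esub> m) \<otimes> (\<psi> (g [^]\<^bsub>A\<^esub> n) \<otimes> k c)"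
      using c by algebra
    also have "\<dots> = \<psi> (g [^]\<^bsub>A\<^esub> n \<otimes>\<^bsub>A\<^esub> a \<oplus>\<^bsub>A\<^esub> g [^]\<^bsub>A\<^esub> m \<otimes>\<^bsub>A\<^esub> d)" using * g by simp
    finally have "\<psi> (g [^]\<^bsub>A\<^esub> (m + n)) \<otimes> k (b \<oplus>\<^bsub>B\<^esub> c) = \<dots>" .
    moreover have "g [^]\<^bsub>A\<^esub> n \<otimes>\<^bsub>A\<^esub> a \<oplus>\<^bsub>A\<^esub> g [^]\<^bsub>A\<^esub> m \<otimes>\<^bsub>A\<^esub> d \<in> carrier A" using * g by simp
    ultimately show ?case using *(1,2) by blast
  next
    case (eng_mult b c)
    then obtain a d and m n :: nat where *: "b \<in> carrier B" "c \<in> carrier B" "a \<in> carrier A" "d \<in> carrier A"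
      "\<psi> (g [^]\<^bsub>A\<^esub> m) \<otimes> k b = \<psi> a" "\<psi> (g [^]\<^bsub>A\<^esub> n) \<otimes> k c = \<psi> d" by blast
    have c: "\<psi> (g [^]\<^bsub>A\<^esub> m) \<in> carrier R" "\<psi> (g [^]\<^bsub>A\<^esub> n) \<in> carrier R" "k b \<in> carrier R" "k c \<in> carrier R"
      using g * by auto
    have "\<psi> (g [^]\<^bsub>A\<^esub> (m + n)) \<otimes> k (b \<otimes>\<^bsub>B\<^esub> c) = (\<psi> (g [^]\<^bsub>A\<^esub> m) \<otimes> \<psi> (g [^]\<^bsub>A\<^esub> n)) \<otimes> (k b \<otimes> k c)"
      using g * by (simp flip: \<psi>.R.nat_pow_mult)
    also have "\<dots> = (\<psi> (g [^]\<^bsub>A\<^esub> m) \<otimes> k b) \<otimes> (\<psi> (g [^]\<^bsub>A\<^esub> n) \<otimes> k c)"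
      using c by algebra
    also have "\<dots> = \<psi> (a \<otimes>\<^bsub>A\<^esub> d)" using * by simp
    finally have "\<psi> (g [^]\<^bsub>A\<^esub> (m + n)) \<otimes> k (b \<otimes>\<^bsub>B\<^esub> c) = \<dots>" .
    moreover have "a \<otimes>\<^bsub>A\<^esub> d \<in> carrier A" using * by simp
    ultimately show ?case using *(1,2) by blast
  }
qed

context local_morphism
begin

lemma mem_basic_open_induced:
  assumes "openin (rtop Y) V" "openin (rtop X) W" "W \<subseteq> preim X f V" "s \<in> carrier (sections Y V)" "x \<in> W"
  shows "pt_map f x \<in> basic_open Y V s \<longleftrightarrow> x \<in> basic_open X W (induced_hom X f V W s)"
  using basic_open_induced[OF assms(1-4)] mem_preim[OF assms(2,5)] assms(5) by simp

end

section \<open>Germs along a localizing map\<close>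

context localizing_map
begin

sublocale local_morphism X Y f
  by (intro local_morphism.intro X.locally_ringed_space_axioms Y.locally_ringed_space_axioms lrs_morphism_axioms)

lemma localizing_chart:
  assumes "x \<in> points X"
  obtains V U S where "affine_open Y V" "affine_open X U" "x \<in> U" "U \<subseteq> preim X f V"
    "S \<subseteq> carrier (sections Y V)"
    "\<And>s. s \<in> S \<Longrightarrow> induced_hom X f V U s \<in> Units (sections X U)"
    "\<And>b. b \<in> carrier (sections X U) \<Longrightarrow> \<exists>a\<in>carrier (sections Y V). \<exists>s\<in>S.
      induced_hom X f V U s \<otimes>\<^bsub>sections X U\<^esub> b = induced_hom X f V U a"
    "\<And>a. \<lbrakk>a \<in> carrier (sections Y V); induced_hom X f V U a = \<zero>\<^bsub>sections X U\<^esub>\<rbrakk>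
      \<Longrightarrow> \<exists>u\<in>S. u \<otimes>\<^bsub>sections Y V\<^esub> a = \<zero>\<^bsub>sections Y V\<^esub>"
proof -
  have y: "pt_map f x \<in> points Y" using continuous assms by (auto simp: continuous_map_def)
  obtain V \<U> where V: "affine_open Y V" "pt_map f x \<in> V" and \<U>: "\<Union>\<U> = preim X f V"
    and loc: "\<And>U. U \<in> \<U> \<Longrightarrow> affine_open X U \<and> localizing_hom (sections Y V) (sections X U) (induced_hom X f V U)"
    using localizing[OF y] by metis
  have "x \<in> \<Union>\<U>" using \<U> V assms by (simp add: preim_def)
  then obtain U where U: "U \<in> \<U>" "x \<in> U" by blast
  have sub: "U \<subseteq> preim X f V" using U \<U> by blast
  have o: "openin (rtop Y) V" "openin (rtop X) U" using V loc[OF U(1)] by (auto simp: affine_open_def)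
  obtain S where S: "S \<subseteq> carrier (sections Y V)" "\<And>s. s \<in> S \<Longrightarrow> induced_hom X f V U s \<in> Units (sections X U)"
    "\<And>b. b \<in> carrier (sections X U) \<Longrightarrow> \<exists>a\<in>carrier (sections Y V). \<exists>s\<in>S.
      induced_hom X f V U s \<otimes>\<^bsub>sections X U\<^esub> b = induced_hom X f V U a"
    "\<And>a. \<lbrakk>a \<in> carrier (sections Y V); induced_hom X f V U a = \<zero>\<^bsub>sections X U\<^esub>\<rbrakk>
      \<Longrightarrow> \<exists>u\<in>S. u \<otimes>\<^bsub>sections Y V\<^esub> a = \<zero>\<^bsub>sections Y V\<^esub>"
    by (rule localizing_homE[OF Y.cring_sections[OF o(1)] X.cring_sections[OF o(2)] conjunct2[OF loc[OF U(1)]]]) blast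
  show ?thesis by (rule that[OF V(1) conjunct1[OF loc[OF U(1)]] U(2) sub S])
qed

text \<open>In a localizing chart the vanishing near \<open>x\<close> becomes an annihilation by
  elements of the base ring, since every section over \<open>U\<close> is a fraction with
  denominator in \<open>S\<close>. All these annihilators are invertible at
  \<open>pt_map f x\<close>.\<close>

lemma vanishing_descends:
  assumes N: "openin (rtop Y) N" and s: "s \<in> carrier (sections Y N)"
    and W: "openin (rtop X) W" "x \<in> W" "W \<subseteq> preim X f N"
    and z: "induced_hom X f N W s = \<zero>\<^bsub>sections X W\<^esub>"
  shows "\<exists>M. openin (rtop Y) M \<and> pt_map f x \<in> M \<and> M \<subseteq> N \<and> restr Y N M s = \<zero>\<^bsub>sections Y M\<^esub>"
proof -
  have xp: "x \<in> points X" using openin_subset[OF W(1)] W(2) by blast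
  obtain V U S where V: "affine_open Y V" and U: "affine_open X U" and xU: "x \<in> U" and UV: "U \<subseteq> preim X f V"
    and S: "S \<subseteq> carrier (sections Y V)"
    and unit: "\<And>s. s \<in> S \<Longrightarrow> induced_hom X f V U s \<in> Units (sections X U)"
    and frac: "\<And>b. b \<in> carrier (sections X U) \<Longrightarrow> \<exists>a\<in>carrier (sections Y V). \<exists>s\<in>S.
      induced_hom X f V U s \<otimes>\<^bsub>sections X U\<^esub> b = induced_hom X f V U a"
    and ker: "\<And>a. \<lbrakk>a \<in> carrier (sections Y V); induced_hom X f V U a = \<zero>\<^bsub>sections X U\<^esub>\<rbrakk>
      \<Longrightarrow> \<exists>u\<in>S. u \<otimes>\<^bsub>sections Y V\<^esub> a = \<zero>\<^bsub>sections Y V\<^esub>"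
    using localizing_chart[OF xp] by metis
  have oV: "openin (rtop Y) V" and oU: "openin (rtop X) U" using V U by (auto simp: affine_open_def)
  interpret \<phi>: ring_hom_cring "sections Y V" "sections X U" "induced_hom X f V U"
    using induced_rhc[OF oV oU UV] .
  let ?y = "pt_map f x"
  have y: "?y \<in> V" "?y \<in> N" using UV xU W by (auto simp: preim_def)
  \<comment> \<open>The section \<open>s\<close> lives on an arbitrary \<open>N\<close>; shrinking
    to a basic open set of \<open>V\<close> inside \<open>N\<close> makes it a fraction
    \<open>a / g^n\<close> over the ring of the chart.\<close>
  obtain g where g: "g \<in> carrier (sections Y V)" "?y \<in> basic_open Y V g" "basic_open Y V g \<subseteq> V \<inter> N"
    using Y.affine_basis[OF V openin_Int[OF oV N], of ?y] y by blast
  define G where "G = basic_open Y V g"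
  have G: "openin (rtop Y) G" "?y \<in> G" "G \<subseteq> V" "G \<subseteq> N" using g openin_basic_open unfolding G_def by auto
  obtain a and n :: nat where a: "a \<in> carrier (sections Y V)" and
    an: "restr Y V G a = restr Y V G (g [^]\<^bsub>sections Y V\<^esub> n) \<otimes>\<^bsub>sections Y G\<^esub> restr Y N G s"
    using Y.affine_fraction[OF V g(1), of "restr Y N G s"] Y.restr_closed[OF N G(1,4) s] unfolding G_def by metis
  have oW1: "openin (rtop X) (W \<inter> (U \<inter> preim X f G))" using W(1) oU open_preim[OF G(1)] by auto
  have "x \<in> W \<inter> (U \<inter> preim X f G)" using W xU xp G by (auto simp: preim_def)
  then obtain t where t: "t \<in> carrier (sections X U)" "x \<in> basic_open X U t"
    "basic_open X U t \<subseteq> W \<inter> (U \<inter> preim X f G)" using X.affine_basis[OF U oW1] by auto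
  define T where "T = basic_open X U t"
  have T: "openin (rtop X) T" "x \<in> T" "T \<subseteq> W" "T \<subseteq> U" "T \<subseteq> preim X f G" "T \<subseteq> preim X f N" "T \<subseteq> preim X f V"
    using t openin_basic_open UV W(3) unfolding T_def by auto
  have "restr X U T (induced_hom X f V U a) = \<zero>\<^bsub>sections X T\<^esub>"
  proof -
    interpret h: ring_hom_cring "sections Y G" "sections X T" "induced_hom X f G T"
      using induced_rhc[OF G(1) T(1,5)] .
    interpret r: ring_hom_cring "sections X W" "sections X T" "restr X W T" using X.restr_rhc[OF W(1) T(1,3)] .
    have gn: "restr Y V G (g [^]\<^bsub>sections Y V\<^esub> n) \<in> carrier (sections Y G)"
      using Y.restr_closed[OF oV G(1,3)] g(1) by simp
    have sG: "restr Y N G s \<in> carrier (sections Y G)" using Y.restr_closed[OF N G(1,4) s] .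
    have "restr X U T (induced_hom X f V U a) = induced_hom X f G T (restr Y V G a)"
      using induced_restr_right[OF oV oU T(1,4) UV a] induced_restr_left[OF oV G(1,3) T(1,5) a] by simp
    also have "\<dots> = induced_hom X f G T (restr Y V G (g [^]\<^bsub>sections Y V\<^esub> n)) \<otimes>\<^bsub>sections X T\<^esub> induced_hom X f N T s"
      unfolding an using h.hom_mult[OF gn sG] induced_restr_left[OF N G(1,4) T(1,5) s] by simp
    also have "induced_hom X f N T s = \<zero>\<^bsub>sections X T\<^esub>"
      using induced_restr_right[OF N W(1) T(1,3) W(3) s] z by simp
    finally show ?thesis using gn by simp
  qed
  then obtain m :: nat where m: "t [^]\<^bsub>sections X U\<^esub> m \<otimes>\<^bsub>sections X U\<^esub> induced_hom X f V U a = \<zero>\<^bsub>sections X U\<^esub>"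
    using X.affine_vanish[OF U t(1) \<phi>.hom_closed[OF a]] unfolding T_def by metis
  obtain c s' where c: "c \<in> carrier (sections Y V)" "s' \<in> S"
    "induced_hom X f V U s' \<otimes>\<^bsub>sections X U\<^esub> t = induced_hom X f V U c" using frac[OF t(1)] by blast
  have s'c: "s' \<in> carrier (sections Y V)" using S c by blast
  let ?cm = "c [^]\<^bsub>sections Y V\<^esub> m"
  \<comment> \<open>Since \<open>t = c / s'\<close> in the chart, \<open>c^m\<close> pulls back to a
    multiple of \<open>t^m\<close>, which already kills the pullback of \<open>a\<close>.\<close>
  have "induced_hom X f V U (?cm \<otimes>\<^bsub>sections Y V\<^esub> a)
      = induced_hom X f V U s' [^]\<^bsub>sections X U\<^esub> m \<otimes>\<^bsub>sections X U\<^esub>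
        (t [^]\<^bsub>sections X U\<^esub> m \<otimes>\<^bsub>sections X U\<^esub> induced_hom X f V U a)"
    using c a t s'c by (simp add: \<phi>.ring.hom_nat_pow c(3)[symmetric] \<phi>.S.nat_pow_distrib \<phi>.S.m_assoc)
  also have "\<dots> = \<zero>\<^bsub>sections X U\<^esub>" unfolding m using s'c by simp
  finally obtain u where u: "u \<in> S" "u \<otimes>\<^bsub>sections Y V\<^esub> (?cm \<otimes>\<^bsub>sections Y V\<^esub> a) = \<zero>\<^bsub>sections Y V\<^esub>"
    using ker[of "?cm \<otimes>\<^bsub>sections Y V\<^esub> a"] a c by auto
  have uc: "u \<in> carrier (sections Y V)" using S u by blast
  \<comment> \<open>On \<open>M\<close> all of \<open>u\<close>, \<open>c\<close> and
    \<open>g\<close> are units, so \<open>u c^m a = 0\<close> gives \<open>a = 0\<close>, and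
    \<open>a = g^n s\<close> then gives \<open>s = 0\<close>.\<close>
  define M where "M = basic_open Y V u \<inter> basic_open Y V c \<inter> G"
  have M: "openin (rtop Y) M" "M \<subseteq> V" "M \<subseteq> G" "M \<subseteq> N" "M \<subseteq> basic_open Y V u" "M \<subseteq> basic_open Y V c"
    "M \<subseteq> basic_open Y V g"
    unfolding M_def using G openin_basic_open[of Y V u] openin_basic_open[of Y V c] by (auto simp: G_def)
  have "?y \<in> basic_open Y V u"
    using mem_basic_open_induced[OF oV oU UV uc xU] X.basic_open_unit[OF oU unit[OF u(1)]] xU by simp
  \<comment> \<open>The pullback of \<open>c\<close> is \<open>s' t\<close>, where \<open>s'\<close>
    becomes a unit on \<open>U\<close> and \<open>t\<close> does not vanish at
    \<open>x\<close>.\<close>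
  moreover have "?y \<in> basic_open Y V c"
    using mem_basic_open_induced[OF oV oU UV c(1) xU] X.basic_open_unit[OF oU unit[OF c(2)]] xU t
      X.basic_open_mult[OF oU \<phi>.hom_closed[OF s'c] t(1)] by (simp flip: c(3))
  ultimately have yM: "?y \<in> M" using G by (simp add: M_def)
  interpret r: ring_hom_cring "sections Y V" "sections Y M" "restr Y V M" using Y.restr_rhc[OF oV M(1,2)] .
  have units: "restr Y V M u \<in> Units (sections Y M)" "restr Y V M c \<in> Units (sections Y M)"
    "restr Y V M g \<in> Units (sections Y M)"
    using Y.unit_on_basic_open[OF oV M(1,5) uc] Y.unit_on_basic_open[OF oV M(1,6) c(1)]
      Y.unit_on_basic_open[OF oV M(1,7) g(1)] by auto
  have "restr Y V M u \<otimes>\<^bsub>sections Y M\<^esub> (restr Y V M c [^]\<^bsub>sections Y M\<^esub> m \<otimes>\<^bsub>sections Y M\<^esub> restr Y V M a)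
    = restr Y V M (u \<otimes>\<^bsub>sections Y V\<^esub> (?cm \<otimes>\<^bsub>sections Y V\<^esub> a))"
    using uc a c by (simp add: r.ring.hom_nat_pow)
  also have "\<dots> = \<zero>\<^bsub>sections Y M\<^esub>" unfolding u(2) by simp
  finally have "restr Y V M c [^]\<^bsub>sections Y M\<^esub> m \<otimes>\<^bsub>sections Y M\<^esub> restr Y V M a = \<zero>\<^bsub>sections Y M\<^esub>"
    using r.S.unit_mult_zero[OF units(1)] a c by simp
  then have aM: "restr Y V M a = \<zero>\<^bsub>sections Y M\<^esub>"
    using r.S.unit_mult_zero[OF r.S.Units_pow_closed[OF units(2)]] a by simp
  interpret q: ring_hom_cring "sections Y G" "sections Y M" "restr Y G M" using Y.restr_rhc[OF G(1) M(1,3)] .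
  have gn: "g [^]\<^bsub>sections Y V\<^esub> n \<in> carrier (sections Y V)" using g by simp
  have "\<zero>\<^bsub>sections Y M\<^esub> = restr Y G M (restr Y V G a)"
    using Y.restr_comp[OF oV G(1) M(1,3) G(3) a] aM by simp
  also have "\<dots> = restr Y V M g [^]\<^bsub>sections Y M\<^esub> n \<otimes>\<^bsub>sections Y M\<^esub> restr Y N M s"
    unfolding an using q.hom_mult[OF Y.restr_closed[OF oV G(1,3) gn] Y.restr_closed[OF N G(1,4) s]]
      Y.restr_comp[OF oV G(1) M(1,3) G(3) gn] Y.restr_comp[OF N G(1) M(1,3) G(4) s] g
    by (simp add: r.ring.hom_nat_pow)
  finally have "restr Y N M s = \<zero>\<^bsub>sections Y M\<^esub>"
    using r.S.unit_mult_zero[OF r.S.Units_pow_closed[OF units(3)] Y.restr_closed[OF N M(1,4) s]] by simp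
  then show ?thesis using M yM by blast
qed

text \<open>Near \<open>x\<close> the section is a fraction of sections over \<open>U\<close>, and
  its numerator and denominator are in turn fractions with denominators in \<open>S\<close>. The
  combined denominator does not vanish at \<open>pt_map f x\<close>, so the fraction makes sense on
  a neighbourhood in \<open>Y\<close>.\<close>

lemma section_descends:
  assumes W: "openin (rtop X) W" "x \<in> W" and \<sigma>: "\<sigma> \<in> carrier (sections X W)"
  obtains N \<tau> W' where "openin (rtop Y) N" "pt_map f x \<in> N" "\<tau> \<in> carrier (sections Y N)"
    "openin (rtop X) W'" "x \<in> W'" "W' \<subseteq> W" "W' \<subseteq> preim X f N" "induced_hom X f N W' \<tau> = restr X W W' \<sigma>"
proof -
  have xp: "x \<in> points X" using openin_subset[OF W(1)] W(2) by blast
  obtain V U S where V: "affine_open Y V" and U: "affine_open X U" and xU: "x \<in> U" and UV: "U \<subseteq> preim X f V"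
    and S: "S \<subseteq> carrier (sections Y V)"
    and unit: "\<And>s. s \<in> S \<Longrightarrow> induced_hom X f V U s \<in> Units (sections X U)"
    and frac: "\<And>b. b \<in> carrier (sections X U) \<Longrightarrow> \<exists>a\<in>carrier (sections Y V). \<exists>s\<in>S.
      induced_hom X f V U s \<otimes>\<^bsub>sections X U\<^esub> b = induced_hom X f V U a"
    using localizing_chart[OF xp] by metis
  have oV: "openin (rtop Y) V" and oU: "openin (rtop X) U" using V U by (auto simp: affine_open_def)
  interpret \<phi>: ring_hom_cring "sections Y V" "sections X U" "induced_hom X f V U"
    using induced_rhc[OF oV oU UV] .
  let ?y = "pt_map f x"
  obtain t where t: "t \<in> carrier (sections X U)" "x \<in> basic_open X U t" "basic_open X U t \<subseteq> W \<inter> U"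
    using X.affine_basis[OF U openin_Int[OF W(1) oU], of x] W xU by blast
  define T where "T = basic_open X U t"
  have T: "openin (rtop X) T" "x \<in> T" "T \<subseteq> W" "T \<subseteq> U" using t openin_basic_open unfolding T_def by auto
  obtain b and n :: nat where b: "b \<in> carrier (sections X U)" and
    bn: "restr X U T b = restr X U T (t [^]\<^bsub>sections X U\<^esub> n) \<otimes>\<^bsub>sections X T\<^esub> restr X W T \<sigma>"
    using X.affine_fraction[OF U t(1), of "restr X W T \<sigma>"] X.restr_closed[OF W(1) T(1,3) \<sigma>] unfolding T_def by metis
  obtain a s1 where a: "a \<in> carrier (sections Y V)" "s1 \<in> S"
    "induced_hom X f V U s1 \<otimes>\<^bsub>sections X U\<^esub> b = induced_hom X f V U a" using frac[OF b] by blast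
  obtain c s2 where c: "c \<in> carrier (sections Y V)" "s2 \<in> S"
    "induced_hom X f V U s2 \<otimes>\<^bsub>sections X U\<^esub> t = induced_hom X f V U c" using frac[OF t(1)] by blast
  have sc: "s1 \<in> carrier (sections Y V)" "s2 \<in> carrier (sections Y V)" using S a c by auto
  \<comment> \<open>With \<open>\<sigma> = b / t^n\<close>, \<open>b = a / s1\<close> and
    \<open>t = c / s2\<close> one gets
    \<open>\<sigma> = (a s2^n) / (s1 c^n) = e / d\<close>.\<close>
  define d where "d = s1 \<otimes>\<^bsub>sections Y V\<^esub> c [^]\<^bsub>sections Y V\<^esub> n"
  define e where "e = a \<otimes>\<^bsub>sections Y V\<^esub> s2 [^]\<^bsub>sections Y V\<^esub> n"
  have dc: "d \<in> carrier (sections Y V)" and ec: "e \<in> carrier (sections Y V)" using sc c a by (auto simp: d_def e_def)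
  define N where "N = basic_open Y V d"
  have N: "openin (rtop Y) N" "N \<subseteq> V" using openin_basic_open basic_open_subset unfolding N_def by fast+
  have "?y \<in> basic_open Y V c"
    using mem_basic_open_induced[OF oV oU UV c(1) xU] X.basic_open_unit[OF oU unit[OF c(2)]] xU t
      X.basic_open_mult[OF oU \<phi>.hom_closed[OF sc(2)] t(1)] by (simp flip: c(3))
  then have "?y \<in> basic_open Y V (c [^]\<^bsub>sections Y V\<^esub> n)" using Y.basic_open_pow[OF oV c(1)] by blast
  moreover have "?y \<in> basic_open Y V s1"
    using mem_basic_open_induced[OF oV oU UV sc(1) xU] X.basic_open_unit[OF oU unit[OF a(2)]] xU by simp
  ultimately have yN: "?y \<in> N" using Y.basic_open_mult[OF oV sc(1)] c(1) by (simp add: N_def d_def)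
  interpret r: ring_hom_cring "sections Y V" "sections Y N" "restr Y V N" using Y.restr_rhc[OF oV N] .
  have du: "restr Y V N d \<in> Units (sections Y N)"
    using Y.unit_on_basic_open[OF oV N(1) _ dc] by (simp add: N_def)
  define \<tau> where "\<tau> = restr Y V N e \<otimes>\<^bsub>sections Y N\<^esub> inv\<^bsub>sections Y N\<^esub> (restr Y V N d)"
  have \<tau>: "\<tau> \<in> carrier (sections Y N)" using du ec by (simp add: \<tau>_def)
  have \<tau>d: "\<tau> \<otimes>\<^bsub>sections Y N\<^esub> restr Y V N d = restr Y V N e"
    using du ec dc by (simp add: \<tau>_def r.S.m_assoc)
  define W' where "W' = T \<inter> preim X f N"
  have W': "openin (rtop X) W'" "x \<in> W'" "W' \<subseteq> W" "W' \<subseteq> preim X f N" "W' \<subseteq> T" "W' \<subseteq> U" "W' \<subseteq> preim X f V"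
    using T open_preim[OF N(1)] yN xp UV unfolding W'_def by (auto simp: preim_def)
  interpret h: ring_hom_cring "sections Y V" "sections X W'" "induced_hom X f V W'" using induced_rhc[OF oV W'(1,7)] .
  interpret k: ring_hom_cring "sections X U" "sections X W'" "restr X U W'" using X.restr_rhc[OF oU W'(1,6)] .
  interpret hN: ring_hom_cring "sections Y N" "sections X W'" "induced_hom X f N W'" using induced_rhc[OF N(1) W'(1,4)] .
  interpret kT: ring_hom_cring "sections X T" "sections X W'" "restr X T W'" using X.restr_rhc[OF T(1) W'(1,5)] .
  have kh: "restr X U W' (induced_hom X f V U z) = induced_hom X f V W' z" if "z \<in> carrier (sections Y V)" for z
    using induced_restr_right[OF oV oU W'(1,6) UV that] .
  have hr: "induced_hom X f N W' (restr Y V N z) = induced_hom X f V W' z" if "z \<in> carrier (sections Y V)" for z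
    using induced_restr_left[OF oV N W'(1,4) that] .
  let ?\<sigma> = "restr X W W' \<sigma>" and ?h = "induced_hom X f V W'" and ?k = "restr X U W'"
  have \<sigma>c: "?\<sigma> \<in> carrier (sections X W')" using X.restr_closed[OF W(1) W'(1,3) \<sigma>] .
  have tn: "t [^]\<^bsub>sections X U\<^esub> n \<in> carrier (sections X U)" using t by simp
  have "?k b = restr X T W' (restr X U T b)" using X.restr_comp[OF oU T(1) W'(1,5) T(4) b] by simp
  also have "\<dots> = ?k t [^]\<^bsub>sections X W'\<^esub> n \<otimes>\<^bsub>sections X W'\<^esub> ?\<sigma>"
    unfolding bn using kT.hom_mult[OF X.restr_closed[OF oU T(1,4) tn] X.restr_closed[OF W(1) T(1,3) \<sigma>]]
      X.restr_comp[OF oU T(1) W'(1,5) T(4) tn] X.restr_comp[OF W(1) T(1) W'(1,5) T(3) \<sigma>] t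
    by (simp add: k.ring.hom_nat_pow)
  finally have kb: "?k b = ?k t [^]\<^bsub>sections X W'\<^esub> n \<otimes>\<^bsub>sections X W'\<^esub> ?\<sigma>" .
  have ha: "?h a = ?h s1 \<otimes>\<^bsub>sections X W'\<^esub> ?k b"
    using kh[OF a(1)] kh[OF sc(1)] b sc by (simp flip: a(3))
  have hc: "?h c = ?h s2 \<otimes>\<^bsub>sections X W'\<^esub> ?k t"
    using kh[OF c(1)] kh[OF sc(2)] t sc by (simp flip: c(3))
  have "?h d \<otimes>\<^bsub>sections X W'\<^esub> induced_hom X f N W' \<tau> = induced_hom X f N W' (\<tau> \<otimes>\<^bsub>sections Y N\<^esub> restr Y V N d)"
    using \<tau> dc hr[OF dc] h.S.m_comm by simp
  also have "\<dots> = ?h e" unfolding \<tau>d using hr[OF ec] .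
  also have "\<dots> = (?h s1 \<otimes>\<^bsub>sections X W'\<^esub> (?k t [^]\<^bsub>sections X W'\<^esub> n \<otimes>\<^bsub>sections X W'\<^esub> ?\<sigma>))
      \<otimes>\<^bsub>sections X W'\<^esub> ?h s2 [^]\<^bsub>sections X W'\<^esub> n"
    unfolding e_def using a sc by (simp add: ha kb h.ring.hom_nat_pow)
  also have "\<dots> = (?h s1 \<otimes>\<^bsub>sections X W'\<^esub> (?h s2 [^]\<^bsub>sections X W'\<^esub> n \<otimes>\<^bsub>sections X W'\<^esub> ?k t [^]\<^bsub>sections X W'\<^esub> n))
      \<otimes>\<^bsub>sections X W'\<^esub> ?\<sigma>"
  proof -
    have "?h s1 \<in> carrier (sections X W')" "?k t [^]\<^bsub>sections X W'\<^esub> n \<in> carrier (sections X W')"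
      "?h s2 [^]\<^bsub>sections X W'\<^esub> n \<in> carrier (sections X W')" using sc t by auto
    then show ?thesis using \<sigma>c by algebra
  qed
  also have "?h s1 \<otimes>\<^bsub>sections X W'\<^esub> (?h s2 [^]\<^bsub>sections X W'\<^esub> n \<otimes>\<^bsub>sections X W'\<^esub> ?k t [^]\<^bsub>sections X W'\<^esub> n) = ?h d"
    unfolding d_def using sc c t by (simp add: h.ring.hom_nat_pow hc h.S.nat_pow_distrib)
  finally have eq: "?h d \<otimes>\<^bsub>sections X W'\<^esub> induced_hom X f N W' \<tau> = ?h d \<otimes>\<^bsub>sections X W'\<^esub> ?\<sigma>" .
  \<comment> \<open>Both sides of the last equation carry the factor \<open>d\<close>, which is a
    unit on \<open>N\<close> and hence on \<open>W'\<close>.\<close>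
  have "?h d \<in> Units (sections X W')"
    using ring_hom_Units[OF hN.homh Y.cring_sections[OF N(1)] X.cring_sections[OF W'(1)] du] hr[OF dc] by simp
  then have "induced_hom X f N W' \<tau> = ?\<sigma>" using eq h.S.Units_l_cancel \<tau> \<sigma>c by simp
  then show ?thesis using that[OF N(1) yN \<tau> W'(1-4)] by blast
qed


text \<open>Each generator descends to a germ on \<open>Y\<close> by
  \<open>section_descends\<close>, and that germ is a fraction over the affine set \<open>V\<close>.
  By induction on \<open>F\<close> the denominators are multiplied and the neighbourhood of
  \<open>x\<close> is shrunk.\<close>

lemma common_denominator:
  assumes V: "affine_open Y V" and U: "openin (rtop X) U" and UV: "U \<subseteq> preim X f V" and x: "x \<in> U"
    and F: "finite F" "F \<subseteq> carrier (sections X U)"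
  shows "\<exists>g\<in>carrier (sections Y V). pt_map f x \<in> basic_open Y V g \<and>
    (\<exists>W. openin (rtop X) W \<and> x \<in> W \<and> W \<subseteq> U \<and>
      (\<forall>b\<in>F. \<exists>a\<in>carrier (sections Y V).
        induced_hom X f V W g \<otimes>\<^bsub>sections X W\<^esub> restr X U W b = induced_hom X f V W a))"
  using F
proof (induction F)
  have oV: "openin (rtop Y) V" using V by (simp add: affine_open_def)
  interpret A: cring "sections Y V" using Y.cring_sections[OF oV] .
  have y: "pt_map f x \<in> V" using UV x by (auto simp: preim_def)
  {
    case empty
    have "pt_map f x \<in> basic_open Y V \<one>\<^bsub>sections Y V\<^esub>" using Y.basic_open_unit[OF oV A.Units_one_closed] y by simp
    then show ?case using U x by blast
  next
    case (insert b F)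
    then obtain g W where g: "g \<in> carrier (sections Y V)" "pt_map f x \<in> basic_open Y V g"
      and W: "openin (rtop X) W" "x \<in> W" "W \<subseteq> U"
      and fr: "\<And>b. b \<in> F \<Longrightarrow> \<exists>a\<in>carrier (sections Y V).
        induced_hom X f V W g \<otimes>\<^bsub>sections X W\<^esub> restr X U W b = induced_hom X f V W a" by auto
    have b: "b \<in> carrier (sections X U)" using insert by simp
    obtain N \<tau> W' where N: "openin (rtop Y) N" "pt_map f x \<in> N" and \<tau>: "\<tau> \<in> carrier (sections Y N)"
      and W': "openin (rtop X) W'" "x \<in> W'" "W' \<subseteq> U" "W' \<subseteq> preim X f N"
        "induced_hom X f N W' \<tau> = restr X U W' b"
      using section_descends[OF U x b] by metis
    obtain h where h: "h \<in> carrier (sections Y V)" "pt_map f x \<in> basic_open Y V h" "basic_open Y V h \<subseteq> V \<inter> N"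
      using Y.affine_basis[OF V openin_Int[OF oV N(1)], of "pt_map f x"] y N by blast
    define H where "H = basic_open Y V h"
    have H: "openin (rtop Y) H" "pt_map f x \<in> H" "H \<subseteq> V" "H \<subseteq> N"
      using h openin_basic_open unfolding H_def by auto
    obtain a and n :: nat where a: "a \<in> carrier (sections Y V)" and
      an: "restr Y V H a = restr Y V H (h [^]\<^bsub>sections Y V\<^esub> n) \<otimes>\<^bsub>sections Y H\<^esub> restr Y N H \<tau>"
      using Y.affine_fraction[OF V h(1), of "restr Y N H \<tau>"] Y.restr_closed[OF N(1) H(1,4) \<tau>] unfolding H_def by metis
    define hn where "hn = h [^]\<^bsub>sections Y V\<^esub> n"
    have hn: "hn \<in> carrier (sections Y V)" "pt_map f x \<in> basic_open Y V hn"
      using h Y.basic_open_pow[OF oV h(1), of n] by (auto simp: hn_def)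
    define Z where "Z = W \<inter> (W' \<inter> preim X f H)"
    have Z: "openin (rtop X) Z" "x \<in> Z" "Z \<subseteq> W" "Z \<subseteq> W'" "Z \<subseteq> U" "Z \<subseteq> preim X f H" "Z \<subseteq> preim X f N" "Z \<subseteq> preim X f V"
      using W W' H open_preim[OF H(1)] UV x mem_preim[OF U x] unfolding Z_def by auto
    interpret k: ring_hom_cring "sections Y V" "sections X Z" "induced_hom X f V Z" using induced_rhc[OF oV Z(1,8)] .
    interpret kH: ring_hom_cring "sections Y H" "sections X Z" "induced_hom X f H Z" using induced_rhc[OF H(1) Z(1,6)] .
    interpret r: ring_hom_cring "sections X W" "sections X Z" "restr X W Z" using X.restr_rhc[OF W(1) Z(1,3)] .
    have WV: "W \<subseteq> preim X f V" using W UV by blast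
    have bZ: "induced_hom X f V Z hn \<otimes>\<^bsub>sections X Z\<^esub> restr X U Z b = induced_hom X f V Z a"
    proof -
      have "induced_hom X f V Z a = induced_hom X f H Z (restr Y V H a)"
        using induced_restr_left[OF oV H(1,3) Z(1,6) a] by simp
      also have "\<dots> = induced_hom X f V Z hn \<otimes>\<^bsub>sections X Z\<^esub> induced_hom X f N Z \<tau>"
        unfolding an hn_def[symmetric]
        using kH.hom_mult[OF Y.restr_closed[OF oV H(1,3) hn(1)] Y.restr_closed[OF N(1) H(1,4) \<tau>]]
          induced_restr_left[OF oV H(1,3) Z(1,6) hn(1)] induced_restr_left[OF N(1) H(1,4) Z(1,6) \<tau>] by simp
      also have "induced_hom X f N Z \<tau> = restr X U Z b"
        using induced_restr_right[OF N(1) W'(1) Z(1,4) W'(4) \<tau>] W'(5)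
          X.restr_comp[OF U W'(1) Z(1,4) W'(3) b] by simp
      finally show ?thesis by simp
    qed
    \<comment> \<open>The factor \<open>g\<close> serves the elements of \<open>F\<close> and
      \<open>hn\<close> serves the new \<open>b\<close>; each numerator is multiplied by the other
      factor.\<close>
    let ?g = "g \<otimes>\<^bsub>sections Y V\<^esub> hn"
    have "\<exists>a\<in>carrier (sections Y V).
        induced_hom X f V Z ?g \<otimes>\<^bsub>sections X Z\<^esub> restr X U Z c = induced_hom X f V Z a" if c: "c \<in> insert b F" for c
    proof (cases "c = b")
      case True
      have "restr X U Z b \<in> carrier (sections X Z)" using X.restr_closed[OF U Z(1,5) b] .
      then have "induced_hom X f V Z ?g \<otimes>\<^bsub>sections X Z\<^esub> restr X U Z c = induced_hom X f V Z (g \<otimes>\<^bsub>sections Y V\<^esub> a)"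
        using True g hn a bZ by (simp add: k.S.m_assoc)
      then show ?thesis using A.m_closed[OF g(1) a] by blast
    next
      case False
      then have cF: "c \<in> F" and cU: "c \<in> carrier (sections X U)" using c insert by auto
      obtain d where d: "d \<in> carrier (sections Y V)"
        "induced_hom X f V W g \<otimes>\<^bsub>sections X W\<^esub> restr X U W c = induced_hom X f V W d" using fr[OF cF] by blast
      interpret w: ring_hom_cring "sections Y V" "sections X W" "induced_hom X f V W" using induced_rhc[OF oV W(1) WV] .
      have cc: "restr X U W c \<in> carrier (sections X W)" "restr X U Z c \<in> carrier (sections X Z)"
        using X.restr_closed[OF U W(1,3) cU] X.restr_closed[OF U Z(1,5) cU] .
      have "restr X W Z (induced_hom X f V W g \<otimes>\<^bsub>sections X W\<^esub> restr X U W c) = induced_hom X f V Z d"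
        unfolding d(2) using induced_restr_right[OF oV W(1) Z(1,3) WV d(1)] .
      then have "induced_hom X f V Z g \<otimes>\<^bsub>sections X Z\<^esub> restr X U Z c = induced_hom X f V Z d"
        using r.hom_mult[OF w.hom_closed[OF g(1)] cc(1)] induced_restr_right[OF oV W(1) Z(1,3) WV g(1)]
          X.restr_comp[OF U W(1) Z(1,3) W(3) cU] by simp
      moreover have "induced_hom X f V Z ?g \<otimes>\<^bsub>sections X Z\<^esub> restr X U Z c
        = induced_hom X f V Z hn \<otimes>\<^bsub>sections X Z\<^esub> (induced_hom X f V Z g \<otimes>\<^bsub>sections X Z\<^esub> restr X U Z c)"
        using k.hom_closed[OF g(1)] k.hom_closed[OF hn(1)] cc(2) k.hom_mult[OF g(1) hn(1)]
        by (simp add: k.S.m_assoc k.S.m_lcomm)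
      ultimately have "induced_hom X f V Z ?g \<otimes>\<^bsub>sections X Z\<^esub> restr X U Z c
        = induced_hom X f V Z (hn \<otimes>\<^bsub>sections Y V\<^esub> d)"
        using k.hom_mult[OF hn(1) d(1)] by simp
      then show ?thesis using A.m_closed[OF hn(1) d(1)] by blast
    qed
    moreover have "pt_map f x \<in> basic_open Y V ?g" using Y.basic_open_mult[OF oV g(1) hn(1)] g hn by simp
    ultimately show ?case using g hn Z by (intro bexI[of _ ?g] conjI exI[of _ Z]) auto
  }
qed

text \<open>The ring of \<open>V\<close> need not be noetherian, so finite generation of the kernel is used over a
  noetherian affine neighbourhood instead.\<close>

lemma kernel_locally_zero:
  assumes V: "affine_open Y V" and V0: "affine_open Y V0" "noetherian_ring (sections Y V0)"
    and g0: "g0 \<in> carrier (sections Y V0)" "pt_map f x \<in> basic_open Y V0 g0" "basic_open Y V0 g0 \<subseteq> V"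
    and T: "openin (rtop X) T" "x \<in> T" "T \<subseteq> preim X f (basic_open Y V0 g0)"
  shows "\<exists>h\<in>carrier (sections Y V). pt_map f x \<in> basic_open Y V h \<and>
    (\<forall>a\<in>carrier (sections Y V). induced_hom X f V T a = \<zero>\<^bsub>sections X T\<^esub> \<longrightarrow>
      (\<exists>k::nat. h [^]\<^bsub>sections Y V\<^esub> k \<otimes>\<^bsub>sections Y V\<^esub> a = \<zero>\<^bsub>sections Y V\<^esub>))"
proof -
  let ?y = "pt_map f x"
  define N where "N = basic_open Y V0 g0"
  have oV: "openin (rtop Y) V" and oV0: "openin (rtop Y) V0" using V V0 by (auto simp: affine_open_def)
  have N: "openin (rtop Y) N" "?y \<in> N" "N \<subseteq> V0" "N \<subseteq> V"
    using openin_basic_open g0 basic_open_subset[of Y V0 g0] unfolding N_def by auto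
  have TN: "T \<subseteq> preim X f N" "T \<subseteq> preim X f V0" "T \<subseteq> preim X f V"
    using T N by (auto simp: N_def preim_def)
  interpret h0: ring_hom_cring "sections Y V0" "sections X T" "induced_hom X f V0 T" using induced_rhc[OF oV0 T(1) TN(2)] .
  interpret h: ring_hom_cring "sections Y V" "sections X T" "induced_hom X f V T" using induced_rhc[OF oV T(1) TN(3)] .
  interpret hN: ring_hom_cring "sections Y N" "sections X T" "induced_hom X f N T" using induced_rhc[OF N(1) T(1) TN(1)] .
  \<comment> \<open>The kernel over the noetherian set \<open>V0\<close>, where it has a finite set
    \<open>E\<close> of generators.\<close>
  define K where "K = {a \<in> carrier (sections Y V0). induced_hom X f V0 T a = \<zero>\<^bsub>sections X T\<^esub>}"
  have "ideal K (sections Y V0)" by (rule h0.R.ideal_of_closed) (auto simp: K_def)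
  then obtain E where E: "E \<subseteq> carrier (sections Y V0)" "finite E" "K = Idl\<^bsub>sections Y V0\<^esub> E"
    using noetherian_ring.finetely_gen[OF V0(2)] by metis
  have EK: "E \<subseteq> K" unfolding E(3) using h0.R.genideal_self[OF E(1)] .
  \<comment> \<open>Each generator vanishes near \<open>?y\<close> by
    \<open>vanishing_descends\<close>; finiteness of \<open>E\<close> provides one neighbourhood for
    all of them, and hence for all of \<open>K\<close>.\<close>
  have "\<exists>M. openin (rtop Y) M \<and> ?y \<in> M \<and> M \<subseteq> V0 \<and> (\<forall>e\<in>E. restr Y V0 M e = \<zero>\<^bsub>sections Y M\<^esub>)"
    using E(2) EK
  proof (induction E)
    case empty
    then show ?case using oV0 N by blast
  next
    case (insert e E)
    then obtain M where M: "openin (rtop Y) M" "?y \<in> M" "M \<subseteq> V0" "\<And>e. e \<in> E \<Longrightarrow> restr Y V0 M e = \<zero>\<^bsub>sections Y M\<^esub>"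
      by auto
    have e: "e \<in> carrier (sections Y V0)" "induced_hom X f V0 T e = \<zero>\<^bsub>sections X T\<^esub>"
      using insert by (auto simp: K_def)
    obtain M' where M': "openin (rtop Y) M'" "?y \<in> M'" "M' \<subseteq> V0" "restr Y V0 M' e = \<zero>\<^bsub>sections Y M'\<^esub>"
      using vanishing_descends[OF oV0 e(1) T(1,2) TN(2) e(2)] by blast
    let ?M = "M \<inter> M'"
    have o: "openin (rtop Y) ?M" using M M' by blast
    have "restr Y V0 ?M d = \<zero>\<^bsub>sections Y ?M\<^esub>" if d: "d \<in> insert e E" for d
    proof -
      have dc: "d \<in> carrier (sections Y V0)" using d insert(4) by (auto simp: K_def)
      interpret r: ring_hom_cring "sections Y M" "sections Y ?M" "restr Y M ?M" using Y.restr_rhc[OF M(1) o] by simp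
      interpret r': ring_hom_cring "sections Y M'" "sections Y ?M" "restr Y M' ?M" using Y.restr_rhc[OF M'(1) o] by simp
      show ?thesis
      proof (cases "d = e")
        case True
        then show ?thesis using Y.restr_comp[OF oV0 M'(1) o _ M'(3) dc] M'(4) r'.hom_zero by simp
      next
        case False
        then show ?thesis using d Y.restr_comp[OF oV0 M(1) o _ M(3) dc] M(4)[of d] r.hom_zero by simp
      qed
    qed
    then show ?case using o M M' by (intro exI[of _ ?M]) auto
  qed
  then obtain M where M: "openin (rtop Y) M" "?y \<in> M" "M \<subseteq> V0" "\<And>e. e \<in> E \<Longrightarrow> restr Y V0 M e = \<zero>\<^bsub>sections Y M\<^esub>"
    by metis
  have KM: "restr Y V0 M a = \<zero>\<^bsub>sections Y M\<^esub>" if "a \<in> K" for a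
  proof -
    interpret r: ring_hom_cring "sections Y V0" "sections Y M" "restr Y V0 M" using Y.restr_rhc[OF oV0 M(1,3)] .
    have "ideal {a \<in> carrier (sections Y V0). restr Y V0 M a = \<zero>\<^bsub>sections Y M\<^esub>} (sections Y V0)"
      by (rule h0.R.ideal_of_closed) auto
    then have "K \<subseteq> {a \<in> carrier (sections Y V0). restr Y V0 M a = \<zero>\<^bsub>sections Y M\<^esub>}"
      unfolding E(3) using h0.R.genideal_minimal M(4) E(1) by blast
    then show ?thesis using that by blast
  qed
  obtain h where h: "h \<in> carrier (sections Y V)" "?y \<in> basic_open Y V h" "basic_open Y V h \<subseteq> M \<inter> N"
    using Y.affine_basis[OF V openin_Int[OF M(1) N(1)], of ?y] M N by blast
  define H where "H = basic_open Y V h"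
  have H: "openin (rtop Y) H" "H \<subseteq> M" "H \<subseteq> N" "H \<subseteq> V" "H \<subseteq> V0" "H \<subseteq> basic_open Y V0 g0"
    using openin_basic_open h N unfolding H_def by (auto simp: N_def)
  have "\<exists>k::nat. h [^]\<^bsub>sections Y V\<^esub> k \<otimes>\<^bsub>sections Y V\<^esub> a = \<zero>\<^bsub>sections Y V\<^esub>"
    if a: "a \<in> carrier (sections Y V)" "induced_hom X f V T a = \<zero>\<^bsub>sections X T\<^esub>" for a
  proof -
    \<comment> \<open>Moves \<open>a\<close> from \<open>V\<close> to \<open>V0\<close>: on
      \<open>N\<close> the section \<open>b = g0^n a\<close> comes from \<open>V0\<close> and lies
      in \<open>K\<close>. As \<open>g0\<close> is a unit on \<open>H\<close>, the vanishing of
      \<open>b\<close> there gives that of \<open>a\<close>.\<close>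
    obtain b and n :: nat where b: "b \<in> carrier (sections Y V0)" and
      bn: "restr Y V0 N b = restr Y V0 N (g0 [^]\<^bsub>sections Y V0\<^esub> n) \<otimes>\<^bsub>sections Y N\<^esub> restr Y V N a"
      using Y.affine_fraction[OF V0(1) g0(1), of "restr Y V N a"] Y.restr_closed[OF oV N(1,4) a(1)] unfolding N_def by metis
    have gn: "g0 [^]\<^bsub>sections Y V0\<^esub> n \<in> carrier (sections Y V0)" using g0 by simp
    have "induced_hom X f V0 T b = induced_hom X f N T (restr Y V0 N b)"
      using induced_restr_left[OF oV0 N(1,3) T(1) TN(1) b] by simp
    also have "\<dots> = induced_hom X f V0 T (g0 [^]\<^bsub>sections Y V0\<^esub> n) \<otimes>\<^bsub>sections X T\<^esub> induced_hom X f V T a"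
      unfolding bn using hN.hom_mult[OF Y.restr_closed[OF oV0 N(1,3) gn] Y.restr_closed[OF oV N(1,4) a(1)]]
        induced_restr_left[OF oV0 N(1,3) T(1) TN(1) gn] induced_restr_left[OF oV N(1,4) T(1) TN(1) a(1)] by simp
    also have "\<dots> = \<zero>\<^bsub>sections X T\<^esub>" unfolding a(2) using h0.S.r_null h0.hom_closed[OF gn] .
    finally have bM: "restr Y V0 M b = \<zero>\<^bsub>sections Y M\<^esub>" using KM b by (simp add: K_def)
    interpret rM: ring_hom_cring "sections Y M" "sections Y H" "restr Y M H" using Y.restr_rhc[OF M(1) H(1,2)] .
    interpret rN: ring_hom_cring "sections Y N" "sections Y H" "restr Y N H" using Y.restr_rhc[OF N(1) H(1,3)] .
    interpret r0: ring_hom_cring "sections Y V0" "sections Y H" "restr Y V0 H" using Y.restr_rhc[OF oV0 H(1,5)] .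
    have "restr Y V0 H b = \<zero>\<^bsub>sections Y H\<^esub>"
      using Y.restr_comp[OF oV0 M(1) H(1,2) M(3) b] bM rM.hom_zero by simp
    moreover have "restr Y V0 H b = restr Y N H (restr Y V0 N b)"
      using Y.restr_comp[OF oV0 N(1) H(1,3) N(3) b] by simp
    moreover have "restr Y N H (restr Y V0 N b) = restr Y V0 H g0 [^]\<^bsub>sections Y H\<^esub> n \<otimes>\<^bsub>sections Y H\<^esub> restr Y V H a"
      unfolding bn using rN.hom_mult[OF Y.restr_closed[OF oV0 N(1,3) gn] Y.restr_closed[OF oV N(1,4) a(1)]]
        Y.restr_comp[OF oV0 N(1) H(1,3) N(3) gn] Y.restr_comp[OF oV N(1) H(1,3) N(4) a(1)] g0(1)
      by (simp add: r0.ring.hom_nat_pow)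
    ultimately have "restr Y V0 H g0 [^]\<^bsub>sections Y H\<^esub> n \<otimes>\<^bsub>sections Y H\<^esub> restr Y V H a = \<zero>\<^bsub>sections Y H\<^esub>" by simp
    then have "restr Y V H a = \<zero>\<^bsub>sections Y H\<^esub>"
      using rM.S.unit_mult_zero[OF rM.S.Units_pow_closed[OF Y.unit_on_basic_open[OF oV0 H(1,6) g0(1)]]
          Y.restr_closed[OF oV H(1,4) a(1)]] by blast
    then show ?thesis using Y.affine_vanish[OF V h(1) a(1)] unfolding H_def by metis
  qed
  then show ?thesis using h by blast
qed


section \<open>Charts of finite type and the openness of the map\<close>

lemma finite_type_chart:
  assumes ft: "finite_type X Y f" and x: "x \<in> points X"
  obtains V U F where "affine_open Y V" "affine_open X U" "x \<in> U" "U \<subseteq> preim X f V"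
    "finite F" "F \<subseteq> carrier (sections X U)"
    "generate_ring (sections X U) (induced_hom X f V U ` carrier (sections Y V) \<union> F) = carrier (sections X U)"
proof -
  have y: "pt_map f x \<in> points Y" using continuous x by (auto simp: continuous_map_def)
  obtain \<V> where \<V>: "\<Union>\<V> = points Y" "\<And>V. V \<in> \<V> \<Longrightarrow> affine_open Y V \<and> (\<exists>\<U>. finite \<U> \<and> \<Union>\<U> = preim X f V \<and>
         (\<forall>U\<in>\<U>. affine_open X U \<and> finite_type_hom (sections Y V) (sections X U) (induced_hom X f V U)))"
    using ft unfolding finite_type_def by blast
  obtain V where V: "V \<in> \<V>" "pt_map f x \<in> V" using y \<V>(1) by blast
  obtain \<U> where \<U>: "\<Union>\<U> = preim X f V"
    "\<And>U. U \<in> \<U> \<Longrightarrow> affine_open X U \<and> finite_type_hom (sections Y V) (sections X U) (induced_hom X f V U)"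
    using \<V>(2)[OF V(1)] by blast
  have "x \<in> \<Union>\<U>" using \<U>(1) V x by (simp add: preim_def)
  then obtain U where U: "U \<in> \<U>" "x \<in> U" by blast
  have sub: "U \<subseteq> preim X f V" using U \<U>(1) by blast
  obtain F where F: "finite F" "F \<subseteq> carrier (sections X U)"
    "generate_ring (sections X U) (induced_hom X f V U ` carrier (sections Y V) \<union> F) = carrier (sections X U)"
    using \<U>(2)[OF U(1)] unfolding finite_type_hom_def by blast
  show ?thesis by (rule that[OF conjunct1[OF \<V>(2)[OF V(1)]] conjunct1[OF \<U>(2)[OF U(1)]] U(2) sub F])
qed

text \<open>The last two conclusions are the form in which the sections over
  \<open>basic_open X U t\<close> are recognised as \<open>A\<^sub>w\<close>, with \<open>A\<close>
  the ring of \<open>V\<close>. Three elements of \<open>A\<close> are collected for this: a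
  denominator of the generators, a numerator of the function cutting out the neighbourhood, and an
  element whose powers kill the kernel.\<close>

lemma localized_chart:
  assumes ft: "finite_type X Y f" and T0: "openin (rtop X) T0" "x \<in> T0"
  obtains V U t w where "affine_open Y V" "affine_open X U" "U \<subseteq> preim X f V"
    "t \<in> carrier (sections X U)" "basic_open X U t \<subseteq> T0"
    "w \<in> carrier (sections Y V)" "pt_map f x \<in> basic_open Y V w"
    "\<And>e. e \<in> carrier (sections X (basic_open X U t)) \<Longrightarrow> \<exists>a\<in>carrier (sections Y V). \<exists>n::nat.
      e \<otimes>\<^bsub>sections X (basic_open X U t)\<^esub> induced_hom X f V (basic_open X U t) (w [^]\<^bsub>sections Y V\<^esub> n)
        = induced_hom X f V (basic_open X U t) a"
    "\<And>a. \<lbrakk>a \<in> carrier (sections Y V);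
        induced_hom X f V (basic_open X U t) a = \<zero>\<^bsub>sections X (basic_open X U t)\<^esub>\<rbrakk>
      \<Longrightarrow> \<exists>n::nat. w [^]\<^bsub>sections Y V\<^esub> n \<otimes>\<^bsub>sections Y V\<^esub> a = \<zero>\<^bsub>sections Y V\<^esub>"
proof -
  let ?y = "pt_map f x"
  have xp: "x \<in> points X" using openin_subset[OF T0(1)] T0(2) by blast
  have yp: "?y \<in> points Y" using continuous xp by (auto simp: continuous_map_def)
  obtain V U F where V: "affine_open Y V" and U: "affine_open X U" and xU: "x \<in> U" and UV: "U \<subseteq> preim X f V"
    and F: "finite F" "F \<subseteq> carrier (sections X U)"
    and gen: "generate_ring (sections X U) (induced_hom X f V U ` carrier (sections Y V) \<union> F) = carrier (sections X U)"
    using finite_type_chart[OF ft xp] by metis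
  have oV: "openin (rtop Y) V" and oU: "openin (rtop X) U" using V U by (auto simp: affine_open_def)
  have yV: "?y \<in> V" using UV xU by (auto simp: preim_def)
  obtain \<W> where "\<Union>\<W> = points Y" "\<And>V. V \<in> \<W> \<Longrightarrow> affine_open Y V \<and> noetherian_ring (sections Y V)"
    using Y.noetherian_cover by metis
  then obtain V0 where V0: "affine_open Y V0" "noetherian_ring (sections Y V0)" "?y \<in> V0" using yp by blast
  have oV0: "openin (rtop Y) V0" using V0 by (simp add: affine_open_def)
  obtain g0 where g0: "g0 \<in> carrier (sections Y V0)" "?y \<in> basic_open Y V0 g0" "basic_open Y V0 g0 \<subseteq> V0 \<inter> V"
    using Y.affine_basis[OF V0(1) openin_Int[OF oV0 oV], of ?y] V0 yV by blast
  obtain g W where g: "g \<in> carrier (sections Y V)" "?y \<in> basic_open Y V g"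
    and W: "openin (rtop X) W" "x \<in> W" "W \<subseteq> U"
    and fr: "\<And>b. b \<in> F \<Longrightarrow> \<exists>a\<in>carrier (sections Y V).
      induced_hom X f V W g \<otimes>\<^bsub>sections X W\<^esub> restr X U W b = induced_hom X f V W a"
    using common_denominator[OF V oU UV xU F] by metis
  \<comment> \<open>Inside \<open>W\<close> the generators have denominator \<open>g\<close>, inside
    the preimage of \<open>basic_open Y V0 g0\<close> the kernel can be controlled by
    \<open>kernel_locally_zero\<close>, and \<open>T0\<close> is the prescribed
    neighbourhood.\<close>
  define Z where "Z = W \<inter> (T0 \<inter> preim X f (basic_open Y V0 g0))"
  have oZ: "openin (rtop X) Z" unfolding Z_def
    by (rule openin_Int[OF W(1) openin_Int[OF T0(1) open_preim[OF openin_basic_open]]])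
  have "x \<in> Z" using W T0 g0 xp by (simp add: Z_def preim_def)
  moreover have "Z \<subseteq> U" using W by (auto simp: Z_def)
  ultimately obtain t where t: "t \<in> carrier (sections X U)" "x \<in> basic_open X U t" "basic_open X U t \<subseteq> Z"
    using X.affine_basis[OF U oZ] by metis
  interpret \<phi>: ring_hom_cring "sections Y V" "sections X U" "induced_hom X f V U" using induced_rhc[OF oV oU UV] .
  let ?\<phi> = "induced_hom X f V U"
  \<comment> \<open>The factor \<open>g\<close> makes \<open>g\<close> a unit on \<open>T1\<close>,
    so that its powers can serve there as denominators.\<close>
  define t1 where "t1 = t \<otimes>\<^bsub>sections X U\<^esub> ?\<phi> g"
  have t1: "t1 \<in> carrier (sections X U)" using t g by (simp add: t1_def)
  define T1 where "T1 = basic_open X U t1"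
  have T1eq: "T1 = basic_open X U t \<inter> basic_open X U (?\<phi> g)"
    using X.basic_open_mult[OF oU t(1) \<phi>.hom_closed[OF g(1)]] by (simp add: T1_def t1_def)
  have T1: "openin (rtop X) T1" "T1 \<subseteq> U" "T1 \<subseteq> W" "T1 \<subseteq> T0" "T1 \<subseteq> preim X f (basic_open Y V0 g0)"
    "T1 \<subseteq> basic_open X U t" "T1 \<subseteq> basic_open X U (?\<phi> g)"
  proof -
    show "openin (rtop X) T1" unfolding T1_def by (rule openin_basic_open)
    show "T1 \<subseteq> U" unfolding T1_def by (rule basic_open_subset)
  qed (use T1eq t(3) in \<open>auto simp: Z_def\<close>)
  have T1V: "T1 \<subseteq> preim X f V" using T1(2) UV by blast
  have xT1: "x \<in> T1" using mem_basic_open_induced[OF oV oU UV g(1) xU] g(2) t(2) by (simp add: T1eq)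
  interpret k1: ring_hom_cring "sections X U" "sections X T1" "restr X U T1" using X.restr_rhc[OF oU T1(1,2)] .
  interpret \<psi>1: ring_hom_cring "sections Y V" "sections X T1" "induced_hom X f V T1" using induced_rhc[OF oV T1(1) T1V] .
  let ?\<psi>1 = "induced_hom X f V T1" and ?k1 = "restr X U T1"
  have k1\<phi>: "?k1 (?\<phi> a) = ?\<psi>1 a" if "a \<in> carrier (sections Y V)" for a
    using induced_restr_right[OF oV oU T1(1,2) UV that] .
  \<comment> \<open>Elements of \<open>A\<close> have denominator \<open>g^0\<close> and those of
    \<open>F\<close> have \<open>g^1\<close>; \<open>generate_ring_fractions\<close> extends this to
    all of \<open>sections X U\<close>.\<close>
  have frac1: "\<exists>a\<in>carrier (sections Y V). \<exists>n::nat. ?\<psi>1 (g [^]\<^bsub>sections Y V\<^esub> n) \<otimes>\<^bsub>sections X T1\<^esub> ?k1 b = ?\<psi>1 a"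
    if b: "b \<in> carrier (sections X U)" for b
  proof -
    have gens: "c \<in> carrier (sections X U) \<and> (\<exists>a\<in>carrier (sections Y V). \<exists>n::nat.
        ?\<psi>1 (g [^]\<^bsub>sections Y V\<^esub> n) \<otimes>\<^bsub>sections X T1\<^esub> ?k1 c = ?\<psi>1 a)"
      if c: "c \<in> ?\<phi> ` carrier (sections Y V) \<union> F" for c
    proof (cases "c \<in> F")
      case True
      have cU: "c \<in> carrier (sections X U)" using True F by blast
      obtain a where a: "a \<in> carrier (sections Y V)"
        "induced_hom X f V W g \<otimes>\<^bsub>sections X W\<^esub> restr X U W c = induced_hom X f V W a" using fr[OF True] by blast
      have WV: "W \<subseteq> preim X f V" using W UV by blast
      interpret r: ring_hom_cring "sections X W" "sections X T1" "restr X W T1" using X.restr_rhc[OF W(1) T1(1,3)] .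
      interpret w: ring_hom_cring "sections Y V" "sections X W" "induced_hom X f V W" using induced_rhc[OF oV W(1) WV] .
      have "restr X W T1 (induced_hom X f V W g \<otimes>\<^bsub>sections X W\<^esub> restr X U W c) = ?\<psi>1 a"
        unfolding a(2) using induced_restr_right[OF oV W(1) T1(1,3) WV a(1)] .
      then have "?\<psi>1 g \<otimes>\<^bsub>sections X T1\<^esub> ?k1 c = ?\<psi>1 a"
        using r.hom_mult[OF w.hom_closed[OF g(1)] X.restr_closed[OF oU W(1,3) cU]]
          induced_restr_right[OF oV W(1) T1(1,3) WV g(1)] X.restr_comp[OF oU W(1) T1(1,3) W(3) cU] by simp
      then have "?\<psi>1 (g [^]\<^bsub>sections Y V\<^esub> (1::nat)) \<otimes>\<^bsub>sections X T1\<^esub> ?k1 c = ?\<psi>1 a" using g by simp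
      then show ?thesis using a(1) cU by blast
    next
      case False
      then obtain a where a: "a \<in> carrier (sections Y V)" "c = ?\<phi> a" using c by blast
      then have "?\<psi>1 (g [^]\<^bsub>sections Y V\<^esub> (0::nat)) \<otimes>\<^bsub>sections X T1\<^esub> ?k1 c = ?\<psi>1 a" using k1\<phi> by simp
      then show ?thesis using a by blast
    qed
    have "b \<in> generate_ring (sections X U) (?\<phi> ` carrier (sections Y V) \<union> F)" using b gen by simp
    then show ?thesis
      using k1.S.generate_ring_fractions[OF \<psi>1.ring_hom_cring_axioms k1.ring_hom_cring_axioms g(1) gens] by blast
  qed
  \<comment> \<open>On \<open>T1\<close> this reads \<open>t = a0 / g^n0\<close>. Both
    \<open>g\<close> and \<open>t\<close> are units there, hence so is \<open>a0\<close>, which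
    therefore does not vanish at \<open>?y\<close> and may become a factor of
    \<open>w\<close>.\<close>
  obtain a0 and n0 :: nat where a0: "a0 \<in> carrier (sections Y V)"
    "?\<psi>1 (g [^]\<^bsub>sections Y V\<^esub> n0) \<otimes>\<^bsub>sections X T1\<^esub> ?k1 t = ?\<psi>1 a0" using frac1[OF t(1)] by blast
  have unit_t: "?k1 t \<in> Units (sections X T1)" using X.unit_on_basic_open[OF oU T1(1,6) t(1)] .
  have unit_g: "?\<psi>1 g \<in> Units (sections X T1)"
    using X.unit_on_basic_open[OF oU T1(1,7) \<phi>.hom_closed[OF g(1)]] k1\<phi>[OF g(1)] by simp
  have "?\<psi>1 a0 \<in> Units (sections X T1)"
    unfolding a0(2)[symmetric] using unit_t k1.S.Units_pow_closed[OF unit_g, of n0] g(1)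
    by (simp add: \<psi>1.ring.hom_nat_pow)
  then have ya0: "?y \<in> basic_open Y V a0"
    using mem_basic_open_induced[OF oV T1(1) T1V a0(1) xT1] X.basic_open_unit[OF T1(1)] xT1 by simp
  obtain h where h: "h \<in> carrier (sections Y V)" "?y \<in> basic_open Y V h"
    and ker1: "\<And>a. \<lbrakk>a \<in> carrier (sections Y V); ?\<psi>1 a = \<zero>\<^bsub>sections X T1\<^esub>\<rbrakk>
      \<Longrightarrow> \<exists>k::nat. h [^]\<^bsub>sections Y V\<^esub> k \<otimes>\<^bsub>sections Y V\<^esub> a = \<zero>\<^bsub>sections Y V\<^esub>"
    using kernel_locally_zero[OF V V0(1,2) g0(1,2) _ T1(1) xT1 T1(5)] g0(3) by blast
  \<comment> \<open>On \<open>T1\<close> the pullback of \<open>a0\<close> is \<open>g^n0 t\<close>,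
    so \<open>w\<close> pulls back to \<open>g^n0 (t g h)\<close>: up to a unit it is the element
    \<open>t'\<close> chosen next, and inverting one inverts the other.\<close>
  define w where "w = g \<otimes>\<^bsub>sections Y V\<^esub> (a0 \<otimes>\<^bsub>sections Y V\<^esub> h)"
  have w: "w \<in> carrier (sections Y V)" using g a0 h by (simp add: w_def)
  have yw: "?y \<in> basic_open Y V w"
    using Y.basic_open_mult[OF oV g(1) \<phi>.R.m_closed[OF a0(1) h(1)]] Y.basic_open_mult[OF oV a0(1) h(1)] g h ya0
    by (simp add: w_def)
  define t' where "t' = t1 \<otimes>\<^bsub>sections X U\<^esub> ?\<phi> h"
  have t': "t' \<in> carrier (sections X U)" using t1 h by (simp add: t'_def)
  define T where "T = basic_open X U t'"
  have Teq: "T = T1 \<inter> basic_open X U (?\<phi> h)"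
    using X.basic_open_mult[OF oU t1 \<phi>.hom_closed[OF h(1)]] by (simp add: T_def t'_def T1_def)
  have T: "openin (rtop X) T" "T \<subseteq> T1" "T \<subseteq> U" "T \<subseteq> preim X f V"
  proof -
    show "openin (rtop X) T" unfolding T_def by (rule openin_basic_open)
  qed (use Teq T1(2) T1V in auto)
  interpret k: ring_hom_cring "sections X U" "sections X T" "restr X U T" using X.restr_rhc[OF oU T(1,3)] .
  interpret \<psi>: ring_hom_cring "sections Y V" "sections X T" "induced_hom X f V T" using induced_rhc[OF oV T(1,4)] .
  interpret r: ring_hom_cring "sections X T1" "sections X T" "restr X T1 T" using X.restr_rhc[OF T1(1) T(1,2)] .
  let ?\<psi> = "induced_hom X f V T" and ?k = "restr X U T"
  have k\<phi>: "?k (?\<phi> a) = ?\<psi> a" if "a \<in> carrier (sections Y V)" for a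
    using induced_restr_right[OF oV oU T(1,3) UV that] .
  have rk: "restr X T1 T (?k1 b) = ?k b" if "b \<in> carrier (sections X U)" for b
    using X.restr_comp[OF oU T1(1) T(1,2) T1(2) that] .
  have r\<psi>: "restr X T1 T (?\<psi>1 a) = ?\<psi> a" if "a \<in> carrier (sections Y V)" for a
    using induced_restr_right[OF oV T1(1) T(1,2) T1V that] .
  \<comment> \<open>If \<open>a\<close> vanishes on \<open>T\<close>, a power of \<open>t'\<close>,
    which is \<open>t1\<close> times the pullback of \<open>h\<close>, kills it on \<open>U\<close>.
    On \<open>T1\<close> the factor \<open>t1\<close> is a unit, so some \<open>h^m a\<close>
    vanishes there and \<open>ker1\<close> supplies a further power of \<open>h\<close>.\<close>
  have ker: "\<exists>n::nat. w [^]\<^bsub>sections Y V\<^esub> n \<otimes>\<^bsub>sections Y V\<^esub> a = \<zero>\<^bsub>sections Y V\<^esub>"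
    if a: "a \<in> carrier (sections Y V)" "?\<psi> a = \<zero>\<^bsub>sections X T\<^esub>" for a
  proof -
    obtain m :: nat where m: "t' [^]\<^bsub>sections X U\<^esub> m \<otimes>\<^bsub>sections X U\<^esub> ?\<phi> a = \<zero>\<^bsub>sections X U\<^esub>"
      using X.affine_vanish[OF U t' \<phi>.hom_closed[OF a(1)]] k\<phi>[OF a(1)] a(2) unfolding T_def by metis
    have hm: "h [^]\<^bsub>sections Y V\<^esub> m \<in> carrier (sections Y V)" using h by simp
    have u1: "?k1 t1 \<in> Units (sections X T1)"
      using X.unit_on_basic_open[OF oU T1(1) _ t1] by (simp add: T1_def)
    have "?k1 t1 [^]\<^bsub>sections X T1\<^esub> m \<otimes>\<^bsub>sections X T1\<^esub> ?\<psi>1 (h [^]\<^bsub>sections Y V\<^esub> m \<otimes>\<^bsub>sections Y V\<^esub> a)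
      = ?k1 (t' [^]\<^bsub>sections X U\<^esub> m \<otimes>\<^bsub>sections X U\<^esub> ?\<phi> a)"
      unfolding t'_def using t1 h a k1\<phi>
      by (simp add: k1.ring.hom_nat_pow \<psi>1.ring.hom_nat_pow k1.S.nat_pow_distrib k1.S.m_assoc)
    also have "\<dots> = \<zero>\<^bsub>sections X T1\<^esub>" unfolding m by simp
    finally have "?\<psi>1 (h [^]\<^bsub>sections Y V\<^esub> m \<otimes>\<^bsub>sections Y V\<^esub> a) = \<zero>\<^bsub>sections X T1\<^esub>"
      using k1.S.unit_mult_zero[OF k1.S.Units_pow_closed[OF u1]] hm a by simp
    then obtain k :: nat where "h [^]\<^bsub>sections Y V\<^esub> k \<otimes>\<^bsub>sections Y V\<^esub> (h [^]\<^bsub>sections Y V\<^esub> m \<otimes>\<^bsub>sections Y V\<^esub> a) = \<zero>\<^bsub>sections Y V\<^esub>"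
      using ker1[OF \<phi>.R.m_closed[OF hm a(1)]] by blast
    then have hz: "h [^]\<^bsub>sections Y V\<^esub> (k + m) \<otimes>\<^bsub>sections Y V\<^esub> a = \<zero>\<^bsub>sections Y V\<^esub>"
      using h a by (simp add: \<phi>.R.m_assoc flip: \<phi>.R.nat_pow_mult)
    have "w [^]\<^bsub>sections Y V\<^esub> (k + m) = (g \<otimes>\<^bsub>sections Y V\<^esub> a0) [^]\<^bsub>sections Y V\<^esub> (k + m) \<otimes>\<^bsub>sections Y V\<^esub> h [^]\<^bsub>sections Y V\<^esub> (k + m)"
      unfolding w_def using g a0 h by (simp add: \<phi>.R.nat_pow_distrib \<phi>.R.m_assoc)
    then have "w [^]\<^bsub>sections Y V\<^esub> (k + m) \<otimes>\<^bsub>sections Y V\<^esub> a = \<zero>\<^bsub>sections Y V\<^esub>"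
      using hz g a0 h a by (simp add: \<phi>.R.m_assoc)
    then show ?thesis by blast
  qed
  \<comment> \<open>Write \<open>e = b / t'^m\<close> and \<open>b = a / g^n\<close>. Then
    \<open>w^m\<close> absorbs \<open>t'^m\<close> and \<open>w^n\<close> absorbs
    \<open>g^n\<close>, whence the exponent \<open>m + n\<close>.\<close>
  have frac: "\<exists>a\<in>carrier (sections Y V). \<exists>n::nat. e \<otimes>\<^bsub>sections X T\<^esub> ?\<psi> (w [^]\<^bsub>sections Y V\<^esub> n) = ?\<psi> a"
    if e: "e \<in> carrier (sections X T)" for e
  proof -
    obtain b and m :: nat where b: "b \<in> carrier (sections X U)"
      "?k b = ?k (t' [^]\<^bsub>sections X U\<^esub> m) \<otimes>\<^bsub>sections X T\<^esub> e"
      using X.affine_fraction[OF U t'] e unfolding T_def by metis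
    obtain a and n :: nat where a: "a \<in> carrier (sections Y V)"
      "?\<psi>1 (g [^]\<^bsub>sections Y V\<^esub> n) \<otimes>\<^bsub>sections X T1\<^esub> ?k1 b = ?\<psi>1 a" using frac1[OF b(1)] by blast
    have gc: "g [^]\<^bsub>sections Y V\<^esub> i \<in> carrier (sections Y V)" for i :: nat using g by simp
    have 1: "?\<psi> (g [^]\<^bsub>sections Y V\<^esub> n) \<otimes>\<^bsub>sections X T\<^esub> ?k b = ?\<psi> a"
      using arg_cong[OF a(2), of "restr X T1 T"] r.hom_mult[OF \<psi>1.hom_closed[OF gc] k1.hom_closed[OF b(1)]]
        r\<psi>[OF gc] r\<psi>[OF a(1)] rk[OF b(1)] by simp
    have 2: "?\<psi> (g [^]\<^bsub>sections Y V\<^esub> n0) \<otimes>\<^bsub>sections X T\<^esub> ?k t = ?\<psi> a0"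
      using arg_cong[OF a0(2), of "restr X T1 T"] r.hom_mult[OF \<psi>1.hom_closed[OF gc] k1.hom_closed[OF t(1)]]
        r\<psi>[OF gc] r\<psi>[OF a0(1)] rk[OF t(1)] by simp
    let ?E = "sections X T"
    have c: "?\<psi> g \<in> carrier ?E" "?\<psi> h \<in> carrier ?E" "?\<psi> a0 \<in> carrier ?E" "?k t \<in> carrier ?E" "?k t' \<in> carrier ?E"
      "?\<psi> (g [^]\<^bsub>sections Y V\<^esub> n0) \<in> carrier ?E" using g h a0 t t' gc by auto
    have kt': "?k t' = (?k t \<otimes>\<^bsub>?E\<^esub> ?\<psi> g) \<otimes>\<^bsub>?E\<^esub> ?\<psi> h"
      unfolding t'_def t1_def using t g h k\<phi> by simp
    have w1: "?\<psi> w = ?\<psi> (g [^]\<^bsub>sections Y V\<^esub> n0) \<otimes>\<^bsub>?E\<^esub> ?k t'"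
    proof -
      have "?\<psi> w = ?\<psi> g \<otimes>\<^bsub>?E\<^esub> ((?\<psi> (g [^]\<^bsub>sections Y V\<^esub> n0) \<otimes>\<^bsub>?E\<^esub> ?k t) \<otimes>\<^bsub>?E\<^esub> ?\<psi> h)"
        unfolding 2 w_def using g a0 h by simp
      also have "\<dots> = ?\<psi> (g [^]\<^bsub>sections Y V\<^esub> n0) \<otimes>\<^bsub>?E\<^esub> ?k t'" unfolding kt' using c by algebra
      finally show ?thesis .
    qed
    let ?P = "?\<psi> (g [^]\<^bsub>sections Y V\<^esub> n0) [^]\<^bsub>?E\<^esub> m" and ?Z = "?k t' [^]\<^bsub>?E\<^esub> m"
      and ?R = "?\<psi> (g [^]\<^bsub>sections Y V\<^esub> n)" and ?Q = "?\<psi> (a0 \<otimes>\<^bsub>sections Y V\<^esub> h) [^]\<^bsub>?E\<^esub> n"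
    have pc: "?P \<in> carrier ?E" "?Z \<in> carrier ?E" "?R \<in> carrier ?E" "?Q \<in> carrier ?E"
      using c gc a0 h by auto
    have wm: "?\<psi> w [^]\<^bsub>?E\<^esub> m = ?P \<otimes>\<^bsub>?E\<^esub> ?Z" unfolding w1 using c by (simp add: k.S.nat_pow_distrib)
    have wn: "?\<psi> w [^]\<^bsub>?E\<^esub> n = ?R \<otimes>\<^bsub>?E\<^esub> ?Q"
      unfolding w_def using g a0 h by (simp add: k.S.nat_pow_distrib \<psi>.ring.hom_nat_pow)
    have "e \<otimes>\<^bsub>?E\<^esub> ?\<psi> (w [^]\<^bsub>sections Y V\<^esub> (m + n)) = e \<otimes>\<^bsub>?E\<^esub> ((?P \<otimes>\<^bsub>?E\<^esub> ?Z) \<otimes>\<^bsub>?E\<^esub> (?R \<otimes>\<^bsub>?E\<^esub> ?Q))"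
      unfolding wm[symmetric] wn[symmetric]
      using w by (simp add: \<psi>.ring.hom_nat_pow k.S.nat_pow_mult)
    also have "\<dots> = (?P \<otimes>\<^bsub>?E\<^esub> ?Q) \<otimes>\<^bsub>?E\<^esub> (?R \<otimes>\<^bsub>?E\<^esub> (?Z \<otimes>\<^bsub>?E\<^esub> e))" using pc e by algebra
    also have "?Z \<otimes>\<^bsub>?E\<^esub> e = ?k b" unfolding b(2) using t' by (simp add: k.ring.hom_nat_pow)
    also have "?R \<otimes>\<^bsub>?E\<^esub> ?k b = ?\<psi> a" by (rule 1)
    also have "(?P \<otimes>\<^bsub>?E\<^esub> ?Q) \<otimes>\<^bsub>?E\<^esub> ?\<psi> a = ?\<psi> (((g [^]\<^bsub>sections Y V\<^esub> n0) [^]\<^bsub>sections Y V\<^esub> m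
        \<otimes>\<^bsub>sections Y V\<^esub> (a0 \<otimes>\<^bsub>sections Y V\<^esub> h) [^]\<^bsub>sections Y V\<^esub> n) \<otimes>\<^bsub>sections Y V\<^esub> a)"
      using gc[of n0] a0 h a \<psi>.ring.hom_nat_pow[OF gc] \<psi>.ring.hom_nat_pow[OF \<phi>.R.m_closed[OF a0(1) h(1)]] by simp
    finally show ?thesis
      using gc[of n0] a0 h a by blast
  qed
  have TT0: "T \<subseteq> T0" using T(2) T1(4) by blast
  show ?thesis
    by (rule that[OF V U UV t' _ w yw]) (use TT0 frac ker in \<open>auto simp: T_def\<close>)
qed

text \<open>A point \<open>z\<close> of \<open>D(w)\<close> is a prime of the ring of
  \<open>V\<close> missing \<open>w\<close>. By \<open>prime_lift\<close> it is the contraction of a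
  prime of the sections over the shrunken neighbourhood, and that prime comes from a point lying
  over \<open>z\<close>.\<close>

lemma image_open:
  assumes ft: "finite_type X Y f" and T0: "openin (rtop X) T0"
  shows "openin (rtop Y) (pt_map f ` T0)"
proof (subst openin_subopen, intro ballI)
  fix y assume "y \<in> pt_map f ` T0"
  then obtain x where x: "x \<in> T0" "y = pt_map f x" by blast
  obtain V U t w where V: "affine_open Y V" and U: "affine_open X U" and UV: "U \<subseteq> preim X f V"
    and t: "t \<in> carrier (sections X U)" "basic_open X U t \<subseteq> T0"
    and w: "w \<in> carrier (sections Y V)" "y \<in> basic_open Y V w"
    and frac: "\<And>e. e \<in> carrier (sections X (basic_open X U t)) \<Longrightarrow> \<exists>a\<in>carrier (sections Y V). \<exists>n::nat.
      e \<otimes>\<^bsub>sections X (basic_open X U t)\<^esub> induced_hom X f V (basic_open X U t) (w [^]\<^bsub>sections Y V\<^esub> n)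
        = induced_hom X f V (basic_open X U t) a"
    and ker: "\<And>a. \<lbrakk>a \<in> carrier (sections Y V);
        induced_hom X f V (basic_open X U t) a = \<zero>\<^bsub>sections X (basic_open X U t)\<^esub>\<rbrakk>
      \<Longrightarrow> \<exists>n::nat. w [^]\<^bsub>sections Y V\<^esub> n \<otimes>\<^bsub>sections Y V\<^esub> a = \<zero>\<^bsub>sections Y V\<^esub>"
    unfolding x(2) using localized_chart[OF ft T0 x(1)] by metis
  have oV: "openin (rtop Y) V" and oU: "openin (rtop X) U" using V U by (auto simp: affine_open_def)
  define T where "T = basic_open X U t"
  have T: "openin (rtop X) T" "T \<subseteq> U" unfolding T_def by (rule openin_basic_open basic_open_subset)+
  have TV: "T \<subseteq> preim X f V" using T UV by blast
  interpret k: ring_hom_cring "sections X U" "sections X T" "restr X U T" using X.restr_rhc[OF oU T] .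
  interpret \<psi>: ring_hom_cring "sections Y V" "sections X T" "induced_hom X f V T" using induced_rhc[OF oV T(1) TV] .
  interpret \<phi>: ring_hom_cring "sections Y V" "sections X U" "induced_hom X f V U" using induced_rhc[OF oV oU UV] .
  have "basic_open Y V w \<subseteq> pt_map f ` T0"
  proof
    fix z assume z: "z \<in> basic_open Y V w"
    have zV: "z \<in> V" using z basic_open_subset by (rule rev_subsetD)
    define P where "P = {s \<in> carrier (sections Y V). z \<notin> basic_open Y V s}"
    have P: "primeideal P (sections Y V)" unfolding P_def by (rule Y.affine_prime_of_point[OF V zV])
    have "w \<notin> P" using z by (simp add: P_def)
    then obtain Q where Q: "primeideal Q (sections X T)"
      "\<And>a. a \<in> carrier (sections Y V) \<Longrightarrow> induced_hom X f V T a \<in> Q \<longleftrightarrow> a \<in> P"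
      using \<psi>.prime_lift[OF P w(1)] frac ker unfolding T_def by metis
    interpret Q: primeideal Q "sections X T" using Q(1) .
    \<comment> \<open>The set \<open>T\<close> has not been shown to be affine, so \<open>Q\<close>
      is contracted to the affine set \<open>U\<close> to get a point; that \<open>t\<close> is a
      unit on \<open>T\<close> then places this point in \<open>T\<close>.\<close>
    obtain x' where x': "x' \<in> U"
      "\<And>s. s \<in> carrier (sections X U) \<Longrightarrow> s \<in> {s \<in> carrier (sections X U). restr X U T s \<in> Q} \<longleftrightarrow> x' \<notin> basic_open X U s"
      by (rule X.affine_point_of_prime[OF U k.primeideal_vimage[OF Q(1)]]) (rule that)
    have "restr X U T t \<notin> Q"
    proof
      assume tQ: "restr X U T t \<in> Q"
      have "restr X U T t \<in> Units (sections X T)"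
        using X.unit_on_basic_open[OF oU T(1) _ t(1)] by (simp add: T_def)
      then obtain s where "s \<in> carrier (sections X T)" "s \<otimes>\<^bsub>sections X T\<^esub> restr X U T t = \<one>\<^bsub>sections X T\<^esub>"
        by (auto simp: Units_def)
      then have "\<one>\<^bsub>sections X T\<^esub> \<in> Q" using Q.I_l_closed[OF tQ] by metis
      then show False using Q.one_imp_carrier Q.I_notcarr by simp
    qed
    then have x'T: "x' \<in> T" using x'(2)[OF t(1)] by (simp add: T_def)
    \<comment> \<open>Both points of the affine set \<open>V\<close> have the same nonvanishing
      sections, as \<open>Q\<close> contracts to the prime \<open>P\<close> of
      \<open>z\<close>.\<close>
    have "pt_map f x' = z"
    proof (rule Y.affine_points_separated[OF V _ zV])
      show "pt_map f x' \<in> V" using x' UV by (auto simp: preim_def)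
      fix a assume a: "a \<in> carrier (sections Y V)"
      have "pt_map f x' \<in> basic_open Y V a \<longleftrightarrow> induced_hom X f V T a \<notin> Q"
        using mem_basic_open_induced[OF oV oU UV a x'(1)] x'(2)[OF \<phi>.hom_closed[OF a]] \<phi>.hom_closed[OF a]
          induced_restr_right[OF oV oU T UV a] by auto
      then show "pt_map f x' \<in> basic_open Y V a \<longleftrightarrow> z \<in> basic_open Y V a"
        using Q(2)[OF a] a by (simp add: P_def)
    qed
    then show "z \<in> pt_map f ` T0" using x'T t(2) by (auto simp: T_def)
  qed
  then show "\<exists>T. openin (rtop Y) T \<and> y \<in> T \<and> T \<subseteq> pt_map f ` T0"
    using w(2) openin_basic_open by (intro exI[of _ "basic_open Y V w"]) simp
qed

end

section \<open>Isomorphisms\<close>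

text \<open>Ideals correspond under the isomorphism and its inverse, so maximality transfers. The
  ring axioms of \<open>S\<close> come with each of its maximal ideals \<open>m\<close>.\<close>

lemma local_hom_ring_iso:
  assumes h: "h \<in> ring_iso R S" and R: "ring R"
  shows "local_hom R S h"
proof -
  interpret R: ring R by fact
  have hom: "h \<in> ring_hom R S" and bij: "bij_betw h (carrier R) (carrier S)" using h by (auto simp: ring_iso_def)
  define g where "g = inv_into (carrier R) h"
  have g: "g \<in> ring_hom S R" using ring_iso_set_sym[OF R h] by (simp add: ring_iso_def g_def)
  have gh: "g (h a) = a" if "a \<in> carrier R" for a
    using bij_betw_imp_inj_on[OF bij] that by (simp add: g_def)
  have hg: "h (g b) = b" if "b \<in> carrier S" for b
    using bij_betw_imp_surj_on[OF bij] that by (simp add: g_def f_inv_into_f)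
  have "maximalideal {a \<in> carrier R. h a \<in> m} R" if m: "maximalideal m S" for m
  proof -
    interpret m: maximalideal m S using m .
    interpret h: ring_hom_ring R S h by (rule ring_hom_ringI2[OF R m.ring_axioms hom])
    interpret g: ring_hom_ring S R g by (rule ring_hom_ringI2[OF m.ring_axioms R g])
    show ?thesis
    proof (rule maximalidealI)
      show "ideal {a \<in> carrier R. h a \<in> m} R" using h.ideal_vimage[OF m.is_ideal] .
      have "\<one>\<^bsub>S\<^esub> \<notin> m" using m.one_imp_carrier m.I_notcarr by blast
      then have "\<one>\<^bsub>R\<^esub> \<notin> {a \<in> carrier R. h a \<in> m}" by simp
      then show "carrier R \<noteq> {a \<in> carrier R. h a \<in> m}" using R.one_closed by blast
      fix J assume J: "ideal J R" "{a \<in> carrier R. h a \<in> m} \<subseteq> J" "J \<subseteq> carrier R"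
      have "m \<subseteq> {b \<in> carrier S. g b \<in> J}"
        using J(2) hg m.a_subset ring_hom_closed[OF g] by (auto simp: subset_iff)
      then have "{b \<in> carrier S. g b \<in> J} = m \<or> {b \<in> carrier S. g b \<in> J} = carrier S"
        using m.I_maximal[OF g.ideal_vimage[OF J(1)]] by blast
      then show "J = {a \<in> carrier R. h a \<in> m} \<or> J = carrier R"
      proof
        assume *: "{b \<in> carrier S. g b \<in> J} = m"
        have "J \<subseteq> {a \<in> carrier R. h a \<in> m}"
          unfolding *[symmetric] using J(3) gh ring_hom_closed[OF hom] by (auto simp: subset_iff)
        then show ?thesis using J(2) by blast
      next
        assume *: "{b \<in> carrier S. g b \<in> J} = carrier S"
        have "a \<in> J" if "a \<in> carrier R" for a
        proof -
          have "h a \<in> {b \<in> carrier S. g b \<in> J}" unfolding * using ring_hom_closed[OF hom that] .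
          then show ?thesis using gh[OF that] by simp
        qed
        then show ?thesis using J(3) by blast
      qed
    qed
  qed
  then show ?thesis using hom by (simp add: local_hom_def)
qed

section \<open>Stalks and inverses of homeomorphisms with isomorphic sections\<close>

context ringed_space
begin

lemma stalk_common:
  assumes "p \<in> carrier (stalk X x)" "q \<in> carrier (stalk X x)"
  obtains U s t where "openin (rtop X) U" "x \<in> U" "s \<in> carrier (sections X U)" "t \<in> carrier (sections X U)"
    "p = germ X x U s" "q = germ X x U t"
proof -
  obtain U s where U: "openin (rtop X) U" "x \<in> U" "s \<in> carrier (sections X U)" "p = germ X x U s"
    using assms(1) by (rule stalk_carrierE)
  obtain V t where V: "openin (rtop X) V" "x \<in> V" "t \<in> carrier (sections X V)" "q = germ X x V t"
    using assms(2) by (rule stalk_carrierE)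
  have o: "openin (rtop X) (U \<inter> V)" and xUV: "x \<in> U \<inter> V" using U V by auto
  show ?thesis
  proof (rule that[OF o xUV])
    show "restr X U (U \<inter> V) s \<in> carrier (sections X (U \<inter> V))" using restr_closed[OF U(1) o _ U(3)] by simp
    show "restr X V (U \<inter> V) t \<in> carrier (sections X (U \<inter> V))" using restr_closed[OF V(1) o _ V(3)] by simp
    show "p = germ X x (U \<inter> V) (restr X U (U \<inter> V) s)" using germ_restr[OF U(1) o _ xUV U(3)] U(4) by simp
    show "q = germ X x (U \<inter> V) (restr X V (U \<inter> V) t)" using germ_restr[OF V(1) o _ xUV V(3)] V(4) by simp
  qed
qed

lemma stalk_ops:
  assumes "openin (rtop X) U" "x \<in> U" "s \<in> carrier (sections X U)" "t \<in> carrier (sections X U)"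
  shows "germ X x U s \<otimes>\<^bsub>stalk X x\<^esub> germ X x U t = germ X x U (s \<otimes>\<^bsub>sections X U\<^esub> t)"
    and "germ X x U s \<oplus>\<^bsub>stalk X x\<^esub> germ X x U t = germ X x U (s \<oplus>\<^bsub>sections X U\<^esub> t)"
  using stalk_mult[OF assms(1-3,1,2,4)] stalk_add[OF assms(1-3,1,2,4)] restr_id[OF assms(1)] assms(3,4) by simp_all

end

text \<open>By \<open>nbhd\<close> every neighbourhood of \<open>x\<close> is a preimage, so a germ
  at \<open>x\<close>, or an equality of germs there, is visible over an open set of
  \<open>Y\<close>, where \<open>sec_map f\<close> is bijective. The value at zero is recorded
  separately: \<open>ring_iso\<close> does not mention zero, and the stalks are not yet known to be
  rings on both sides.\<close>

lemma stalk_map_ring_iso: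
  assumes X: "ringed_space X" and Y: "ringed_space Y"
    and cont: "\<And>V. openin (rtop Y) V \<Longrightarrow> openin (rtop X) (preim X f V)"
    and nbhd: "\<And>N. openin (rtop X) N \<Longrightarrow> \<exists>W. openin (rtop Y) W \<and> N = preim X f W"
    and iso: "\<And>V. openin (rtop Y) V \<Longrightarrow> sec_map f V \<in> ring_iso (sections Y V) (sections X (preim X f V))"
    and nat: "\<And>V W t. \<lbrakk>openin (rtop Y) V; openin (rtop Y) W; W \<subseteq> V; t \<in> carrier (sections Y V)\<rbrakk>
      \<Longrightarrow> sec_map f W (restr Y V W t) = restr X (preim X f V) (preim X f W) (sec_map f V t)"
    and x: "x \<in> points X" and y: "pt_map f x \<in> points Y"
  shows "stalk_map X f x \<in> ring_iso (stalk Y (pt_map f x)) (stalk X x)"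
    and "stalk_map X f x \<zero>\<^bsub>stalk Y (pt_map f x)\<^esub> = \<zero>\<^bsub>stalk X x\<^esub>"
proof -
  interpret X: ringed_space X by fact
  interpret Y: ringed_space Y by fact
  let ?y = "pt_map f x" and ?h = "stalk_map X f x"
  have hom: "sec_map f V \<in> ring_hom (sections Y V) (sections X (preim X f V))" if "openin (rtop Y) V" for V
    using iso[OF that] by (simp add: ring_iso_def)
  have val: "?h (germ Y ?y V t) = germ X x (preim X f V) (sec_map f V t)"
    if "openin (rtop Y) V" "?y \<in> V" "t \<in> carrier (sections Y V)" for V t
    by (rule stalk_map_germ[OF X Y cont hom nat x that])
  have xV: "x \<in> preim X f V" if "?y \<in> V" for V using that x by (simp add: preim_def)
  have ytop: "openin (rtop Y) (points Y)" by simp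
  have one: "?h \<one>\<^bsub>stalk Y ?y\<^esub> = \<one>\<^bsub>stalk X x\<^esub>"
  proof -
    interpret c: cring "sections Y (points Y)" using Y.cring_sections[OF ytop] .
    show ?thesis
      using val[OF ytop y c.one_closed] ring_hom_one[OF hom[OF ytop]] X.germ_one[OF cont[OF ytop] xV[OF y]]
      by (simp add: Y.stalk_one)
  qed
  show "?h \<zero>\<^bsub>stalk Y ?y\<^esub> = \<zero>\<^bsub>stalk X x\<^esub>"
  proof -
    interpret c: cring "sections Y (points Y)" using Y.cring_sections[OF ytop] .
    interpret d: cring "sections X (preim X f (points Y))" using X.cring_sections[OF cont[OF ytop]] .
    show ?thesis
      using val[OF ytop y c.zero_closed] ring_hom_zero[OF hom[OF ytop] c.ring_axioms d.ring_axioms]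
        X.germ_zero[OF cont[OF ytop] xV[OF y]]
      by (simp add: Y.stalk_zero)
  qed
  show "?h \<in> ring_iso (stalk Y ?y) (stalk X x)"
  proof (rule ring_iso_memI)
    show closed: "?h p \<in> carrier (stalk X x)" if p: "p \<in> carrier (stalk Y ?y)" for p
    proof -
      obtain V s where V: "openin (rtop Y) V" "?y \<in> V" "s \<in> carrier (sections Y V)" "p = germ Y ?y V s"
        using p by (rule Y.stalk_carrierE)
      show ?thesis unfolding V(4) val[OF V(1-3)]
        by (rule X.stalk_carrierI[OF cont[OF V(1)] xV[OF V(2)] ring_hom_closed[OF hom[OF V(1)] V(3)]])
    qed
    fix p q assume pq: "p \<in> carrier (stalk Y ?y)" "q \<in> carrier (stalk Y ?y)"
    obtain V s t where V: "openin (rtop Y) V" "?y \<in> V" and st: "s \<in> carrier (sections Y V)" "t \<in> carrier (sections Y V)"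
      and p: "p = germ Y ?y V s" and q: "q = germ Y ?y V t"
      using pq by (rule Y.stalk_common)
    interpret c: cring "sections Y V" using Y.cring_sections[OF V(1)] .
    note cl = ring_hom_closed[OF hom[OF V(1)] st(1)] ring_hom_closed[OF hom[OF V(1)] st(2)]
    show "?h (p \<otimes>\<^bsub>stalk Y ?y\<^esub> q) = ?h p \<otimes>\<^bsub>stalk X x\<^esub> ?h q"
      using val[OF V st(1)] val[OF V st(2)] val[OF V c.m_closed[OF st]] ring_hom_mult[OF hom[OF V(1)] st]
        X.stalk_ops(1)[OF cont[OF V(1)] xV[OF V(2)] cl] Y.stalk_ops(1)[OF V st] by (simp add: p q)
    show "?h (p \<oplus>\<^bsub>stalk Y ?y\<^esub> q) = ?h p \<oplus>\<^bsub>stalk X x\<^esub> ?h q"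
      using val[OF V st(1)] val[OF V st(2)] val[OF V c.a_closed[OF st]] ring_hom_add[OF hom[OF V(1)] st]
        X.stalk_ops(2)[OF cont[OF V(1)] xV[OF V(2)] cl] Y.stalk_ops(2)[OF V st] by (simp add: p q)
  next
    show "?h \<one>\<^bsub>stalk Y ?y\<^esub> = \<one>\<^bsub>stalk X x\<^esub>" by (rule one)
    show "bij_betw ?h (carrier (stalk Y ?y)) (carrier (stalk X x))"
    proof (rule bij_betw_imageI[OF inj_onI subset_antisym[OF subsetI subsetI]])
      fix p q assume pq: "p \<in> carrier (stalk Y ?y)" "q \<in> carrier (stalk Y ?y)" and eq: "?h p = ?h q"
      obtain V s t where V: "openin (rtop Y) V" "?y \<in> V" and st: "s \<in> carrier (sections Y V)" "t \<in> carrier (sections Y V)"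
        and p: "p = germ Y ?y V s" and q: "q = germ Y ?y V t"
        using pq by (rule Y.stalk_common)
      have "germ X x (preim X f V) (sec_map f V s) = germ X x (preim X f V) (sec_map f V t)"
        using eq val[OF V st(1)] val[OF V st(2)] by (simp add: p q)
      then obtain N where N: "openin (rtop X) N" "x \<in> N" "N \<subseteq> preim X f V"
        "restr X (preim X f V) N (sec_map f V s) = restr X (preim X f V) N (sec_map f V t)"
        using X.germ_eqD[OF cont[OF V(1)] xV[OF V(2)] ring_hom_closed[OF hom[OF V(1)] st(2)]] by metis
      obtain W where W: "openin (rtop Y) W" "N = preim X f W" using nbhd[OF N(1)] by blast
      \<comment> \<open>The sections agree on \<open>N\<close>, the preimage of \<open>Z\<close>;
        injectivity of \<open>sec_map f Z\<close> moves the agreement to \<open>Z\<close>.\<close>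
      define Z where "Z = V \<inter> W"
      have Z: "openin (rtop Y) Z" "Z \<subseteq> V" "?y \<in> Z" using V W N(2) by (auto simp: Z_def preim_def)
      have NZ: "preim X f Z = N" using N(3) W(2) by (auto simp: Z_def preim_def)
      have "sec_map f Z (restr Y V Z s) = sec_map f Z (restr Y V Z t)"
        using nat[OF V(1) Z(1,2) st(1)] nat[OF V(1) Z(1,2) st(2)] N(4) NZ by simp
      then have "restr Y V Z s = restr Y V Z t"
        using bij_betw_imp_inj_on[OF ring_iso_memE(5)[OF iso[OF Z(1)]]]
          Y.restr_closed[OF V(1) Z(1,2) st(1)] Y.restr_closed[OF V(1) Z(1,2) st(2)] by (auto dest: inj_onD)
      then show "p = q"
        using Y.germ_restr[OF V(1) Z st(1)] Y.germ_restr[OF V(1) Z st(2)] by (simp add: p q)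
    next
      fix q assume "q \<in> ?h ` carrier (stalk Y ?y)"
      then obtain p where p: "p \<in> carrier (stalk Y ?y)" "q = ?h p" by (rule imageE)
      obtain V s where V: "openin (rtop Y) V" "?y \<in> V" "s \<in> carrier (sections Y V)" "p = germ Y ?y V s"
        using p(1) by (rule Y.stalk_carrierE)
      show "q \<in> carrier (stalk X x)" unfolding p(2) V(4) val[OF V(1-3)]
        by (rule X.stalk_carrierI[OF cont[OF V(1)] xV[OF V(2)] ring_hom_closed[OF hom[OF V(1)] V(3)]])
    next
      fix q assume "q \<in> carrier (stalk X x)"
      then obtain N s where N: "openin (rtop X) N" "x \<in> N" "s \<in> carrier (sections X N)" "q = germ X x N s"
        by (rule X.stalk_carrierE)
      obtain W where W: "openin (rtop Y) W" "N = preim X f W" using nbhd[OF N(1)] by blast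
      have "s \<in> sec_map f W ` carrier (sections Y W)"
        using bij_betw_imp_surj_on[OF ring_iso_memE(5)[OF iso[OF W(1)]]] N(3) W(2) by simp
      then obtain t where t: "t \<in> carrier (sections Y W)" "s = sec_map f W t" by (rule imageE)
      have yW: "?y \<in> W" using N(2) W(2) by (simp add: preim_def)
      have "q = ?h (germ Y ?y W t)" using val[OF W(1) yW t(1)] N(4) W(2) t(2) by simp
      then show "q \<in> ?h ` carrier (stalk Y ?y)" using Y.stalk_carrierI[OF W(1) yW t(1)] by blast
    qed
  qed
qed

text \<open>Points and sections are inverted separately. The stalks of \<open>Y\<close> are
  isomorphic to those of \<open>X\<close>, from which they inherit the ring axioms, and isomorphisms
  of rings are local; so \<open>Y\<close> enters only as a ringed space, which is easy to check for
  an open subspace.\<close>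

lemma lrs_iso_of_homeomorphism:
  assumes X: "locally_ringed_space X" and Y: "ringed_space Y"
    and bij: "bij_betw (pt_map f) (points X) (points Y)"
    and cont: "\<And>V. openin (rtop Y) V \<Longrightarrow> openin (rtop X) (preim X f V)"
    and opn: "\<And>N. openin (rtop X) N \<Longrightarrow> openin (rtop Y) (pt_map f ` N)"
    and iso: "\<And>V. openin (rtop Y) V \<Longrightarrow> sec_map f V \<in> ring_iso (sections Y V) (sections X (preim X f V))"
    and nat: "\<And>V W t. \<lbrakk>openin (rtop Y) V; openin (rtop Y) W; W \<subseteq> V; t \<in> carrier (sections Y V)\<rbrakk>
      \<Longrightarrow> sec_map f W (restr Y V W t) = restr X (preim X f V) (preim X f W) (sec_map f V t)"
  shows "lrs_iso X Y f"
proof -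
  interpret X: locally_ringed_space X by fact
  interpret Y: ringed_space Y by fact
  note XR = X.ringed_space_axioms
  \<comment> \<open>The preimage of \<open>N\<close> under the inverse map is
    \<open>pt_map f\<close> applied to \<open>N\<close>, so the sections over \<open>N\<close> are
    sent back by inverting \<open>sec_map f\<close> over that image.\<close>
  define g where "g = \<lparr> pt_map = inv_into (points X) (pt_map f),
    sec_map = (\<lambda>N. inv_into (carrier (sections Y (pt_map f ` N))) (sec_map f (pt_map f ` N))) \<rparr>"
  have fp: "pt_map f x \<in> points Y" if "x \<in> points X" for x using bij_betwE[OF bij] that by blast
  have gp: "pt_map g y \<in> points X" "pt_map f (pt_map g y) = y" if "y \<in> points Y" for y
    using bij_betw_imp_surj_on[OF bij] that by (auto simp: g_def inv_into_into f_inv_into_f)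
  have gf: "pt_map g (pt_map f x) = x" if "x \<in> points X" for x
    using bij_betw_imp_inj_on[OF bij] that by (simp add: g_def)
  have preim_g: "preim Y g N = pt_map f ` N" if "openin (rtop X) N" for N
  proof -
    have "N \<subseteq> points X" using openin_subset[OF that] .
    then show ?thesis using gp gf fp by (force simp: preim_def)
  qed
  have preim_f: "preim X f (pt_map f ` N) = N" if "openin (rtop X) N" for N
    using openin_subset[OF that] bij_betw_imp_inj_on[OF bij] by (auto simp: preim_def dest: inj_onD)
  have image_preim: "pt_map f ` preim X f W = W" if "openin (rtop Y) W" for W
    using openin_subset[OF that] bij_betw_imp_surj_on[OF bij] by (auto simp: preim_def)
  have f_nbhd: "\<exists>W. openin (rtop Y) W \<and> N = preim X f W" if "openin (rtop X) N" for N
    using opn[OF that] preim_f[OF that] by metis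
  have g_cont: "openin (rtop Y) (preim Y g N)" if "openin (rtop X) N" for N
    using opn[OF that] preim_g[OF that] by simp
  have g_nbhd: "\<exists>N. openin (rtop X) N \<and> W = preim Y g N" if "openin (rtop Y) W" for W
    using cont[OF that] preim_g[OF cont[OF that]] image_preim[OF that] by metis
  have hom: "sec_map f V \<in> ring_hom (sections Y V) (sections X (preim X f V))" if "openin (rtop Y) V" for V
    using iso[OF that] by (simp add: ring_iso_def)
  have inj: "inj_on (sec_map f V) (carrier (sections Y V))"
    and surj: "sec_map f V ` carrier (sections Y V) = carrier (sections X (preim X f V))" if "openin (rtop Y) V" for V
    using ring_iso_memE(5)[OF iso[OF that]] by (auto simp: bij_betw_def)
  have g_iso: "sec_map g N \<in> ring_iso (sections X N) (sections Y (preim Y g N))" if N: "openin (rtop X) N" for N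
    using ring_iso_set_sym[OF cring.axioms(1)[OF Y.cring_sections[OF opn[OF N]]] iso[OF opn[OF N]]]
    unfolding preim_g[OF N] preim_f[OF N] by (simp add: g_def)
  have fg_sec: "sec_map f (pt_map f ` N) (sec_map g N t) = t" if "openin (rtop X) N" "t \<in> carrier (sections X N)" for N t
    using surj[OF opn[OF that(1)]] that preim_f[OF that(1)] by (simp add: g_def f_inv_into_f)
  have g_nat: "sec_map g N' (restr X N N' t) = restr Y (preim Y g N) (preim Y g N') (sec_map g N t)"
    if N: "openin (rtop X) N" "openin (rtop X) N'" "N' \<subseteq> N" "t \<in> carrier (sections X N)" for N N' t
  proof -
    have s: "sec_map g N t \<in> carrier (sections Y (pt_map f ` N))"
      using ring_iso_memE(1)[OF g_iso[OF N(1)] N(4)] preim_g[OF N(1)] by simp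
    have sub: "pt_map f ` N' \<subseteq> pt_map f ` N" using N(3) by blast
    have "sec_map f (pt_map f ` N') (restr Y (pt_map f ` N) (pt_map f ` N') (sec_map g N t)) = restr X N N' t"
      using nat[OF opn[OF N(1)] opn[OF N(2)] sub s] fg_sec[OF N(1,4)] preim_f N by simp
    then show ?thesis
      using inv_into_f_f[OF inj[OF opn[OF N(2)]] Y.restr_closed[OF opn[OF N(1)] opn[OF N(2)] sub s]]
      unfolding preim_g[OF N(1)] preim_g[OF N(2)] by (simp add: g_def)
  qed
  have st_f: "stalk_map X f x \<in> ring_iso (stalk Y (pt_map f x)) (stalk X x)" if "x \<in> points X" for x
    by (rule stalk_map_ring_iso(1)[OF XR Y cont f_nbhd iso nat that fp[OF that]])
  have st_g: "stalk_map Y g y \<in> ring_iso (stalk X (pt_map g y)) (stalk Y y)" if "y \<in> points Y" for y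
    by (rule stalk_map_ring_iso(1)[OF Y XR g_cont g_nbhd g_iso g_nat that gp(1)[OF that]])
  have st_g0: "stalk_map Y g y \<zero>\<^bsub>stalk X (pt_map g y)\<^esub> = \<zero>\<^bsub>stalk Y y\<^esub>" if "y \<in> points Y" for y
    by (rule stalk_map_ring_iso(2)[OF Y XR g_cont g_nbhd g_iso g_nat that gp(1)[OF that]])
  have stX: "cring (stalk X x)" if "x \<in> points X" for x using X.local_stalk[OF that] by (simp add: local_ring_def)
  \<comment> \<open>Transport along an isomorphism makes the target a ring with the image of zero as
    its zero; \<open>st_g0\<close> identifies that image with the zero of the stalk.\<close>
  have stY: "cring (stalk Y y)" if y: "y \<in> points Y" for y
    using cring.ring_iso_imp_img_cring[OF stX[OF gp(1)[OF y]] st_g[OF y]] unfolding st_g0[OF y] by simp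
  have "lrs_morphism X Y f"
  proof
    show "continuous_map (rtop X) (rtop Y) (pt_map f)"
      using fp cont by (auto simp: continuous_map_def preim_def)
    show "local_hom (stalk Y (pt_map f x)) (stalk X x) (stalk_map X f x)" if "x \<in> points X" for x
      by (rule local_hom_ring_iso[OF st_f[OF that] cring.axioms(1)[OF stY[OF fp[OF that]]]])
  qed (fact hom nat)+
  moreover have "lrs_morphism Y X g"
  proof
    show "continuous_map (rtop Y) (rtop X) (pt_map g)"
      using gp g_cont by (auto simp: continuous_map_def preim_def)
    show "local_hom (stalk X (pt_map g y)) (stalk Y y) (stalk_map Y g y)" if "y \<in> points Y" for y
      by (rule local_hom_ring_iso[OF st_g[OF that] cring.axioms(1)[OF stX[OF gp(1)[OF that]]]])
    show "sec_map g N \<in> ring_hom (sections X N) (sections Y (preim Y g N))" if "openin (rtop X) N" for N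
      using g_iso[OF that] by (simp add: ring_iso_def)
  qed (fact g_nat)
  moreover have "rs_eq X X (rs_comp Y g f) rs_id"
    using gf fg_sec preim_g by (simp add: rs_eq_def rs_comp_def rs_id_def)
  moreover have "sec_map g (preim X f W) (sec_map f W t) = t"
    if "openin (rtop Y) W" "t \<in> carrier (sections Y W)" for W t
    using image_preim[OF that(1)] inv_into_f_f[OF inj[OF that(1)] that(2)] by (simp add: g_def)
  then have "rs_eq Y Y (rs_comp X f g) rs_id"
    using gp by (simp add: rs_eq_def rs_comp_def rs_id_def)
  ultimately show ?thesis unfolding lrs_iso_def by blast
qed

lemma ringed_space_open_subspace:
  assumes X: "ringed_space X" and U: "openin (rtop X) U"
  shows "ringed_space (open_subspace X U)"
proof -
  interpret ringed_space X by fact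
  have o: "openin (rtop X) V" if "openin (rtop (open_subspace X U)) V" for V
    using that openin_open_subspace[OF U] by blast
  show ?thesis
  proof (rule ringed_space.intro)
    fix \<U> s t assume *: "\<And>V. V \<in> \<U> \<Longrightarrow> openin (rtop (open_subspace X U)) V"
      "s \<in> carrier (sections (open_subspace X U) (\<Union>\<U>))" "t \<in> carrier (sections (open_subspace X U) (\<Union>\<U>))"
      "\<And>V. V \<in> \<U> \<Longrightarrow> restr (open_subspace X U) (\<Union>\<U>) V s = restr (open_subspace X U) (\<Union>\<U>) V t"
    show "s = t" by (rule locality[of \<U>]) (use * o in simp_all)
  next
    fix \<U> \<sigma> assume *: "\<And>V. V \<in> \<U> \<Longrightarrow> openin (rtop (open_subspace X U)) V"
      "\<And>V. V \<in> \<U> \<Longrightarrow> \<sigma> V \<in> carrier (sections (open_subspace X U) V)"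
      "\<And>V W. \<lbrakk>V \<in> \<U>; W \<in> \<U>\<rbrakk> \<Longrightarrow> restr (open_subspace X U) V (V \<inter> W) (\<sigma> V) = restr (open_subspace X U) W (V \<inter> W) (\<sigma> W)"
    have "\<exists>s\<in>carrier (sections X (\<Union>\<U>)). \<forall>V\<in>\<U>. restr X (\<Union>\<U>) V s = \<sigma> V"
      by (rule gluing) (use * o in simp_all)
    then show "\<exists>s\<in>carrier (sections (open_subspace X U) (\<Union>\<U>)). \<forall>V\<in>\<U>. restr (open_subspace X U) (\<Union>\<U>) V s = \<sigma> V"
      by simp
  qed (use o cring_sections restr_hom restr_id restr_comp in simp_all)
qed

section \<open>Sections over open subsets of the image of an injective map\<close>

context localizing_immersion
begin

lemma preim_image:
  assumes "openin (rtop X) N" shows "preim X f (pt_map f ` N) = N"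
  using openin_subset[OF assms] injective by (auto simp: preim_def dest: inj_onD)

text \<open>Every point of \<open>W\<close> is some \<open>pt_map f x\<close>, so
  \<open>vanishing_descends\<close> makes the difference of two sections with equal pullbacks vanish
  near each point of \<open>W\<close>.\<close>

lemma sec_map_inj:
  assumes W: "openin (rtop Y) W" "W \<subseteq> pt_map f ` points X"
  shows "inj_on (sec_map f W) (carrier (sections Y W))"
proof (rule inj_onI)
  fix s t assume st: "s \<in> carrier (sections Y W)" "t \<in> carrier (sections Y W)" and eq: "sec_map f W s = sec_map f W t"
  have oW: "openin (rtop X) (preim X f W)" using open_preim[OF W(1)] .
  interpret h: ring_hom_cring "sections Y W" "sections X (preim X f W)" "induced_hom X f W (preim X f W)"
    using induced_rhc[OF W(1) oW subset_refl] .
  let ?d = "s \<ominus>\<^bsub>sections Y W\<^esub> t"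
  have "induced_hom X f W (preim X f W) s = induced_hom X f W (preim X f W) t" using eq by (simp add: induced_hom_def)
  then have dz: "induced_hom X f W (preim X f W) ?d = \<zero>\<^bsub>sections X (preim X f W)\<^esub>"
    using st by (simp add: a_minus_def h.S.r_neg)
  show "s = t"
  proof (rule Y.section_eqI[OF W(1) st])
    fix y assume y: "y \<in> W"
    then obtain x where x: "x \<in> points X" "y = pt_map f x" using W(2) by blast
    have "x \<in> preim X f W" using x y by (simp add: preim_def)
    then obtain M where M: "openin (rtop Y) M" "y \<in> M" "M \<subseteq> W" "restr Y W M ?d = \<zero>\<^bsub>sections Y M\<^esub>"
      using vanishing_descends[OF W(1) h.R.minus_closed[OF st] oW _ subset_refl dz] x(2) by blast
    interpret r: ring_hom_cring "sections Y W" "sections Y M" "restr Y W M" using Y.restr_rhc[OF W(1) M(1,3)] .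
    have c: "restr Y W M s \<in> carrier (sections Y M)" "restr Y W M t \<in> carrier (sections Y M)" using st by auto
    have "restr Y W M s \<ominus>\<^bsub>sections Y M\<^esub> restr Y W M t = \<zero>\<^bsub>sections Y M\<^esub>"
      using M(4) st by (simp add: a_minus_def)
    then have "restr Y W M s = restr Y W M t" using c r.S.r_right_minus_eq by blast
    then show "\<exists>M. openin (rtop Y) M \<and> y \<in> M \<and> M \<subseteq> W \<and> restr Y W M s = restr Y W M t" using M by blast
  qed
qed

text \<open>Germs descend by \<open>section_descends\<close>; openness and injectivity of
  \<open>f\<close> turn a descended germ into a section pulling back to \<open>\<sigma>\<close> on a
  whole preimage. By \<open>sec_map_inj\<close> these local solutions agree on overlaps, so they
  glue.\<close>

lemma sec_map_surj:
  assumes ft: "finite_type X Y f" and W: "openin (rtop Y) W" "W \<subseteq> pt_map f ` points X"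
    and \<sigma>: "\<sigma> \<in> carrier (sections X (preim X f W))"
  shows "\<exists>\<tau>\<in>carrier (sections Y W). sec_map f W \<tau> = \<sigma>"
proof -
  have oW: "openin (rtop X) (preim X f W)" using open_preim[OF W(1)] .
  \<comment> \<open>All open subsets of \<open>W\<close> over which the pullback equation can be
    solved; they are shown to cover \<open>W\<close>.\<close>
  define \<U> where "\<U> = {M. openin (rtop Y) M \<and> M \<subseteq> W \<and>
    (\<exists>\<tau>\<in>carrier (sections Y M). sec_map f M \<tau> = restr X (preim X f W) (preim X f M) \<sigma>)}"
  have \<U>D: "openin (rtop Y) M" "M \<subseteq> W" "preim X f M \<subseteq> preim X f W" if "M \<in> \<U>" for M
    using that by (auto simp: \<U>_def preim_def)
  obtain \<tau> where \<tau>: "\<And>M. M \<in> \<U> \<Longrightarrow> \<tau> M \<in> carrier (sections Y M)"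
    "\<And>M. M \<in> \<U> \<Longrightarrow> sec_map f M (\<tau> M) = restr X (preim X f W) (preim X f M) \<sigma>"
  proof -
    have "\<forall>M\<in>\<U>. \<exists>\<tau>. \<tau> \<in> carrier (sections Y M) \<and> sec_map f M \<tau> = restr X (preim X f W) (preim X f M) \<sigma>"
      by (auto simp: \<U>_def)
    from bchoice[OF this] show ?thesis using that by blast
  qed
  have cov: "\<Union>\<U> = W"
  proof (intro equalityI subsetI)
    fix y assume y: "y \<in> W"
    then obtain x where x: "x \<in> points X" "y = pt_map f x" using W(2) by blast
    have xW: "x \<in> preim X f W" using x y by (simp add: preim_def)
    obtain N \<tau> Z where N: "openin (rtop Y) N" "pt_map f x \<in> N" "\<tau> \<in> carrier (sections Y N)"
      and Z: "openin (rtop X) Z" "x \<in> Z" "Z \<subseteq> preim X f W" "Z \<subseteq> preim X f N"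
        "induced_hom X f N Z \<tau> = restr X (preim X f W) Z \<sigma>"
      using section_descends[OF oW xW \<sigma>] by metis
    \<comment> \<open>Initially \<open>\<tau>\<close> pulls back to \<open>\<sigma>\<close> only on
      \<open>Z\<close>, which may be smaller than the preimage of \<open>N\<close>. Passing to the
      image of \<open>Z\<close> cures this, since by injectivity its preimage is \<open>Z\<close>
      again.\<close>
    define M where "M = pt_map f ` Z"
    have M: "openin (rtop Y) M" "preim X f M = Z" "M \<subseteq> N" "M \<subseteq> W"
      using image_open[OF ft Z(1)] preim_image[OF Z(1)] Z(3,4) by (auto simp: M_def preim_def)
    have "sec_map f M (restr Y N M \<tau>) = restr X (preim X f W) (preim X f M) \<sigma>"
      using sec_map_restr[OF N(1) M(1,3) N(3)] Z(5) M(2) by (simp add: induced_hom_def)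
    then have "M \<in> \<U>" unfolding \<U>_def using M(1,4) Y.restr_closed[OF N(1) M(1,3) N(3)] by blast
    then show "y \<in> \<Union>\<U>" using Z(2) x(2) by (auto simp: M_def)
  qed (use \<U>D in blast)
  have "\<exists>s\<in>carrier (sections Y (\<Union>\<U>)). \<forall>M\<in>\<U>. restr Y (\<Union>\<U>) M s = \<tau> M"
  proof (rule Y.gluing)
    fix M assume M: "M \<in> \<U>"
    then show "openin (rtop Y) M" "\<tau> M \<in> carrier (sections Y M)" using \<U>D \<tau> by blast+
    fix M' assume M': "M' \<in> \<U>"
    let ?I = "M \<inter> M'"
    have I: "openin (rtop Y) ?I" "?I \<subseteq> pt_map f ` points X" using \<U>D[OF M] \<U>D[OF M'] W(2) by auto
    \<comment> \<open>On an overlap both solutions pull back to the same restriction of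
      \<open>\<sigma>\<close>, so injectivity over the overlap identifies them.\<close>
    have val: "sec_map f ?I (restr Y L ?I (\<tau> L)) = restr X (preim X f W) (preim X f ?I) \<sigma>"
      if L: "L \<in> \<U>" "?I \<subseteq> L" for L
    proof -
      have sub: "preim X f ?I \<subseteq> preim X f L" using L(2) by (auto simp: preim_def)
      show ?thesis
        using sec_map_restr[OF \<U>D(1)[OF L(1)] I(1) L(2) \<tau>(1)[OF L(1)]] \<tau>(2)[OF L(1)]
          X.restr_comp[OF oW open_preim[OF \<U>D(1)[OF L(1)]] open_preim[OF I(1)] sub \<U>D(3)[OF L(1)] \<sigma>] by simp
    qed
    have "sec_map f ?I (restr Y M ?I (\<tau> M)) = sec_map f ?I (restr Y M' ?I (\<tau> M'))"
      using val[OF M] val[OF M'] by simp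
    then show "restr Y M ?I (\<tau> M) = restr Y M' ?I (\<tau> M')"
      using inj_onD[OF sec_map_inj[OF I]] Y.restr_closed[OF \<U>D(1)[OF M] I(1) _ \<tau>(1)[OF M]]
        Y.restr_closed[OF \<U>D(1)[OF M'] I(1) _ \<tau>(1)[OF M']] by simp
  qed
  then obtain s where s: "s \<in> carrier (sections Y W)" "\<And>M. M \<in> \<U> \<Longrightarrow> restr Y W M s = \<tau> M"
    unfolding cov by blast
  have "sec_map f W s = \<sigma>"
  proof (rule X.section_eqI[OF oW ring_hom_closed[OF sec_map_hom[OF W(1)] s(1)] \<sigma>])
    fix x assume x: "x \<in> preim X f W"
    then obtain M where M: "M \<in> \<U>" "pt_map f x \<in> M" using cov by (auto simp: preim_def)
    have "restr X (preim X f W) (preim X f M) (sec_map f W s) = restr X (preim X f W) (preim X f M) \<sigma>"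
      using sec_map_restr[OF W(1) \<U>D(1,2)[OF M(1)] s(1)] s(2)[OF M(1)] \<tau>(2)[OF M(1)] by simp
    then show "\<exists>N. openin (rtop X) N \<and> x \<in> N \<and> N \<subseteq> preim X f W \<and>
        restr X (preim X f W) N (sec_map f W s) = restr X (preim X f W) N \<sigma>"
      using open_preim[OF \<U>D(1)[OF M(1)]] \<U>D(3)[OF M(1)] x M(2)
      by (intro exI[of _ "preim X f M"]) (auto simp: preim_def)
  qed
  then show ?thesis using s(1) by blast
qed

end

theorem mainTheorem11:
  fixes X :: "('a, 'r) ringed_space"
    and Y :: "('b, 's) ringed_space"
    and f :: "('a, 'r, 'b, 's) rs_map"
  assumes "localizing_immersion X Y f"
    and "finite_type X Y f"
  shows "open_immersion X Y f"
proof -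
  interpret localizing_immersion X Y f by fact
  define V where "V = pt_map f ` points X"
  have V: "openin (rtop Y) V" unfolding V_def using image_open[OF assms(2) openin_topspace] .
  note sub = openin_open_subspace[OF V]
  have "lrs_iso X (open_subspace Y V) f"
  proof (rule lrs_iso_of_homeomorphism)
    show "locally_ringed_space X" by (rule X.locally_ringed_space_axioms)
    show "ringed_space (open_subspace Y V)" by (rule ringed_space_open_subspace[OF Y.ringed_space_axioms V])
    show "bij_betw (pt_map f) (points X) (points (open_subspace Y V))"
      using inj_on_imp_bij_betw[OF injective] points_open_subspace[OF V] by (simp add: V_def)
    show "openin (rtop (open_subspace Y V)) (pt_map f ` N)" if "openin (rtop X) N" for N
      unfolding sub using image_open[OF assms(2) that] openin_subset[OF that] by (auto simp: V_def)
    fix W assume W: "openin (rtop (open_subspace Y V)) W"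
    then have W': "openin (rtop Y) W" "W \<subseteq> pt_map f ` points X" using sub by (auto simp: V_def)
    show "openin (rtop X) (preim X f W)" using open_preim[OF W'(1)] .
    have "bij_betw (sec_map f W) (carrier (sections Y W)) (carrier (sections X (preim X f W)))"
      using sec_map_inj[OF W'] sec_map_surj[OF assms(2) W'] ring_hom_closed[OF sec_map_hom[OF W'(1)]]
      by (auto simp: bij_betw_def image_iff)
    then show "sec_map f W \<in> ring_iso (sections (open_subspace Y V) W) (sections X (preim X f W))"
      using sec_map_hom[OF W'(1)] by (simp add: ring_iso_def)
    fix W2 t assume "openin (rtop (open_subspace Y V)) W2" "W2 \<subseteq> W" "t \<in> carrier (sections (open_subspace Y V) W)"
    then show "sec_map f W2 (restr (open_subspace Y V) W W2 t) = restr X (preim X f W) (preim X f W2) (sec_map f W t)"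
      using sec_map_restr[OF W'(1)] sub by simp
  qed
  then show ?thesis using V lrs_morphism_axioms by (auto simp: open_immersion_def)
qed

end
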